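(* For unsplittable 3-CVRP there is a polynomial-time $\frac{3}{2}$-approximation algorithm.
   Context: An instance of CVRP consists of a complete graph $G$ on vertex set $V\cup\{v_0\}$, where $V=\{v_1,\dots,v_n\}$ are customers and $v_0$ is the depot; a nonnegative edge weight $w$ that is symmetric and satisfies the triangle inequality; a demand $d_i\in\mathbb{Z}_{\geq1}$ for each customer $v_i$ (with $d_i\le k$); and a vehicle capacity $k$. A tour is a closed walk starting and ending at $v_0$ that delivers a total amount of at most $k$ to the customers on it; a feasible solution (itinerary) is a collection of tours whose deliveries meet every customer's demand, with cost the total weight of traversed edges. In the unsplittable version each customer's whole demand must be delivered by a single tour. $k$-CVRP denotes the problem with fixed capacity $k$. A $\rho$-approximation algorithm runs in polynomial time and outputs a feasible solution of cost at most $\rho$ times the optimum. *)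

theory Defs
  imports Complex_Main "HOL-Computational_Algebra.Polynomial" "HOL-Library.Log_Nat"
begin

section \<open>Polynomial-time computation\<close>

text \<open>
  The model of computation is a first-order, point-free while language over binary trees with
  integers at the leaves. Its cost measure is logarithmic: integers are written in binary, and
  every elementary operation is charged the total length of its argument and its result. Since
  each elementary operation can be carried out by a Turing machine in time polynomial in that
  length, and a Turing machine is simulated step by step by a loop on a tree that holds its
  configuration, "polynomial time" has the same meaning as for Turing machines.
\<close>

datatype val = Leaf int | Node val val

fun vsize :: "val \<Rightarrow> nat" where
  "vsize (Leaf a) = 1 + floorlog 2 (nat \<bar>a\<bar>)"
| "vsize (Node x y) = 1 + vsize x + vsize y"

datatype prim = Copy | Const int | Left | Right | IsNode | Add | Sub | Mul | Div | Less

text \<open>The primitives are total; the value on ill-shaped arguments is an arbitrary convention.\<close>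

fun prim_val :: "prim \<Rightarrow> val \<Rightarrow> val" where
  "prim_val Copy x = x"
| "prim_val (Const c) x = Leaf c"
| "prim_val Left (Node x y) = x"
| "prim_val Right (Node x y) = y"
| "prim_val IsNode (Node x y) = Leaf 1"
| "prim_val Add (Node (Leaf a) (Leaf b)) = Leaf (a + b)"
| "prim_val Sub (Node (Leaf a) (Leaf b)) = Leaf (a - b)"
| "prim_val Mul (Node (Leaf a) (Leaf b)) = Leaf (a * b)"
| "prim_val Div (Node (Leaf a) (Leaf b)) = Leaf (a div b)"
| "prim_val Less (Node (Leaf a) (Leaf b)) = Leaf (if a < b then 1 else 0)"
| "prim_val _ _ = Leaf 0"

datatype prog = Prim prim | Comp prog prog | Fork prog prog | Branch prog prog prog | Loop prog prog

text \<open>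
  \<open>run p x t y\<close>: on input \<open>x\<close> the program \<open>p\<close> halts after time \<open>t\<close> with output \<open>y\<close>.
  \<open>Comp p q\<close> runs \<open>p\<close> first; \<open>Fork\<close> runs both programs on the same input and joins the results;
  a test counts as true unless its result is \<open>Leaf 0\<close>.
\<close>

inductive run :: "prog \<Rightarrow> val \<Rightarrow> nat \<Rightarrow> val \<Rightarrow> bool" where
  Prim: "run (Prim f) x (vsize x + vsize (prim_val f x)) (prim_val f x)"
| Comp: "run p x t y \<Longrightarrow> run q y u z \<Longrightarrow> run (Comp p q) x (t + u) z"
| Fork: "run p x t y \<Longrightarrow> run q x u z \<Longrightarrow> run (Fork p q) x (t + u + 1) (Node y z)"
| BranchTrue: "run c x t b \<Longrightarrow> b \<noteq> Leaf 0 \<Longrightarrow> run p x u y \<Longrightarrow> run (Branch c p q) x (t + u) y"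
| BranchFalse: "run c x t (Leaf 0) \<Longrightarrow> run q x u y \<Longrightarrow> run (Branch c p q) x (t + u) y"
| LoopTrue: "run c x t b \<Longrightarrow> b \<noteq> Leaf 0 \<Longrightarrow> run p x u y \<Longrightarrow> run (Loop c p) y v z \<Longrightarrow>
    run (Loop c p) x (t + u + v) z"
| LoopFalse: "run c x t (Leaf 0) \<Longrightarrow> run (Loop c p) x (t + vsize x) x"

lemma run_deterministic:
  assumes "run p x t y" and "run p x t' y'"
  shows "t' = t \<and> y' = y"
  using assms
proof (induction arbitrary: t' y' rule: run.induct)
  case (Prim f x)
  then show ?case by (auto elim: run.cases)
next
  case (Comp p x t y q u z)
  from Comp.prems show ?case by cases (use Comp.IH in blast)
next
  case (Fork p x t y q u z)
  from Fork.prems show ?case by cases (use Fork.IH in blast)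
next
  case (BranchTrue c x t b p u y q)
  from BranchTrue.prems show ?case by cases (use BranchTrue in blast)+
next
  case (BranchFalse c x t q u y p)
  from BranchFalse.prems show ?case by cases (use BranchFalse.IH in blast)+
next
  case (LoopTrue c x t b p u y v z)
  from LoopTrue.prems show ?case by cases (use LoopTrue in blast)+
next
  case (LoopFalse c x t p)
  from LoopFalse.prems show ?case by cases (use LoopFalse.IH in blast)+
qed

text \<open>No program can build a value that is larger than its running time.\<close>

lemma run_time_ge: "run p x t y \<Longrightarrow> vsize x + vsize y \<le> t"
  by (induction rule: run.induct) auto

definition poly_time :: "val set \<Rightarrow> prog \<Rightarrow> bool" where
  "poly_time A P \<longleftrightarrow> (\<exists>q :: nat poly. \<forall>x\<in>A. \<exists>t y. run P x t y \<and> t \<le> poly q (vsize x))"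

text \<open>
  A minimisation problem is given by its set of instances, the feasible solutions of each
  instance, their costs, and encodings of instances and solutions.
\<close>

definition approximation_algorithm ::
  "real \<Rightarrow> 'i set \<Rightarrow> ('i \<Rightarrow> 's set) \<Rightarrow> ('i \<Rightarrow> 's \<Rightarrow> real) \<Rightarrow> ('i \<Rightarrow> val) \<Rightarrow> ('s \<Rightarrow> val) \<Rightarrow> prog \<Rightarrow> bool"
  where
  "approximation_algorithm \<rho> Insts sol cost encI encS P \<longleftrightarrow>
     poly_time (encI ` Insts) P \<and>
     (\<forall>I\<in>Insts. \<exists>t S. run P (encI I) t (encS S) \<and> S \<in> sol I \<and>
        cost I S \<le> \<rho> * (INF S'\<in>sol I. cost I S'))"


section \<open>Capacitated vehicle routing\<close>

text \<open>
  Vertex \<open>0\<close> is the depot, and the customers are \<open>1, \<dots>, customers I\<close>. Values of \<open>weight\<close> and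
  \<open>demand\<close> outside these ranges are irrelevant. Weights are rational, so that instances are
  finite objects.
\<close>

record cvrp =
  customers :: nat
  weight :: "nat \<Rightarrow> nat \<Rightarrow> rat"
  demand :: "nat \<Rightarrow> nat"

text \<open>
  The complete graph has no loops; \<open>weight I u u = 0\<close> is the usual convention that lets a walk
  stay at a vertex at no cost.
\<close>

definition cvrp_instance :: "nat \<Rightarrow> cvrp \<Rightarrow> bool" where
  "cvrp_instance k I \<longleftrightarrow>
     (\<forall>u\<le>customers I. weight I u u = 0) \<and>
     (\<forall>u\<le>customers I. \<forall>v\<le>customers I. 0 \<le> weight I u v \<and> weight I u v = weight I v u) \<and>
     (\<forall>u\<le>customers I. \<forall>v\<le>customers I. \<forall>x\<le>customers I.
        weight I u x \<le> weight I u v + weight I v x) \<and>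
     (\<forall>i\<in>{1..customers I}. 1 \<le> demand I i \<and> demand I i \<le> k)"

text \<open>
  A tour is the list of its stops between leaving the depot and finally returning to it; each
  stop is a vertex together with the amount delivered there. The walk may pass through the
  depot and may visit a vertex several times.
\<close>

type_synonym tour = "(nat \<times> nat) list"

definition tour_walk :: "tour \<Rightarrow> nat list" where
  "tour_walk T = 0 # map fst T @ [0]"

definition walk_weight :: "cvrp \<Rightarrow> nat list \<Rightarrow> rat" where
  "walk_weight I p = sum_list (map2 (weight I) p (tl p))"

definition delivered :: "tour \<Rightarrow> nat \<Rightarrow> nat" where
  "delivered T i = (\<Sum>(v, a)\<leftarrow>T. if v = i then a else 0)"

definition is_tour :: "nat \<Rightarrow> cvrp \<Rightarrow> tour \<Rightarrow> bool" where
  "is_tour k I T \<longleftrightarrow>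
     (\<forall>v\<in>set (tour_walk T). v \<le> customers I) \<and> delivered T 0 = 0 \<and>
     (\<Sum>i=1..customers I. delivered T i) \<le> k"

type_synonym itinerary = "tour list"

definition feasible :: "nat \<Rightarrow> cvrp \<Rightarrow> itinerary \<Rightarrow> bool" where
  "feasible k I S \<longleftrightarrow>
     (\<forall>T\<in>set S. is_tour k I T) \<and>
     (\<forall>i\<in>{1..customers I}. (\<Sum>T\<leftarrow>S. delivered T i) = demand I i)"

definition unsplittable :: "cvrp \<Rightarrow> itinerary \<Rightarrow> bool" where
  "unsplittable I S \<longleftrightarrow>
     (\<forall>i\<in>{1..customers I}. \<exists>T\<in>set S. delivered T i = demand I i)"

definition itinerary_cost :: "cvrp \<Rightarrow> itinerary \<Rightarrow> real" where
  "itinerary_cost I S = real_of_rat (\<Sum>T\<leftarrow>S. walk_weight I (tour_walk T))"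


section \<open>Encodings\<close>

definition enc_nat :: "nat \<Rightarrow> val" where
  "enc_nat m = Leaf (int m)"

definition enc_rat :: "rat \<Rightarrow> val" where
  "enc_rat r = (case quotient_of r of (a, b) \<Rightarrow> Node (Leaf a) (Leaf b))"

primrec enc_list :: "('a \<Rightarrow> val) \<Rightarrow> 'a list \<Rightarrow> val" where
  "enc_list f [] = Leaf 0"
| "enc_list f (x # xs) = Node (f x) (enc_list f xs)"

definition enc_cvrp :: "cvrp \<Rightarrow> val" where
  "enc_cvrp I =
     Node (enc_nat (customers I))
      (Node (enc_list enc_nat (map (demand I) [1..<customers I + 1]))
        (enc_list (enc_list enc_rat)
          (map (\<lambda>u. map (weight I u) [0..<customers I + 1]) [0..<customers I + 1])))"

definition enc_itinerary :: "itinerary \<Rightarrow> val" where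
  "enc_itinerary = enc_list (enc_list (\<lambda>(v, a). Node (enc_nat v) (enc_nat a)))"

lemma enc_list_eq_iff:
  assumes "\<And>x y. f x = f y \<longleftrightarrow> x = y"
  shows "enc_list f xs = enc_list f ys \<longleftrightarrow> xs = ys"
proof (induction xs arbitrary: ys)
  case Nil
  show ?case by (cases ys) auto
next
  case (Cons x xs)
  then show ?case using assms by (cases ys) auto
qed

lemma inj_enc_itinerary: "inj enc_itinerary"
  unfolding inj_def enc_itinerary_def
  by (auto simp: enc_list_eq_iff enc_nat_def split: prod.splits)

end

theory Submission
  imports Defs
begin

text \<open>
  Let \<open>x\<^sub>v\<close> be the distance of \<open>v\<close> from the depot and \<open>s u v = x\<^sub>u + x\<^sub>v - w u v\<close> what is saved by serving
  \<open>u\<close> and \<open>v\<close> together. Weigh a pair of unit demands by its saving \<open>s u v\<close>, a pair with demands 1 and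
  2 by \<open>s u v / 2\<close>, and every other pair by 0, and compute a permutation of the customers that
  maximises the total weight \<open>W\<close> of its arcs. An even cycle of the permutation is cut into pairs; an
  odd cycle of unit demands into pairs and one triple; an odd cycle through a larger demand into
  pairs and a single customer, and there halving the weight of the two arcs at that demand pays for
  the loss. In each case some rotation of the cycle saves half of the cycle's weight, so the tours
  cost at most \<open>2 * (\<Sum>v. x\<^sub>v) - W / 2\<close>.

  Conversely, an optimal dual solution of the assignment problem splits \<open>W\<close> among the customers, and
  by the triangle inequality a tour through at most three customers costs at least two thirds of
  its share of \<open>2 * (\<Sum>v. x\<^sub>v) - W / 2\<close>. For three unit demands this needs the arcs of the whole
  triangle, which is why permutations are used in place of matchings.
\<close>

section \<open>Polynomial-time functions\<close>

text \<open>The ratio is decided by tours with demands 1 and 2. Such a tour costs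
  \<open>x\<^sub>a + x\<^sub>b + w a b\<close>, while its share of the bound can reach
  \<open>3/2 * (x\<^sub>a + x\<^sub>b) + w a b / 2\<close>; the quotient is 3/2 when
  \<open>w a b = 0\<close>. Halving the weight of these pairs is therefore the largest discount that
  the ratio tolerates, and it suffices for the odd cycles.

  Permutations also keep the optimisation bipartite: augmenting paths suffice and the dual is
  integral. Doubling all weights removes the halves, whence the factors 4, 8 and 6 in the estimates.

  The second obstacle is the cost measure. Polynomially many cheap rounds can still build huge
  values, so every loop needs a size bound on all states that it passes. The invariants of the
  matching and of the cycle decomposition thus serve twice, for correctness and for size. They hold
  for arbitrary tables, with defaults for missing entries, so the time bound does not depend on the
  input being a valid instance.\<close>

class enc =
  fixes enc :: "'a \<Rightarrow> val"

abbreviation sz :: "'a::enc \<Rightarrow> nat" where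
  "sz x \<equiv> vsize (enc x)"

instantiation int :: enc begin
definition enc_int :: "int \<Rightarrow> val" where [simp]: "enc_int = Leaf"
instance ..
end

instantiation nat :: enc begin
definition enc_nat_inst: "enc = enc_nat"
instance ..
end

instantiation rat :: enc begin
definition enc_rat_inst: "enc = enc_rat"
instance ..
end

text \<open>\<open>Leaf 0\<close> is the one value that a test reads as false.\<close>

instantiation bool :: enc begin
definition enc_bool :: "bool \<Rightarrow> val" where "enc_bool b = Leaf (if b then 1 else 0)"
instance ..
end

instantiation prod :: (enc, enc) enc begin
definition enc_prod :: "'a \<times> 'b \<Rightarrow> val" where "enc_prod p = Node (enc (fst p)) (enc (snd p))"
instance ..
end

instantiation list :: (enc) enc begin
definition enc_list_inst: "enc = enc_list enc"
instance ..
end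

lemma enc_nat_simp [simp]: "enc (m::nat) = Leaf (int m)"
  by (simp add: enc_nat_inst enc_nat_def)

lemma enc_pair [simp]: "enc (a, b) = Node (enc a) (enc b)"
  by (simp add: enc_prod_def)

lemma enc_Nil [simp]: "enc [] = Leaf 0"
  and enc_Cons [simp]: "enc (x # xs) = Node (enc x) (enc xs)"
  by (simp_all add: enc_list_inst)

text \<open>The set \<open>A\<close> is a promise on the input. It admits partial operations such as
  \<open>hd\<close>, about whose value on \<open>[]\<close> nothing is known.\<close>

definition ptime :: "'a::enc set \<Rightarrow> ('a \<Rightarrow> 'b::enc) \<Rightarrow> bool" where
  "ptime A f \<longleftrightarrow> (\<exists>P q. \<forall>x\<in>A. \<exists>t. run P (enc x) t (enc (f x)) \<and> t \<le> poly q (sz x))"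

text \<open>Coefficients are natural numbers, so no term decreases; size bounds can therefore be
  chained through polynomials.\<close>

lemma poly_nat_mono: "x \<le> y \<Longrightarrow> poly q x \<le> poly q (y::nat)"
  by (induction q) (auto intro!: add_mono mult_mono)

lemma ptimeI:
  "(\<And>x. x \<in> A \<Longrightarrow> \<exists>t. run P (enc x) t (enc (f x)) \<and> t \<le> poly q (sz x)) \<Longrightarrow> ptime A f"
  unfolding ptime_def by blast

lemma ptime_subset: "ptime B f \<Longrightarrow> A \<subseteq> B \<Longrightarrow> ptime A f"
  unfolding ptime_def by blast

lemma ptime_cong: "ptime A f \<Longrightarrow> (\<And>x. x \<in> A \<Longrightarrow> f x = g x) \<Longrightarrow> ptime A g"
  unfolding ptime_def by (metis (no_types, lifting))

text \<open>Writing the output takes time, so a polynomial running time already bounds the size of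
  the value.\<close>

lemma ptime_size:
  assumes "ptime A f"
  shows "\<exists>q. \<forall>x\<in>A. sz (f x) \<le> poly q (sz x)"
proof -
  obtain P q where "\<forall>x\<in>A. \<exists>t. run P (enc x) t (enc (f x)) \<and> t \<le> poly q (sz x)"
    using assms unfolding ptime_def by blast
  then have "\<forall>x\<in>A. sz (f x) \<le> poly q (sz x)"
    by (meson add_leD2 le_trans run_time_ge)
  then show ?thesis by blast
qed

lemma ptime_comp:
  assumes f: "ptime A f" and g: "ptime B g" and AB: "\<And>x. x \<in> A \<Longrightarrow> f x \<in> B"
  shows "ptime A (\<lambda>x. g (f x))"
proof -
  obtain P p where P: "\<forall>x\<in>A. \<exists>t. run P (enc x) t (enc (f x)) \<and> t \<le> poly p (sz x)"
    using f unfolding ptime_def by blast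
  obtain Q q where Q: "\<forall>x\<in>B. \<exists>t. run Q (enc x) t (enc (g x)) \<and> t \<le> poly q (sz x)"
    using g unfolding ptime_def by blast
  show ?thesis
  proof (rule ptimeI[where P = "Comp P Q" and q = "p + pcompose q p"])
    fix x assume x: "x \<in> A"
    obtain t where t: "run P (enc x) t (enc (f x))" "t \<le> poly p (sz x)" using P x by blast
    obtain u where u: "run Q (enc (f x)) u (enc (g (f x)))" "u \<le> poly q (sz (f x))"
      using Q AB[OF x] by blast
    have "sz (f x) \<le> poly p (sz x)" using run_time_ge[OF t(1)] t(2) by linarith
    then have "u \<le> poly q (poly p (sz x))" using u(2) poly_nat_mono le_trans by blast
    then show "\<exists>t. run (Comp P Q) (enc x) t (enc (g (f x))) \<and> t \<le> poly (p + pcompose q p) (sz x)"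
      using run.Comp[OF t(1) u(1)] t(2) by (auto simp: poly_pcompose intro!: exI add_mono)
  qed
qed

lemma ptime_pair:
  assumes f: "ptime A f" and g: "ptime A g"
  shows "ptime A (\<lambda>x. (f x, g x))"
proof -
  obtain P p where P: "\<forall>x\<in>A. \<exists>t. run P (enc x) t (enc (f x)) \<and> t \<le> poly p (sz x)"
    using f unfolding ptime_def by blast
  obtain Q q where Q: "\<forall>x\<in>A. \<exists>t. run Q (enc x) t (enc (g x)) \<and> t \<le> poly q (sz x)"
    using g unfolding ptime_def by blast
  show ?thesis
  proof (rule ptimeI[where P = "Fork P Q" and q = "p + q + 1"])
    fix x assume x: "x \<in> A"
    obtain t u where "run P (enc x) t (enc (f x))" "t \<le> poly p (sz x)"
      "run Q (enc x) u (enc (g x))" "u \<le> poly q (sz x)" using P Q x by blast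
    then show "\<exists>t. run (Fork P Q) (enc x) t (enc (f x, g x)) \<and> t \<le> poly (p + q + 1) (sz x)"
      by (auto intro!: exI[of _ "t + u + 1"] run.Fork)
  qed
qed

text \<open>Each branch has to be polynomial only where its guard holds. This is how a test for
  emptiness justifies a later \<open>hd\<close>.\<close>

lemma ptime_if:
  assumes c: "ptime A c" and f: "ptime {x \<in> A. c x} f" and g: "ptime {x \<in> A. \<not> c x} g"
  shows "ptime A (\<lambda>x. if c x then f x else g x)"
proof -
  obtain C r where C: "\<forall>x\<in>A. \<exists>t. run C (enc x) t (enc (c x)) \<and> t \<le> poly r (sz x)"
    using c unfolding ptime_def by blast
  obtain P p where P: "\<forall>x\<in>{x \<in> A. c x}. \<exists>t. run P (enc x) t (enc (f x)) \<and> t \<le> poly p (sz x)"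
    using f unfolding ptime_def by blast
  obtain Q q where Q: "\<forall>x\<in>{x \<in> A. \<not> c x}. \<exists>t. run Q (enc x) t (enc (g x)) \<and> t \<le> poly q (sz x)"
    using g unfolding ptime_def by blast
  show ?thesis
  proof (rule ptimeI[where P = "Branch C P Q" and q = "r + p + q"])
    fix x assume x: "x \<in> A"
    obtain t where t: "run C (enc x) t (enc (c x))" "t \<le> poly r (sz x)" using C x by blast
    show "\<exists>t. run (Branch C P Q) (enc x) t (enc (if c x then f x else g x))
        \<and> t \<le> poly (r + p + q) (sz x)"
    proof (cases "c x")
      case True
      then obtain u where "run P (enc x) u (enc (f x))" "u \<le> poly p (sz x)" using P x by blast
      with t True show ?thesis
        by (auto intro!: exI[of _ "t + u"] run.BranchTrue simp: enc_bool_def)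
    next
      case False
      then obtain u where "run Q (enc x) u (enc (g x))" "u \<le> poly q (sz x)" using Q x by blast
      with t False show ?thesis
        by (auto intro!: exI[of _ "t + u"] run.BranchFalse simp: enc_bool_def)
    qed
  qed
qed

lemma ptime_prim:
  assumes "\<And>x. x \<in> A \<Longrightarrow> prim_val pr (enc x) = enc (f x)"
    and "\<And>x. x \<in> A \<Longrightarrow> sz (f x) \<le> sz x + c"
  shows "ptime A f"
proof (rule ptimeI[where P = "Prim pr" and q = "[:c, 2:]"])
  fix x assume "x \<in> A"
  then show "\<exists>t. run (Prim pr) (enc x) t (enc (f x)) \<and> t \<le> poly [:c, 2:] (sz x)"
    using run.Prim[of pr "enc x"] assms[of x]
    by (auto intro!: exI[of _ "sz x + sz (f x)"])
qed

lemma ptime_id: "ptime A (\<lambda>x. x)"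
  by (rule ptime_prim[where pr = Copy and c = 0]) auto

text \<open>Only integers are available as constants, so a tree is assembled by \<open>Fork\<close>.
  Every leaf is charged for reading the input, which makes the time linear in the input
  size.\<close>

lemma ptime_const: "ptime A (\<lambda>x. c)"
proof -
  have "\<exists>P k. \<forall>x. \<exists>t. run P x t v \<and> t \<le> k + 2 * k * vsize x" for v
  proof (induction v)
    case (Leaf a)
    show ?case
      by (rule exI[of _ "Prim (Const a)"], rule exI[of _ "vsize (Leaf a) + 1"])
        (auto intro!: exI run.Prim[of "Const a", simplified])
  next
    case (Node v w)
    obtain P k Q l where P: "\<And>x. \<exists>t. run P x t v \<and> t \<le> k + 2 * k * vsize x"
      and Q: "\<And>x. \<exists>t. run Q x t w \<and> t \<le> l + 2 * l * vsize x"
      using Node by metis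
    show ?case
    proof (rule exI[of _ "Fork P Q"], rule exI[of _ "k + l + 1"], intro allI)
      fix x
      obtain t u where "run P x t v" "t \<le> k + 2 * k * vsize x" "run Q x u w"
        "u \<le> l + 2 * l * vsize x" using P Q by metis
      then show "\<exists>t. run (Fork P Q) x t (Node v w) \<and> t \<le> k + l + 1 + 2 * (k + l + 1) * vsize x"
        by (intro exI[of _ "t + u + 1"] conjI run.Fork) (auto simp: algebra_simps)
    qed
  qed
  then obtain P k where P: "\<And>x. \<exists>t. run P x t (enc c) \<and> t \<le> k + 2 * k * vsize x" by metis
  show ?thesis
    by (rule ptimeI[where P = P and q = "[:k, 2 * k:]"]) (use P in \<open>auto simp: algebra_simps\<close>)
qed

text \<open>\<open>S\<close> is the invariant. A bound on the number of rounds alone would not do,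
  since a value may double in size in every round; hence one polynomial of the initial size bounds
  both the rounds and all states.\<close>

lemma ptime_while:
  assumes c: "ptime S c" and body: "ptime {s \<in> S. c s} body"
    and iter: "\<And>s. s \<in> A \<Longrightarrow> \<exists>k \<le> poly q (sz s).
      (\<forall>i\<le>k. (body ^^ i) s \<in> S \<and> sz ((body ^^ i) s) \<le> poly q (sz s)) \<and>
      (\<forall>i<k. c ((body ^^ i) s)) \<and> \<not> c ((body ^^ k) s) \<and> f s = (body ^^ k) s"
  shows "ptime A f"
proof -
  obtain C r where C: "\<forall>x\<in>S. \<exists>t. run C (enc x) t (enc (c x)) \<and> t \<le> poly r (sz x)"
    using c unfolding ptime_def by blast
  obtain P p where P: "\<forall>x\<in>{x \<in> S. c x}. \<exists>t. run P (enc x) t (enc (body x)) \<and> t \<le> poly p (sz x)"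
    using body unfolding ptime_def by blast
  \<comment> \<open>With every state of size at most \<open>B\<close>, a round costs at most
    \<open>poly r B + poly p B\<close>; the final failing test and the charge for the returned state
    add \<open>poly r B + B\<close>.\<close>
  have loop: "\<exists>t. run (Loop C P) (enc s) t (enc ((body ^^ k) s)) \<and>
      t \<le> k * (poly r B + poly p B) + poly r B + B"
    if "\<forall>i\<le>k. (body ^^ i) s \<in> S \<and> sz ((body ^^ i) s) \<le> B"
      "\<forall>i<k. c ((body ^^ i) s)" "\<not> c ((body ^^ k) s)" for k s B
    using that
  proof (induction k arbitrary: s)
    case 0
    then obtain t where t: "run C (enc s) t (enc False)" "t \<le> poly r (sz s)" using C
      by fastforce
    have "poly r (sz s) \<le> poly r B" using 0 by (simp add: poly_nat_mono)
    then show ?case using t 0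
      by (auto intro!: exI[of _ "t + sz s"] run.LoopFalse simp: enc_bool_def)
  next
    case (Suc k)
    have s: "s \<in> S" "c s" "sz s \<le> B"
      using Suc.prems(1)[rule_format, of 0] Suc.prems(2)[rule_format, of 0] by auto
    obtain t where t: "run C (enc s) t (enc True)" "t \<le> poly r (sz s)" using C s by fastforce
    obtain u where u: "run P (enc s) u (enc (body s))" "u \<le> poly p (sz s)" using P s by fastforce
    have "\<exists>v. run (Loop C P) (enc (body s)) v (enc ((body ^^ k) (body s))) \<and>
      v \<le> k * (poly r B + poly p B) + poly r B + B"
    proof (rule Suc.IH)
      show "\<forall>i\<le>k. (body ^^ i) (body s) \<in> S \<and> sz ((body ^^ i) (body s)) \<le> B"
        using Suc.prems(1) by (metis Suc_le_mono funpow_swap1 funpow.simps(2) o_apply)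
      show "\<forall>i<k. c ((body ^^ i) (body s))"
        using Suc.prems(2) by (metis Suc_less_eq funpow_swap1 funpow.simps(2) o_apply)
      show "\<not> c ((body ^^ k) (body s))"
        using Suc.prems(3) by (metis funpow_swap1 funpow.simps(2) o_apply)
    qed
    then obtain v where v: "run (Loop C P) (enc (body s)) v (enc ((body ^^ k) (body s)))"
      "v \<le> k * (poly r B + poly p B) + poly r B + B" by blast
    have "poly r (sz s) \<le> poly r B" "poly p (sz s) \<le> poly p B" using s by (simp_all add: poly_nat_mono)
    moreover have "run (Loop C P) (enc s) (t + u + v) (enc ((body ^^ Suc k) s))"
      using run.LoopTrue[OF t(1) _ u(1) v(1)] by (simp add: enc_bool_def funpow_swap1)
    ultimately show ?case using t(2) u(2) v(2)
      by (intro exI[of _ "t + u + v"]) (auto simp: algebra_simps)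
  qed
  show ?thesis
  proof (rule ptimeI[where P = "Loop C P" and
        q = "q * (pcompose r q + pcompose p q) + pcompose r q + q"])
    fix s assume "s \<in> A"
    from iter[OF this] obtain k where k: "k \<le> poly q (sz s)"
      "\<forall>i\<le>k. (body ^^ i) s \<in> S \<and> sz ((body ^^ i) s) \<le> poly q (sz s)"
      "\<forall>i<k. c ((body ^^ i) s)" "\<not> c ((body ^^ k) s)" "f s = (body ^^ k) s" by blast
    from loop[OF k(2-4)] obtain t where t: "run (Loop C P) (enc s) t (enc (f s))"
      "t \<le> k * (poly r (poly q (sz s)) + poly p (poly q (sz s))) + poly r (poly q (sz s)) + poly q (sz s)"
      unfolding k(5) by blast
    have "t \<le> poly q (sz s) * (poly r (poly q (sz s)) + poly p (poly q (sz s)))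
        + poly r (poly q (sz s)) + poly q (sz s)"
      using t(2) k(1) by (meson add_le_mono1 le_trans mult_le_mono1)
    with t(1) show "\<exists>t. run (Loop C P) (enc s) t (enc (f s)) \<and>
        t \<le> poly (q * (pcompose r q + pcompose p q) + pcompose r q + q) (sz s)"
      by (auto simp: poly_pcompose)
  qed
qed

section \<open>Closure rules for several arguments, pairs, lists and truth values\<close>

lemma ptime_comp1:
  "ptime UNIV g \<Longrightarrow> ptime A f \<Longrightarrow> ptime A (\<lambda>x. g (f x))"
  by (rule ptime_comp) auto

lemma ptime_comp2:
  "ptime UNIV (\<lambda>p. g (fst p) (snd p)) \<Longrightarrow> ptime A f \<Longrightarrow> ptime A h \<Longrightarrow> ptime A (\<lambda>x. g (f x) (h x))"
  using ptime_comp1[of "\<lambda>p. g (fst p) (snd p)" A "\<lambda>x. (f x, h x)"] ptime_pair[of A f h] by simp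

lemma ptime_comp3:
  "ptime UNIV (\<lambda>p. g (fst p) (fst (snd p)) (snd (snd p))) \<Longrightarrow> ptime A f \<Longrightarrow> ptime A h \<Longrightarrow>
    ptime A k \<Longrightarrow> ptime A (\<lambda>x. g (f x) (h x) (k x))"
  using ptime_comp1[of "\<lambda>p. g (fst p) (fst (snd p)) (snd (snd p))" A "\<lambda>x. (f x, (h x, k x))"]
    ptime_pair[of A f "\<lambda>x. (h x, k x)"] ptime_pair[of A h k] by simp

lemma ptime_fst: "ptime A f \<Longrightarrow> ptime A (\<lambda>x. fst (f x))"
  by (rule ptime_comp1, rule ptime_prim[where pr = Left and c = 0]) (auto simp: enc_prod_def)

lemma ptime_snd: "ptime A f \<Longrightarrow> ptime A (\<lambda>x. snd (f x))"
  by (rule ptime_comp1, rule ptime_prim[where pr = Right and c = 0]) (auto simp: enc_prod_def)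

text \<open>A list cell is encoded like a pair.\<close>

lemma ptime_Cons: "ptime A f \<Longrightarrow> ptime A g \<Longrightarrow> ptime A (\<lambda>x. f x # g x)"
  using ptime_pair[of A f g] unfolding ptime_def by simp

text \<open>No promise is involved as for \<open>hd\<close>: \<open>tl [] = []\<close> agrees with
  the default value \<open>Leaf 0\<close> of the primitive.\<close>

lemma ptime_tl: "ptime A f \<Longrightarrow> ptime A (\<lambda>x. tl (f x))"
proof (rule ptime_comp1[where g = tl], rule ptime_prim[where pr = Right and c = 0])
  fix x :: "'b list"
  show "prim_val Right (enc x) = enc (tl x)" by (cases x) auto
  show "sz (tl x) \<le> sz x + 0" by (cases x) auto
qed

lemma ptime_hd: "ptime A f \<Longrightarrow> (\<And>x. x \<in> A \<Longrightarrow> f x \<noteq> []) \<Longrightarrow> ptime A (\<lambda>x. hd (f x))"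
proof (rule ptime_comp[where B = "{xs. xs \<noteq> []}" and g = hd], assumption,
    rule ptime_prim[where pr = Left and c = 0])
  fix x :: "'b list" assume "x \<in> {xs. xs \<noteq> []}"
  then show "prim_val Left (enc x) = enc (hd x)" "sz (hd x) \<le> sz x + 0" by (cases x; auto)+
qed auto

lemma ptime_not_Nil: "ptime A f \<Longrightarrow> ptime A (\<lambda>x. f x \<noteq> [])"
proof (rule ptime_comp1[where g = "\<lambda>x. x \<noteq> []"], rule ptime_prim[where pr = IsNode and c = 1])
  fix x :: "'b list"
  show "prim_val IsNode (enc x) = enc (x \<noteq> [])" by (cases x) (auto simp: enc_bool_def)
  show "sz (x \<noteq> []) \<le> sz x + 1" by (cases x) (auto simp: enc_bool_def floorlog_def)
qed

lemma ptime_not: "ptime A f \<Longrightarrow> ptime A (\<lambda>x. \<not> f x)"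
  by (rule ptime_cong[OF ptime_if[of A f "\<lambda>_. False" "\<lambda>_. True"]]) (auto intro: ptime_const)

lemma ptime_conj: "ptime A f \<Longrightarrow> ptime {x \<in> A. f x} g \<Longrightarrow> ptime A (\<lambda>x. f x \<and> g x)"
  by (rule ptime_cong[OF ptime_if[of A f g "\<lambda>_. False"]]) (auto intro: ptime_const)

lemma ptime_disj: "ptime A f \<Longrightarrow> ptime {x \<in> A. \<not> f x} g \<Longrightarrow> ptime A (\<lambda>x. f x \<or> g x)"
  by (rule ptime_cong[OF ptime_if[of A f "\<lambda>_. True" g]]) (auto intro: ptime_const)

lemma ptime_Nil_eq: "ptime A f \<Longrightarrow> ptime A (\<lambda>x. f x = [])"
  using ptime_not[OF ptime_not_Nil] by simp

text \<open>Natural numbers and integers share their encoding, so the conversion is free and the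
  rules for integers carry over.\<close>

lemma ptime_int: "ptime A f \<Longrightarrow> ptime A (\<lambda>x. int (f x))"
  unfolding ptime_def by simp

section \<open>Bit lengths and arithmetic\<close>

lemma floorlog2_le: "x < 2 ^ k \<Longrightarrow> floorlog 2 x \<le> k"
  by (rule floorlog_leI) auto

lemma less_two_power_floorlog: "x < 2 ^ floorlog 2 x"
  by (rule floorlog_leD) auto

lemma floorlog2_add: "floorlog 2 (x + y) \<le> floorlog 2 x + floorlog 2 y + 1"
proof (rule floorlog2_le)
  have "x < 2 ^ (floorlog 2 x + floorlog 2 y)" "y < 2 ^ (floorlog 2 x + floorlog 2 y)"
    using less_two_power_floorlog[of x] less_two_power_floorlog[of y]
    by (auto simp: power_add intro: order_less_le_trans[of _ "2 ^ _"])
  then show "x + y < 2 ^ (floorlog 2 x + floorlog 2 y + 1)" by simp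
qed

lemma floorlog2_mult: "floorlog 2 (x * y) \<le> floorlog 2 x + floorlog 2 y"
proof (rule floorlog2_le)
  show "x * y < 2 ^ (floorlog 2 x + floorlog 2 y)"
    using less_two_power_floorlog[of x] less_two_power_floorlog[of y]
    by (simp add: power_add mult_strict_mono)
qed

lemma floorlog2_le_self: "floorlog 2 x \<le> x"
  by (rule floorlog2_le) (rule less_exp)

lemma ptime_add_int: "ptime A f \<Longrightarrow> ptime A g \<Longrightarrow> ptime A (\<lambda>x. f x + g x :: int)"
proof (rule ptime_comp2[where g = "(+)"], rule ptime_prim[where pr = Add and c = 1])
  fix p :: "int \<times> int"
  have "floorlog 2 (nat \<bar>fst p + snd p\<bar>) \<le> floorlog 2 (nat \<bar>fst p\<bar> + nat \<bar>snd p\<bar>)"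
    by (rule floorlog_mono) linarith
  then show "sz (fst p + snd p) \<le> sz p + 1"
    using floorlog2_add[of "nat \<bar>fst p\<bar>" "nat \<bar>snd p\<bar>"] by (cases p) simp
qed (auto simp: enc_prod_def)

lemma ptime_diff_int: "ptime A f \<Longrightarrow> ptime A g \<Longrightarrow> ptime A (\<lambda>x. f x - g x :: int)"
proof (rule ptime_comp2[where g = "(-)"], rule ptime_prim[where pr = Sub and c = 1])
  fix p :: "int \<times> int"
  have "floorlog 2 (nat \<bar>fst p - snd p\<bar>) \<le> floorlog 2 (nat \<bar>fst p\<bar> + nat \<bar>snd p\<bar>)"
    by (rule floorlog_mono) linarith
  then show "sz (fst p - snd p) \<le> sz p + 1"
    using floorlog2_add[of "nat \<bar>fst p\<bar>" "nat \<bar>snd p\<bar>"] by (cases p) simp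
qed (auto simp: enc_prod_def)

lemma sz_mult_int: "sz (a * b :: int) \<le> sz a + sz b"
  using floorlog2_mult[of "nat \<bar>a\<bar>" "nat \<bar>b\<bar>"] by (simp add: abs_mult nat_mult_distrib)

lemma ptime_mult_int: "ptime A f \<Longrightarrow> ptime A g \<Longrightarrow> ptime A (\<lambda>x. f x * g x :: int)"
proof (rule ptime_comp2[where g = "(*)"], rule ptime_prim[where pr = Mul and c = 0])
  fix p :: "int \<times> int"
  show "sz (fst p * snd p) \<le> sz p + 0"
    using sz_mult_int[of "fst p" "snd p"] by (cases p) simp
qed (auto simp: enc_prod_def)

text \<open>Rounding down moves a negative quotient away from zero, but never beyond the dividend:
  the divisor 1 is the extreme case, and division by 0 gives 0.\<close>

lemma abs_div_le_abs: "\<bar>a div b\<bar> \<le> \<bar>a :: int\<bar>"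
proof -
  have pos: "\<bar>a div b\<bar> \<le> \<bar>a\<bar>" if "b > 0" for a b :: int
  proof (cases "a \<ge> 0")
    case True
    then show ?thesis using that zdiv_mono2[of a 1 b] by (simp add: pos_imp_zdiv_nonneg_iff)
  next
    case False
    then show ?thesis using that zdiv_mono2_neg[of a 1 b] by (simp add: pos_imp_zdiv_neg_iff abs_of_neg)
  qed
  show ?thesis
  proof (cases b "0 :: int" rule: linorder_cases)
    case less
    then show ?thesis using pos[of "- b" "- a"] by simp
  qed (use pos in auto)
qed

lemma ptime_div_int: "ptime A f \<Longrightarrow> ptime A g \<Longrightarrow> ptime A (\<lambda>x. f x div g x :: int)"
proof (rule ptime_comp2[where g = "(div)"], rule ptime_prim[where pr = Div and c = 0])
  fix p :: "int \<times> int"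
  show "sz (fst p div snd p) \<le> sz p + 0"
    using floorlog_mono[of "nat \<bar>fst p div snd p\<bar>" "nat \<bar>fst p\<bar>" 2] abs_div_le_abs[of "fst p" "snd p"]
    by (cases p) (simp add: nat_mono)
qed (auto simp: enc_prod_def)

lemma ptime_less_int: "ptime A f \<Longrightarrow> ptime A g \<Longrightarrow> ptime A (\<lambda>x. f x < (g x :: int))"
  by (rule ptime_comp2, rule ptime_prim[where pr = Less and c = 1])
    (auto simp: enc_prod_def enc_bool_def floorlog_def)

lemma ptime_le_int: "ptime A f \<Longrightarrow> ptime A g \<Longrightarrow> ptime A (\<lambda>x. f x \<le> (g x :: int))"
  using ptime_not[OF ptime_less_int[of A g f]] by (simp add: not_less)

lemma ptime_eq_int: "ptime A f \<Longrightarrow> ptime A g \<Longrightarrow> ptime A (\<lambda>x. f x = (g x :: int))"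
  by (rule ptime_cong[OF ptime_conj[OF ptime_le_int[of A f g] ptime_subset[OF ptime_le_int[of A g f]]]])
    auto

lemma ptime_less_nat: "ptime A f \<Longrightarrow> ptime A g \<Longrightarrow> ptime A (\<lambda>x. f x < (g x :: nat))"
  using ptime_less_int[OF ptime_int ptime_int] by simp

lemma ptime_le_nat: "ptime A f \<Longrightarrow> ptime A g \<Longrightarrow> ptime A (\<lambda>x. f x \<le> (g x :: nat))"
  using ptime_le_int[OF ptime_int ptime_int] by simp

lemma ptime_eq_nat: "ptime A f \<Longrightarrow> ptime A g \<Longrightarrow> ptime A (\<lambda>x. f x = (g x :: nat))"
  using ptime_eq_int[OF ptime_int ptime_int] by simp

lemma ptime_add_nat: "ptime A f \<Longrightarrow> ptime A g \<Longrightarrow> ptime A (\<lambda>x. f x + g x :: nat)"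
  using ptime_add_int[OF ptime_int ptime_int, of A f g] unfolding ptime_def by simp

lemma ptime_Suc: "ptime A f \<Longrightarrow> ptime A (\<lambda>x. Suc (f x))"
  using ptime_add_nat[of A f "\<lambda>_. 1"] by (simp add: ptime_const)

text \<open>A rational is stored as its reduced fraction, so numerator and denominator are mere
  projections.\<close>

lemma ptime_numerator: "ptime A f \<Longrightarrow> ptime A (\<lambda>x. fst (quotient_of (f x)))"
  by (rule ptime_comp1, rule ptime_prim[where pr = Left and c = 0])
    (auto simp: enc_rat_inst enc_rat_def split: prod.splits)

lemma ptime_denominator: "ptime A f \<Longrightarrow> ptime A (\<lambda>x. snd (quotient_of (f x)))"
  by (rule ptime_comp1, rule ptime_prim[where pr = Right and c = 0])
    (auto simp: enc_rat_inst enc_rat_def split: prod.splits)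

section \<open>Loops over lists\<close>

lemma sz_le_sz_list: "e \<in> set xs \<Longrightarrow> sz e \<le> sz xs"
  by (induction xs) auto

lemma length_le_sz: "length xs \<le> sz xs"
  by (induction xs) auto

lemma sz_list_le: "(\<And>e. e \<in> set xs \<Longrightarrow> sz e \<le> k) \<Longrightarrow> sz xs \<le> 1 + length xs * (k + 1)"
proof (induction xs)
  case (Cons x xs)
  then have "sz x \<le> k" "sz xs \<le> 1 + length xs * (k + 1)" by auto
  then show ?case by simp
qed (simp add: floorlog_def)

lemma sz_suffix: "sz zs \<le> sz (ys @ zs)"
  by (induction ys) auto

text \<open>A fold is a loop on the parameter, the remaining list and the accumulator. Both the step
  and the size bound refer only to accumulators that some prefix of the list produces, so that
  invariants of the fold can be brought in.\<close>

lemma ptime_fold: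
  fixes g :: "'a::enc \<Rightarrow> 'e::enc \<Rightarrow> 'c::enc \<Rightarrow> 'c"
  assumes init: "ptime A init" and xs: "ptime A xs"
    and g: "ptime {(x, e, acc). x \<in> A \<and> (\<exists>ys zs. xs x = ys @ e # zs \<and> acc = fold (g x) ys (init x))}
      (\<lambda>p. g (fst p) (fst (snd p)) (snd (snd p)))"
    and bound: "\<And>x ys zs. x \<in> A \<Longrightarrow> xs x = ys @ zs \<Longrightarrow> sz (fold (g x) ys (init x)) \<le> poly q (sz x)"
  shows "ptime A (\<lambda>x. fold (g x) (xs x) (init x))"
proof -
  \<comment> \<open>The reachable states: a suffix of the list, with the fold of the matching
    prefix.\<close>
  define S where "S = {(x, l, acc). x \<in> A \<and> (\<exists>ys. xs x = ys @ l \<and> acc = fold (g x) ys (init x))}"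
  define cnd where "cnd = (\<lambda>s :: 'a \<times> 'e list \<times> 'c. fst (snd s) \<noteq> [])"
  define body where "body = (\<lambda>s :: 'a \<times> 'e list \<times> 'c.
    (fst s, tl (fst (snd s)), g (fst s) (hd (fst (snd s))) (snd (snd s))))"
  define B where "B = {(x, e, acc). x \<in> A \<and> (\<exists>ys zs. xs x = ys @ e # zs \<and> acc = fold (g x) ys (init x))}"
  have c: "ptime S cnd"
    unfolding cnd_def by (intro ptime_not_Nil ptime_fst ptime_snd ptime_id)
  have step: "ptime {s \<in> S. cnd s} (\<lambda>s. g (fst s) (hd (fst (snd s))) (snd (snd s)))"
  proof -
    have "ptime {s \<in> S. cnd s} (\<lambda>s. (fst s, hd (fst (snd s)), snd (snd s)))"
      by (intro ptime_pair ptime_hd ptime_fst ptime_snd ptime_id) (auto simp: cnd_def)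
    from ptime_comp[OF this g] show ?thesis
      by (force simp: S_def cnd_def neq_Nil_conv)
  qed
  have b: "ptime {s \<in> S. cnd s} body"
    unfolding body_def by (intro ptime_pair ptime_tl step ptime_fst ptime_snd ptime_id)
  define A' where "A' = {(x, l, acc). x \<in> A \<and> l = xs x \<and> acc = init x}"
  have pow: "(body ^^ i) (x, xs x, init x) = (x, drop i (xs x), fold (g x) (take i (xs x)) (init x))"
    if "i \<le> length (xs x)" for i x
    using that
  proof (induction i)
    case (Suc i)
    then show ?case
      by (simp add: body_def take_Suc_conv_app_nth hd_drop_conv_nth tl_drop drop_Suc)
  qed simp
  have "ptime A' (\<lambda>s. (fst s, [] :: 'e list, fold (g (fst s)) (fst (snd s)) (snd (snd s))))"
  proof (rule ptime_while[OF c b, where q = "q + [:1, 1:] + [:1, 1:]"])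
    fix s assume "s \<in> A'"
    then obtain x where s: "s = (x, xs x, init x)" and x: "x \<in> A" by (auto simp: A'_def)
    let ?k = "length (xs x)" and ?q = "q + [:1, 1:] + [:1, 1:]"
    show "\<exists>k\<le>poly ?q (sz s). (\<forall>i\<le>k. (body ^^ i) s \<in> S \<and> sz ((body ^^ i) s) \<le> poly ?q (sz s)) \<and>
      (\<forall>i<k. cnd ((body ^^ i) s)) \<and> \<not> cnd ((body ^^ k) s) \<and>
      (fst s, [], fold (g (fst s)) (fst (snd s)) (snd (snd s))) = (body ^^ k) s"
    proof (intro exI[of _ ?k] conjI allI impI)
      have "?k \<le> sz s" using length_le_sz[of "xs x"] by (simp add: s)
      then show "?k \<le> poly ?q (sz s)" by simp
      fix i assume i: "i \<le> ?k"
      show "(body ^^ i) s \<in> S"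
        unfolding s pow[OF i] S_def using x by (auto intro!: exI[of _ "take i (xs x)"])
      have "sz (fold (g x) (take i (xs x)) (init x)) \<le> poly q (sz x)"
        using bound[OF x, of "take i (xs x)" "drop i (xs x)"] by simp
      also have "\<dots> \<le> poly q (sz s)" by (rule poly_nat_mono) (simp add: s)
      finally show "sz ((body ^^ i) s) \<le> poly ?q (sz s)"
        using sz_suffix[of "drop i (xs x)" "take i (xs x)"]
        unfolding s pow[OF i] by simp
    next
      fix i assume "i < ?k"
      then show "cnd ((body ^^ i) s)" using pow[of i x] by (simp add: s cnd_def)
    next
      show "\<not> cnd ((body ^^ ?k) s)" using pow[of ?k x] by (simp add: s cnd_def)
      show "(fst s, [], fold (g (fst s)) (fst (snd s)) (snd (snd s))) = (body ^^ ?k) s"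
        using pow[of ?k x] by (simp add: s)
    qed
  qed
  then have "ptime A' (\<lambda>s. snd (snd (fst s, [] :: 'e list, fold (g (fst s)) (fst (snd s)) (snd (snd s)))))"
    by (intro ptime_snd)
  moreover have "ptime A (\<lambda>x. (x, xs x, init x))"
    by (intro ptime_pair init xs ptime_id)
  ultimately show ?thesis
    using ptime_comp[of A "\<lambda>x. (x, xs x, init x)" A'
        "\<lambda>s. fold (g (fst s)) (fst (snd s)) (snd (snd s))"]
    by (simp add: A'_def)
qed

text \<open>If a step enlarges the accumulator by an amount that does not depend on the accumulator,
  the growth over the whole list is linear in its length. Most loops are of this kind.\<close>

lemma ptime_fold_add:
  fixes g :: "'a::enc \<Rightarrow> 'e::enc \<Rightarrow> 'c::enc \<Rightarrow> 'c"
  assumes init: "ptime A init" and xs: "ptime A xs"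
    and g: "ptime {p. fst p \<in> A \<and> fst (snd p) \<in> set (xs (fst p))} (\<lambda>p. g (fst p) (fst (snd p)) (snd (snd p)))"
    and bound: "\<And>x e acc. x \<in> A \<Longrightarrow> e \<in> set (xs x) \<Longrightarrow> sz (g x e acc) \<le> sz acc + poly q (sz x + sz e)"
  shows "ptime A (\<lambda>x. fold (g x) (xs x) (init x))"
proof -
  obtain p where p: "\<And>x. x \<in> A \<Longrightarrow> sz (init x) \<le> poly p (sz x)"
    using ptime_size[OF init] by blast
  obtain r where r: "\<And>x. x \<in> A \<Longrightarrow> sz (xs x) \<le> poly r (sz x)"
    using ptime_size[OF xs] by blast
  show ?thesis
  proof (rule ptime_fold[OF init xs, where q = "p + r * pcompose q ([:0, 1:] + r)"])
    show "ptime {(x, e, acc). x \<in> A \<and> (\<exists>ys zs. xs x = ys @ e # zs \<and> acc = fold (g x) ys (init x))}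
      (\<lambda>p. g (fst p) (fst (snd p)) (snd (snd p)))"
      by (rule ptime_subset[OF g]) force
    fix x ys zs assume x: "x \<in> A" and ys: "xs x = ys @ zs"
    have "sz (fold (g x) ys acc) \<le> sz acc + length ys * poly q (sz x + poly r (sz x))"
      if "set ys \<subseteq> set (xs x)" for ys acc
      using that
    proof (induction ys arbitrary: acc)
      case (Cons e ys)
      have "sz e \<le> poly r (sz x)" using Cons.prems sz_le_sz_list[of e "xs x"] r[OF x] by simp
      then have "sz (g x e acc) \<le> sz acc + poly q (sz x + poly r (sz x))"
        using bound[OF x, of e acc] Cons.prems poly_nat_mono[of "sz x + sz e" "sz x + poly r (sz x)" q]
        by simp
      then show ?case using Cons.IH[of "g x e acc"] Cons.prems by simp
    qed simp
    from this[of ys "init x"] have "sz (fold (g x) ys (init x))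
      \<le> poly p (sz x) + length ys * poly q (sz x + poly r (sz x))"
      using ys p[OF x] by simp
    moreover have "length ys \<le> poly r (sz x)"
      using length_le_sz[of "xs x"] r[OF x] ys by simp
    ultimately show "sz (fold (g x) ys (init x)) \<le> poly (p + r * pcompose q ([:0, 1:] + r)) (sz x)"
      by (simp add: poly_pcompose) (meson add_le_cancel_left le_trans mult_le_mono1)
  qed
qed

lemma sz_append: "sz (xs @ ys) \<le> sz xs + sz ys"
  by (induction xs) auto

lemma ptime_rev:
  assumes f: "ptime A f"
  shows "ptime A (\<lambda>x. rev (f x))"
proof -
  have "ptime A (\<lambda>x. fold (#) (f x) [])"
    by (rule ptime_fold_add[where q = "[:1, 1:]", OF ptime_const f])
      (auto intro!: ptime_Cons ptime_fst ptime_snd ptime_id)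
  then show ?thesis by (simp add: fold_Cons_rev)
qed

lemma ptime_append: "ptime A f \<Longrightarrow> ptime A g \<Longrightarrow> ptime A (\<lambda>x. f x @ g x)"
proof -
  assume f: "ptime A f" and g: "ptime A g"
  have "ptime A (\<lambda>x. fold (#) (rev (f x)) (g x))"
    by (rule ptime_fold_add[where q = "[:1, 1:]"])
      (auto intro!: ptime_Cons ptime_fst ptime_snd ptime_id ptime_rev f g)
  then show ?thesis by (simp add: fold_Cons_rev)
qed

lemma ptime_map:
  assumes h: "ptime {p. fst p \<in> A \<and> snd p \<in> set (xs (fst p))} (\<lambda>p. h (fst p) (snd p))"
    and xs: "ptime A xs"
  shows "ptime A (\<lambda>x. map (h x) (xs x))"
proof -
  obtain q where q: "\<And>x e. x \<in> A \<Longrightarrow> e \<in> set (xs x) \<Longrightarrow> sz (h x e) \<le> poly q (1 + sz x + sz e)"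
    using ptime_size[OF h] by fastforce
  have "ptime A (\<lambda>x. fold (\<lambda>e acc. h x e # acc) (xs x) [])"
  proof (rule ptime_fold_add[where q = "1 + pcompose q [:1, 1:]", OF ptime_const xs])
    show "ptime {p. fst p \<in> A \<and> fst (snd p) \<in> set (xs (fst p))}
      (\<lambda>p. h (fst p) (fst (snd p)) # snd (snd p))"
      by (intro ptime_Cons ptime_comp[OF _ h, of _ "\<lambda>p. (fst p, fst (snd p))", simplified]
          ptime_pair ptime_fst ptime_snd ptime_id) auto
  qed (use q in \<open>fastforce simp: poly_pcompose\<close>)
  then have "ptime A (\<lambda>x. rev (fold (\<lambda>e acc. h x e # acc) (xs x) []))" by (rule ptime_rev)
  moreover have "rev (fold (\<lambda>e acc. h x e # acc) ys []) = map (h x) ys" for x ys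
    by (induction ys rule: rev_induct) auto
  ultimately show ?thesis by simp
qed

lemma ptime_filter:
  assumes h: "ptime {p. fst p \<in> A \<and> snd p \<in> set (xs (fst p))} (\<lambda>p. h (fst p) (snd p))"
    and xs: "ptime A xs"
  shows "ptime A (\<lambda>x. filter (h x) (xs x))"
proof -
  have "ptime A (\<lambda>x. fold (\<lambda>e acc. if h x e then e # acc else acc) (xs x) [])"
  proof (rule ptime_fold_add[where q = "[:1, 1:]", OF ptime_const xs])
    show "ptime {p. fst p \<in> A \<and> fst (snd p) \<in> set (xs (fst p))}
      (\<lambda>p. if h (fst p) (fst (snd p)) then fst (snd p) # snd (snd p) else snd (snd p))"
      by (intro ptime_if ptime_Cons ptime_comp[OF _ h, of _ "\<lambda>p. (fst p, fst (snd p))", simplified]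
          ptime_pair ptime_fst ptime_snd ptime_id) auto
  qed auto
  then have "ptime A (\<lambda>x. rev (fold (\<lambda>e acc. if h x e then e # acc else acc) (xs x) []))"
    by (rule ptime_rev)
  moreover have "rev (fold (\<lambda>e acc. if h x e then e # acc else acc) ys []) = filter (h x) ys" for x ys
    by (induction ys rule: rev_induct) auto
  ultimately show ?thesis by simp
qed

lemma ptime_concat:
  assumes xs: "ptime A xs"
  shows "ptime A (\<lambda>x. concat (xs x))"
proof -
  have "ptime A (\<lambda>x. fold (\<lambda>e acc. acc @ e) (xs x) [])"
    by (rule ptime_fold_add[where q = "[:0, 1:]", OF ptime_const xs])
      (auto intro!: ptime_append ptime_fst ptime_snd ptime_id sz_append[THEN order_trans])
  moreover have "fold (\<lambda>e acc. acc @ e) ys [] = concat ys" for ys :: "'b list list"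
    by (induction ys rule: rev_induct) auto
  ultimately show ?thesis by simp
qed

lemma ptime_list_ex:
  assumes h: "ptime {p. fst p \<in> A \<and> snd p \<in> set (xs (fst p))} (\<lambda>p. h (fst p) (snd p))"
    and xs: "ptime A xs"
  shows "ptime A (\<lambda>x. list_ex (h x) (xs x))"
proof -
  have "ptime A (\<lambda>x. filter (h x) (xs x) \<noteq> [])"
    by (intro ptime_not_Nil ptime_filter h xs)
  then show ?thesis by (simp add: list_ex_iff filter_empty_conv)
qed

text \<open>As a function of a binary number \<open>n\<close>, the list \<open>[0..<n]\<close> would
  be exponential. It is affordable because \<open>n\<close> is the length of a list at hand.\<close>

lemma ptime_upt_length:
  assumes xs: "ptime A xs"
  shows "ptime A (\<lambda>x. [0..<length (xs x)])"
proof -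
  have eq: "fold (\<lambda>e acc. (Suc (fst acc), fst acc # snd acc)) ys (0, []) = (length ys, rev [0..<length ys])"
    for ys :: "'b list" by (induction ys rule: rev_induct) auto
  obtain r where r: "\<And>x. x \<in> A \<Longrightarrow> sz (xs x) \<le> poly r (sz x)"
    using ptime_size[OF xs] by blast
  have nat_le: "sz n \<le> n + 1" for n :: nat using floorlog2_le_self[of n] by simp
  have "ptime A (\<lambda>x. fold (\<lambda>e acc. (Suc (fst acc), fst acc # snd acc)) (xs x) (0, []))"
  proof (rule ptime_fold[OF ptime_const xs, where q = "[:4, 1:] + r + r * (r + 3)"], goal_cases)
    case 1
    show ?case by (intro ptime_pair ptime_Suc ptime_Cons ptime_fst ptime_snd ptime_id)
  next
    case (2 x ys zs)
    have l: "length ys \<le> poly r (sz x)"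
      using length_le_sz[of "xs x"] r[OF 2(1)] 2(2) by simp
    have "sz (rev [0..<length ys]) \<le> 1 + length ys * (length ys + 1 + 1)"
      using sz_list_le[of "rev [0..<length ys]" "length ys + 1"] nat_le
      by (metis (no_types, lifting) add_le_mono1 atLeastLessThan_iff le_trans length_rev length_upt
          less_imp_le_nat minus_nat.diff_0 set_rev set_upt)
    also have "\<dots> \<le> 1 + poly r (sz x) * (poly r (sz x) + 2)"
      using l by (intro add_left_mono mult_le_mono) auto
    finally show ?case using nat_le[of "length ys"] l unfolding eq
      by (simp add: algebra_simps)
  qed
  then have "ptime A (\<lambda>x. rev (snd (fold (\<lambda>e acc. (Suc (fst acc), fst acc # snd acc)) (xs x) (0, []))))"
    by (intro ptime_rev ptime_snd)
  then show ?thesis by (simp add: eq)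
qed

lemma ptime_nth_default:
  assumes d: "ptime A d" and xs: "ptime A xs" and i: "ptime A i"
  shows "ptime A (\<lambda>x. nth_default (d x) (xs x) (i x))"
proof -
  \<comment> \<open>The counter is an integer because it continues below zero after the wanted
    position; it is zero exactly once.\<close>
  have eq: "fold (\<lambda>e acc. (fst acc - 1, if fst acc = 0 then e else snd acc)) ys (int n, d) =
     (int n - int (length ys), nth_default d ys n)" for ys :: "'b list" and n d
    by (induction ys rule: rev_induct) (auto simp: nth_default_def nth_append)
  have one: "sz (a - 1 :: int) \<le> sz a + 2" for a
  proof -
    have "floorlog 2 (nat \<bar>a - 1\<bar>) \<le> floorlog 2 (nat \<bar>a\<bar> + 1)" by (rule floorlog_mono) linarith
    then show ?thesis using floorlog2_add[of "nat \<bar>a\<bar>" 1] by (simp add: floorlog_def)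
  qed
  have "ptime A (\<lambda>x. fold (\<lambda>e acc. (fst acc - 1, if fst acc = 0 then e else snd acc)) (xs x) (int (i x), d x))"
  proof (rule ptime_fold_add[where q = "[:2, 1:]"], goal_cases)
    case 3
    show ?case
      by (intro ptime_pair ptime_if ptime_diff_int ptime_eq_int ptime_const ptime_fst ptime_snd ptime_id)
  next
    case (4 x e acc)
    show ?case using one[of "fst acc"] by (cases acc) auto
  qed (intro ptime_pair ptime_int d xs i)+
  then show ?thesis using ptime_snd by (fastforce simp: eq)
qed

lemma ptime_sum_list:
  assumes xs: "ptime A xs"
  shows "ptime A (\<lambda>x. sum_list (xs x) :: int)"
proof -
  have "ptime A (\<lambda>x. fold (\<lambda>e acc. acc + e) (xs x) (0 :: int))"
  proof (rule ptime_fold_add[where q = "[:1, 1:]", OF ptime_const xs], goal_cases)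
    case 1
    show ?case by (intro ptime_add_int ptime_fst ptime_snd ptime_id)
  next
    case (2 x e acc)
    have "floorlog 2 (nat \<bar>acc + e\<bar>) \<le> floorlog 2 (nat \<bar>acc\<bar> + nat \<bar>e\<bar>)"
      by (rule floorlog_mono) linarith
    then show ?case using floorlog2_add[of "nat \<bar>acc\<bar>" "nat \<bar>e\<bar>"] by simp
  qed
  moreover have "fold (\<lambda>e acc. acc + e) ys 0 = sum_list ys" for ys :: "int list"
    by (induction ys rule: rev_induct) (auto simp: add.commute)
  ultimately show ?thesis by simp
qed

text \<open>Bit lengths add up under multiplication, so even the product of all entries stays
  polynomial. This makes clearing all denominators affordable.\<close>

lemma ptime_prod_list:
  assumes xs: "ptime A xs"
  shows "ptime A (\<lambda>x. prod_list (xs x) :: int)"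
proof -
  have "ptime A (\<lambda>x. fold (\<lambda>e acc. acc * e) (xs x) (1 :: int))"
  proof (rule ptime_fold_add[where q = "[:0, 1:]", OF ptime_const xs], goal_cases)
    case 1
    show ?case by (intro ptime_mult_int ptime_fst ptime_snd ptime_id)
  next
    case (2 x e acc)
    show ?case using sz_mult_int[of acc e] by (simp del: enc_int_def)
  qed
  moreover have "fold (\<lambda>e acc. acc * e) ys 1 = prod_list ys" for ys :: "int list"
    by (induction ys rule: rev_induct) (auto simp: mult.commute)
  ultimately show ?thesis by simp
qed

lemmas ptime_base = ptime_id ptime_const ptime_fst ptime_snd ptime_pair
  ptime_Cons ptime_tl ptime_rev ptime_append ptime_concat ptime_upt_length ptime_nth_default
  ptime_sum_list ptime_prod_list ptime_not_Nil ptime_Nil_eq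
  ptime_add_int ptime_diff_int ptime_mult_int ptime_div_int ptime_less_int ptime_le_int ptime_eq_int
  ptime_int ptime_less_nat ptime_le_nat ptime_eq_nat ptime_add_nat ptime_Suc
  ptime_numerator ptime_denominator
  ptime_if ptime_conj ptime_disj ptime_not ptime_map ptime_filter ptime_list_ex

section \<open>The Hungarian method\<close>

type_synonym hstate =
  "int list \<times> int list \<times> (nat \<times> nat) list \<times> (nat \<times> (nat \<times> nat) list) list"

text \<open>
  A state consists of the dual values of the rows and of the columns, the current matching, and
  an alternating tree. The tree lists the reached rows; the path stored with a row consists of the
  edges that the matching gains on the way from the row back to the unmatched root.
\<close>

definition tree_cols :: "(nat \<times> (nat \<times> nat) list) list \<Rightarrow> nat list" where
  "tree_cols t = concat (map (\<lambda>e. map snd (snd e)) t)"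

text \<open>Every entry carries the tree node with its path, so the minimal entry alone tells how to
  grow the tree or augment the matching.\<close>

definition slacks ::
  "nat \<Rightarrow> (nat \<Rightarrow> nat \<Rightarrow> int) \<Rightarrow> int list \<Rightarrow> int list \<Rightarrow> (nat \<times> (nat \<times> nat) list) list \<Rightarrow>
    (int \<times> (nat \<times> (nat \<times> nat) list) \<times> nat) list" where
  "slacks n b U V t = concat (map (\<lambda>e.
     map (\<lambda>c. (nth_default 0 U (fst e) + nth_default 0 V c - b (fst e) c, e, c))
       (filter (\<lambda>c. \<not> list_ex (\<lambda>c'. c' = c) (tree_cols t)) [0..<n])) t)"

definition min_by :: "('a \<Rightarrow> int) \<Rightarrow> 'a list \<Rightarrow> 'a" where
  "min_by f xs = fold (\<lambda>e m. if f e < f m then e else m) xs (hd xs)"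

text \<open>Here \<open>m\<close> consists of the least slack, a reached row with its path, and a
  column outside the tree. The dual shift makes this edge tight; a matched column then brings its
  mate into the tree, and a free column ends the search with an augmentation. Shift and growth form
  one step, so progress is made even when the slack is 0.\<close>

definition hungarian_grow ::
  "nat \<Rightarrow> hstate \<Rightarrow> int \<times> (nat \<times> (nat \<times> nat) list) \<times> nat \<Rightarrow> hstate" where
  "hungarian_grow n s m =
     (map (\<lambda>i. nth_default 0 (fst s) i -
         (if list_ex (\<lambda>e. fst e = i) (snd (snd (snd s))) then fst m else 0)) [0..<n],
      map (\<lambda>i. nth_default 0 (fst (snd s)) i +
         (if list_ex (\<lambda>c. c = i) (tree_cols (snd (snd (snd s)))) then fst m else 0)) [0..<n],
      if list_ex (\<lambda>e. snd e = snd (snd m)) (fst (snd (snd s)))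
      then (fst (snd (snd s)),
        (fst (hd (filter (\<lambda>e. snd e = snd (snd m)) (fst (snd (snd s))))),
          (fst (fst (snd m)), snd (snd m)) # snd (fst (snd m))) # snd (snd (snd s)))
      else ((fst (fst (snd m)), snd (snd m)) # snd (fst (snd m)) @
          filter (\<lambda>e. \<not> list_ex (\<lambda>e'. fst e' = fst e)
            ((fst (fst (snd m)), snd (snd m)) # snd (fst (snd m)))) (fst (snd (snd s))), []))"

text \<open>A state with complete matching is a fixed point, so a fixed number of rounds can replace
  a termination test.\<close>

definition hungarian_step :: "nat \<Rightarrow> (nat \<Rightarrow> nat \<Rightarrow> int) \<Rightarrow> hstate \<Rightarrow> hstate" where
  "hungarian_step n b s =
     (if snd (snd (snd s)) = []
      then if filter (\<lambda>r. \<not> list_ex (\<lambda>e. fst e = r) (fst (snd (snd s)))) [0..<n] = [] then s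
        else (fst s, fst (snd s), fst (snd (snd s)),
          [(hd (filter (\<lambda>r. \<not> list_ex (\<lambda>e. fst e = r) (fst (snd (snd s)))) [0..<n]), [])])
      else if slacks n b (fst s) (fst (snd s)) (snd (snd (snd s))) = [] then s
      else hungarian_grow n s (min_by fst (slacks n b (fst s) (fst (snd s)) (snd (snd (snd s))))))"

text \<open>For nonnegative entries a row sum dominates every entry of its row, which makes this
  dual solution feasible.\<close>

definition hungarian_init :: "nat \<Rightarrow> (nat \<Rightarrow> nat \<Rightarrow> int) \<Rightarrow> hstate" where
  "hungarian_init n b =
     (map (\<lambda>r. sum_list (map (b r) [0..<n])) [0..<n], map (\<lambda>_. 0) [0..<n], [], [])"

lemma min_by:
  assumes "xs \<noteq> []"
  shows "min_by f xs \<in> set xs" and "\<And>y. y \<in> set xs \<Longrightarrow> f (min_by f xs) \<le> f y"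
proof -
  have "fold (\<lambda>e m. if f e < f m then e else m) ys z \<in> insert z (set ys) \<and>
    (\<forall>y\<in>insert z (set ys). f (fold (\<lambda>e m. if f e < f m then e else m) ys z) \<le> f y)" for ys z
    by (induction ys rule: rev_induct) auto
  from this[of xs "hd xs"] assms show "min_by f xs \<in> set xs"
    "\<And>y. y \<in> set xs \<Longrightarrow> f (min_by f xs) \<le> f y"
    by (auto simp: min_by_def insert_absorb)
qed

subsection \<open>Alternating trees\<close>

text \<open>The first edge \<open>e\<close> on the path of \<open>r\<close> leads from the parent
  row \<open>fst e\<close> to the column matched with \<open>r\<close>, and the rest of the path is
  that of the parent. The list is thus closed under parents, and as its rows are distinct every row
  has only one path.\<close>

definition alternating_tree ::
  "nat \<Rightarrow> (nat \<times> nat) list \<Rightarrow> nat \<Rightarrow> (nat \<times> (nat \<times> nat) list) list \<Rightarrow> bool" where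
  "alternating_tree n M rt t \<longleftrightarrow> distinct (map fst t) \<and> rt < n \<and> rt \<notin> fst ` set M \<and>
     (\<forall>r p. (r, p) \<in> set t \<longrightarrow> r < n) \<and> (\<forall>r. (r, []) \<in> set t \<longrightarrow> r = rt) \<and>
     (\<forall>r e p. (r, e # p) \<in> set t \<longrightarrow> (r, snd e) \<in> set M \<and> (fst e, p) \<in> set t)"

definition matching :: "nat \<Rightarrow> (nat \<times> nat) list \<Rightarrow> bool" where
  "matching n M \<longleftrightarrow> distinct (map fst M) \<and> distinct (map snd M) \<and> (\<forall>(r, c)\<in>set M. r < n \<and> c < n)"

lemma matching_row: "matching n M \<Longrightarrow> (r, c) \<in> set M \<Longrightarrow> (r, c') \<in> set M \<Longrightarrow> c = c'"
  unfolding matching_def by (meson eq_key_imp_eq_value)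

lemma matching_col: "matching n M \<Longrightarrow> (r, c) \<in> set M \<Longrightarrow> (r', c) \<in> set M \<Longrightarrow> r = r'"
  unfolding matching_def distinct_map by (metis inj_onD prod.inject snd_conv)

lemma matching_bound: "matching n M \<Longrightarrow> (r, c) \<in> set M \<Longrightarrow> r < n \<and> c < n"
  by (auto simp: matching_def)

lemma tree_basic:
  assumes "alternating_tree n M rt t"
  shows "distinct (map fst t)" and "rt < n" and "rt \<notin> fst ` set M"
proof -
  have "distinct (map fst t) \<and> rt < n \<and> rt \<notin> fst ` set M"
    using assms unfolding alternating_tree_def by (elim conjE) (intro conjI)
  then show "distinct (map fst t)" and "rt < n" and "rt \<notin> fst ` set M" by simp_all
qed

lemma tree_row:
  assumes "alternating_tree n M rt t" and "(r, p) \<in> set t"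
  shows "r < n"
proof -
  have "\<forall>r p. (r, p) \<in> set t \<longrightarrow> r < n"
    using assms(1) unfolding alternating_tree_def by (elim conjE)
  from this[rule_format, OF assms(2)] show ?thesis .
qed

lemma tree_Nil:
  assumes "alternating_tree n M rt t" and "(r, []) \<in> set t"
  shows "r = rt"
proof -
  have "\<forall>r. (r, []) \<in> set t \<longrightarrow> r = rt"
    using assms(1) unfolding alternating_tree_def by (elim conjE)
  from this[rule_format, OF assms(2)] show ?thesis .
qed

lemma tree_Cons:
  assumes "alternating_tree n M rt t" and "(r, e # p) \<in> set t"
  shows "(r, snd e) \<in> set M" and "(fst e, p) \<in> set t"
proof -
  have "\<forall>r e p. (r, e # p) \<in> set t \<longrightarrow> (r, snd e) \<in> set M \<and> (fst e, p) \<in> set t"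
    using assms(1) unfolding alternating_tree_def by (elim conjE)
  from this[rule_format, OF assms(2)] show "(r, snd e) \<in> set M" and "(fst e, p) \<in> set t" by auto
qed

lemma tree_free: "alternating_tree n M rt t \<Longrightarrow> (rt, c) \<notin> set M"
  using tree_basic(3) by force

lemma set_tree_cols: "set (tree_cols t) = (\<Union>e\<in>set t. snd ` set (snd e))"
  by (auto simp: tree_cols_def)

lemma tree_path_col:
  assumes "alternating_tree n M rt t" and "(r, p) \<in> set t" and "c \<in> snd ` set p"
  shows "\<exists>r'\<in>insert r (fst ` set p). r' \<in> fst ` set t \<and> (r', c) \<in> set M"
  using assms(2,3)
proof (induction p arbitrary: r)
  case (Cons e p)
  note e = tree_Cons[OF assms(1) Cons.prems(1)]
  show ?case
  proof (cases "c = snd e")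
    case True
    have "r \<in> fst ` set t" using Cons.prems(1) by force
    then show ?thesis using e(1) True by blast
  next
    case False
    then have "c \<in> snd ` set p" using Cons.prems(2) by simp
    from Cons.IH[OF e(2) this] show ?thesis by auto
  qed
qed simp

text \<open>Every row except the root is entered through its mate, and the root has none. Hence a
  matching edge has both ends in the tree or neither.\<close>

lemma tree_cols_iff:
  assumes M: "matching n M" and t: "alternating_tree n M rt t"
  shows "c \<in> set (tree_cols t) \<longleftrightarrow> (\<exists>r\<in>fst ` set t. (r, c) \<in> set M)"
proof
  assume "c \<in> set (tree_cols t)"
  then show "\<exists>r\<in>fst ` set t. (r, c) \<in> set M"
    using tree_path_col[OF t] unfolding set_tree_cols by fastforce
next
  assume "\<exists>r\<in>fst ` set t. (r, c) \<in> set M"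
  then obtain r p where rp: "(r, p) \<in> set t" "(r, c) \<in> set M" by auto
  moreover have "r \<noteq> rt" using tree_free[OF t] rp(2) by blast
  ultimately obtain e p' where p: "p = e # p'" "(r, snd e) \<in> set M"
    using tree_Nil[OF t] tree_Cons(1)[OF t] by (metis list.exhaust)
  then have "snd e = c" using matching_row[OF M] rp(2) by blast
  then show "c \<in> set (tree_cols t)" using rp(1) p(1) unfolding set_tree_cols by force
qed

lemma tree_path_row:
  assumes "alternating_tree n M rt t" and "(r, p) \<in> set t" and "r' \<in> fst ` set p"
  shows "\<exists>p'. (r', p') \<in> set t \<and> length p' < length p"
  using assms(2,3)
proof (induction p arbitrary: r)
  case (Cons e p)
  then have "(fst e, p) \<in> set t" using tree_Cons[OF assms(1)] by blast
  with Cons show ?case by (cases "r' = fst e") (force simp: less_Suc_eq)+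
qed simp

text \<open>Paths get strictly shorter towards the root, and each row has only one path, so no row
  can return.\<close>

lemma tree_path_distinct:
  assumes t: "alternating_tree n M rt t" and "(r, p) \<in> set t"
  shows "distinct (r # map fst p)"
  using assms(2)
proof (induction p arbitrary: r)
  case (Cons e p)
  then have e: "(fst e, p) \<in> set t" using tree_Cons[OF t] by blast
  have "r \<notin> fst ` set (e # p)"
  proof
    assume "r \<in> fst ` set (e # p)"
    from tree_path_row[OF t Cons.prems this] obtain p'
      where "(r, p') \<in> set t" "length p' < length (e # p)" by blast
    moreover have "distinct (map fst t)" by (rule tree_basic(1)[OF t])
    ultimately show False using Cons.prems by (metis eq_key_imp_eq_value less_irrefl)
  qed
  then show ?case using Cons.IH[OF e] by auto
qed simp

text \<open>The columns of a path are exactly those that its rows release when their old edges are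
  dropped, so an augmentation reuses each of them once.\<close>

lemma tree_path_mates:
  assumes M: "matching n M" and t: "alternating_tree n M rt t" and "(r, p) \<in> set t"
  shows "snd ` set p = {c. \<exists>r'\<in>insert r (fst ` set p). (r', c) \<in> set M} \<and> distinct (map snd p)"
  using assms(3)
proof (induction p arbitrary: r)
  case Nil
  then show ?case using tree_free[OF t] tree_Nil[OF t] by auto
next
  case (Cons e p)
  then have e: "(r, snd e) \<in> set M" "(fst e, p) \<in> set t" using tree_Cons[OF t] by blast+
  note IH = Cons.IH[OF e(2)]
  have r: "r \<notin> insert (fst e) (fst ` set p)" using tree_path_distinct[OF t Cons.prems] by auto
  have "snd e \<notin> snd ` set p"
    using IH r matching_col[OF M e(1)] by auto
  moreover have "{c. \<exists>r'\<in>insert r (fst ` set (e # p)). (r', c) \<in> set M} =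
    insert (snd e) {c. \<exists>r'\<in>insert (fst e) (fst ` set p). (r', c) \<in> set M}"
  proof (rule set_eqI)
    fix c
    have "(r, c) \<in> set M \<longleftrightarrow> c = snd e" using e(1) matching_row[OF M e(1)] by blast
    then show "c \<in> {c. \<exists>r'\<in>insert r (fst ` set (e # p)). (r', c) \<in> set M} \<longleftrightarrow>
      c \<in> insert (snd e) {c. \<exists>r'\<in>insert (fst e) (fst ` set p). (r', c) \<in> set M}" by simp
  qed
  moreover have "snd ` set (e # p) = insert (snd e) (snd ` set p)" by simp
  ultimately show ?case using IH by (simp only: list.map distinct.simps set_map) blast
qed

lemma alternating_tree_length:
  assumes "alternating_tree n M rt t"
  shows "length t \<le> n"
proof -
  have "distinct (map fst t)" "set (map fst t) \<subseteq> {..<n}"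
    using tree_basic(1)[OF assms] tree_row[OF assms] by auto
  then show ?thesis by (metis card_lessThan card_mono distinct_card finite_lessThan length_map)
qed

lemma tree_path_length:
  assumes t: "alternating_tree n M rt t" and p: "(r, p) \<in> set t"
  shows "length p \<le> n"
proof -
  have "distinct (map fst p)" using tree_path_distinct[OF t p] by simp
  moreover have "set (map fst p) \<subseteq> {..<n}"
    using tree_path_row[OF t p] tree_row[OF t] by auto
  ultimately show ?thesis by (metis card_lessThan card_mono distinct_card finite_lessThan length_map)
qed

lemma matching_length:
  assumes "matching n M"
  shows "length M \<le> n"
proof -
  have "distinct (map fst M)" "set (map fst M) \<subseteq> {..<n}" using assms by (auto simp: matching_def)
  then show ?thesis by (metis card_lessThan card_mono distinct_card finite_lessThan length_map)
qed

text \<open>This is the symmetric difference with the augmenting path: all old edges in rows of the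
  path go, the edges of the path and \<open>(r, c)\<close> come. Columns stay covered, which
  preserves the condition on potentials of free columns.\<close>

lemma matching_augment:
  assumes M: "matching n M" and t: "alternating_tree n M rt t" and p: "(r, p) \<in> set t"
    and c: "c < n" "c \<notin> snd ` set M"
  defines "M' \<equiv> (r, c) # p @ filter (\<lambda>e. fst e \<notin> fst ` set ((r, c) # p)) M"
  shows "matching n M'" and "length M' = Suc (length M)" and "snd ` set M \<subseteq> snd ` set M'"
proof -
  let ?R = "insert r (fst ` set p)"
  have mates: "c' \<in> snd ` set p \<longleftrightarrow> (\<exists>r'\<in>?R. (r', c') \<in> set M)" for c'
    using tree_path_mates[OF M t p] by blast
  have dp: "distinct (map snd p)" using tree_path_mates[OF M t p] by blast
  have mate: "c' \<in> snd ` set p \<longleftrightarrow> r' \<in> ?R" if "(r', c') \<in> set M" for r' c'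
    using mates[of c'] that matching_col[OF M that] by blast
  have sub: "c' \<in> snd ` set M" if "c' \<in> snd ` set p" for c'
    using mates[of c'] that by force
  have rows: "r' < n" if "r' \<in> ?R" for r'
    using that tree_path_row[OF t p] tree_row[OF t] p by blast
  have cols: "c' < n" if "c' \<in> snd ` set M" for c'
    using that matching_bound[OF M] by auto
  let ?F = "filter (\<lambda>e. fst e \<notin> ?R) M"
  have M': "M' = (r, c) # p @ ?F" by (simp add: M'_def)
  have cp: "c \<notin> snd ` set p" using sub c(2) by blast
  have pF: "snd e \<notin> snd ` set p" if "e \<in> set M" "fst e \<notin> ?R" for e
    using that mate[of "fst e" "snd e"] by (simp del: insert_iff)
  have dM: "distinct (map fst M)" "distinct (map snd M)"
    using M unfolding matching_def by blast+
  have dF: "distinct (map fst ?F)" "distinct (map snd ?F)"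
    by (rule distinct_map_filter dM)+
  show "matching n M'" unfolding matching_def
  proof (intro conjI)
    show "distinct (map fst M')"
    proof -
      have "set (map fst ((r, c) # p)) \<inter> set (map fst ?F) = {}" by fastforce
      then show ?thesis using tree_path_distinct[OF t p] dF(1) unfolding M' by auto
    qed
    show "distinct (map snd M')"
    proof -
      have "snd e \<notin> insert c (snd ` set p)" if "e \<in> set ?F" for e
      proof -
        have e: "e \<in> set M" "fst e \<notin> ?R" using that by simp_all
        have "snd e \<noteq> c" using e(1) c(2) by blast
        then show ?thesis using pF[OF e] by simp
      qed
      then have "snd ` set ?F \<subseteq> - insert c (snd ` set p)" by (intro image_subsetI) simp
      then have "set (map snd ((r, c) # p)) \<inter> set (map snd ?F) = {}"
        by (simp only: set_map list.simps image_insert set_simps snd_conv) blast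
      then show ?thesis using dp dF(2) cp unfolding M'
        by (simp only: append_Cons[symmetric] map_append distinct_append) simp
    qed
    have "r' < n \<and> c' < n" if "(r', c') \<in> set M'" for r' c'
    proof -
      have "(r', c') = (r, c) \<or> (r', c') \<in> set p \<or> (r', c') \<in> set M"
        using that unfolding M' by (simp only: set_simps set_append set_filter) blast
      then show ?thesis
      proof (elim disjE)
        assume "(r', c') = (r, c)"
        then show ?thesis using rows[of r] c(1) by simp
      next
        assume "(r', c') \<in> set p"
        then have "r' \<in> fst ` set p" "c' \<in> snd ` set p"
          by (metis fst_conv image_eqI, metis snd_conv image_eqI)
        then show ?thesis using rows[of r'] cols[of c'] sub[of c'] by simp
      next
        assume "(r', c') \<in> set M"
        then show ?thesis by (rule matching_bound[OF M])
      qed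
    qed
    then show "\<forall>(r, c)\<in>set M'. r < n \<and> c < n" by blast
  qed
  \<comment> \<open>As many old edges are dropped as the path \<open>p\<close> has edges, since the
    root had none; the edge \<open>(r, c)\<close> is the surplus.\<close>
  let ?G = "filter (\<lambda>e. fst e \<in> ?R) M"
  have "snd ` set ?G = snd ` set p"
  proof (rule set_eqI)
    fix c'
    have "c' \<in> snd ` set ?G \<longleftrightarrow> (\<exists>e. e \<in> set M \<and> fst e \<in> ?R \<and> c' = snd e)"
      unfolding image_iff set_filter by blast
    also have "\<dots> \<longleftrightarrow> (\<exists>r'\<in>?R. (r', c') \<in> set M)" by (metis prod.collapse fst_conv snd_conv)
    finally show "c' \<in> snd ` set ?G \<longleftrightarrow> c' \<in> snd ` set p" unfolding mates .
  qed
  moreover have "distinct (map snd ?G)"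
    by (rule distinct_map_filter dM)+
  ultimately have "length ?G = length p"
    using dp by (metis distinct_card length_map list.set_map)
  then show "length M' = Suc (length M)"
    using sum_length_filter_compl[of "\<lambda>e. fst e \<in> ?R" M] unfolding M' by simp
  show "snd ` set M \<subseteq> snd ` set M'"
  proof
    fix c' assume "c' \<in> snd ` set M"
    then obtain r' where r': "(r', c') \<in> set M" by auto
    show "c' \<in> snd ` set M'"
    proof (cases "r' \<in> ?R")
      case True
      then show ?thesis using mate[OF r'] unfolding M' by auto
    next
      case False
      then show ?thesis using r' unfolding M' by force
    qed
  qed
qed

text \<open>The mate of a column outside the tree is a row outside the tree, so distinctness of rows
  survives.\<close>

lemma alternating_tree_grow:
  assumes M: "matching n M" and t: "alternating_tree n M rt t" and p: "(r, p) \<in> set t"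
    and c: "c \<notin> set (tree_cols t)" "(r', c) \<in> set M"
  shows "alternating_tree n M rt ((r', (r, c) # p) # t)"
proof -
  have new: "r' \<notin> fst ` set t" using tree_cols_iff[OF M t] c by blast
  have "r' < n" using matching_bound[OF M c(2)] by simp
  then show ?thesis
    using t p c(2) new unfolding alternating_tree_def list.set(2) insert_iff prod.inject by auto
qed

subsection \<open>Invariant\<close>

text \<open>The bound \<open>B\<close> on the potentials keeps the numbers short; it serves the
  running time, not the duality.\<close>

definition dual_feasible :: "nat \<Rightarrow> (nat \<Rightarrow> nat \<Rightarrow> int) \<Rightarrow> int \<Rightarrow> int list \<Rightarrow> int list \<Rightarrow> bool" where
  "dual_feasible n b B U V \<longleftrightarrow> length U = n \<and> length V = n \<and>
     (\<forall>i<n. 0 \<le> U ! i \<and> U ! i \<le> B \<and> 0 \<le> V ! i \<and> V ! i \<le> B) \<and>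
     (\<forall>r<n. \<forall>c<n. b r c \<le> U ! r + V ! c)"

definition tight :: "(nat \<Rightarrow> nat \<Rightarrow> int) \<Rightarrow> int list \<Rightarrow> int list \<Rightarrow> nat \<times> nat \<Rightarrow> bool" where
  "tight b U V e \<longleftrightarrow> U ! fst e + V ! snd e = b (fst e) (snd e)"

text \<open>Free columns keep potential 0. Comparing rows with such a column is what keeps the row
  potentials nonnegative while they are lowered.\<close>

definition hungarian_inv :: "nat \<Rightarrow> (nat \<Rightarrow> nat \<Rightarrow> int) \<Rightarrow> int \<Rightarrow> hstate \<Rightarrow> bool" where
  "hungarian_inv n b B s \<longleftrightarrow> (case s of (U, V, M, t) \<Rightarrow>
     dual_feasible n b B U V \<and> matching n M \<and> (\<forall>e\<in>set M. tight b U V e) \<and>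
     (\<forall>c<n. c \<notin> snd ` set M \<longrightarrow> V ! c = 0) \<and>
     (t \<noteq> [] \<longrightarrow> (\<exists>rt. alternating_tree n M rt t)) \<and> (\<forall>e\<in>set t. \<forall>e'\<in>set (snd e). tight b U V e'))"

text \<open>An augmentation discards a tree of at most \<open>n\<close> rows; the weight
  \<open>Suc n\<close> of a matching edge outweighs this loss.\<close>

definition progress :: "nat \<Rightarrow> hstate \<Rightarrow> nat" where
  "progress n s = Suc n * length (fst (snd (snd s))) + length (snd (snd (snd s)))"

lemma tree_matching_less:
  assumes M: "matching n M" and t: "alternating_tree n M rt t"
  shows "length M < n"
proof -
  have "set (map fst M) \<subseteq> {..<n} - {rt}" using matching_bound[OF M] tree_basic(3)[OF t] by auto
  then have "card (set (map fst M)) \<le> n - 1"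
    using card_mono[of "{..<n} - {rt}" "set (map fst M)"] tree_basic(2)[OF t] by simp
  moreover have "card (set (map fst M)) = length M"
    using M unfolding matching_def by (metis distinct_card length_map)
  ultimately show ?thesis using tree_basic(2)[OF t] by linarith
qed

lemma matching_free_col:
  assumes M: "matching n M" and less: "length M < n"
  shows "\<exists>c<n. c \<notin> snd ` set M"
proof (rule ccontr)
  assume "\<not> (\<exists>c<n. c \<notin> snd ` set M)"
  then have "{..<n} \<subseteq> set (map snd M)" by auto
  then have "n \<le> card (set (map snd M))" by (metis card_lessThan card_mono finite_set)
  also have "\<dots> \<le> length M" by (metis card_length length_map)
  finally show False using less by simp
qed

lemma matching_free_row:
  assumes M: "matching n M"
  shows "(\<exists>r<n. r \<notin> fst ` set M) \<longleftrightarrow> length M < n"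
proof
  assume "\<exists>r<n. r \<notin> fst ` set M"
  then obtain r where "r < n" "r \<notin> fst ` set M" by blast
  \<comment> \<open>The definition admits a tree without any entry, which lets the count for trees
    apply to a bare unmatched row.\<close>
  then have "alternating_tree n M r []" by (simp add: alternating_tree_def)
  then show "length M < n" by (rule tree_matching_less[OF M])
next
  assume less: "length M < n"
  show "\<exists>r<n. r \<notin> fst ` set M"
  proof (rule ccontr)
    assume "\<not> (\<exists>r<n. r \<notin> fst ` set M)"
    then have "{..<n} \<subseteq> set (map fst M)" by auto
    then have "n \<le> card (set (map fst M))" by (metis card_lessThan card_mono finite_set)
    also have "\<dots> \<le> length M" by (metis card_length length_map)
    finally show False using less by simp
  qed
qed

lemma slacks_iff:
  "(d, e, c) \<in> set (slacks n b U V t) \<longleftrightarrow> e \<in> set t \<and> c < n \<and> c \<notin> set (tree_cols t) \<and>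
    d = nth_default 0 U (fst e) + nth_default 0 V c - b (fst e) c"
  by (auto simp: slacks_def list_ex_iff)

text \<open>An edge loses slack only if its row is in the tree and its column is not, and
  \<open>d\<close> does not exceed the slack of such edges. Edges with both ends in the tree, in
  particular those on stored paths, stay tight because the two shifts cancel.\<close>

lemma dual_update:
  fixes U V :: "int list"
  assumes M: "matching n M" and t: "alternating_tree n M rt t"
    and dual: "dual_feasible n b B U V" and tightM: "\<forall>e\<in>set M. tight b U V e"
    and tightt: "\<forall>e\<in>set t. \<forall>e'\<in>set (snd e). tight b U V e'"
    and zero: "\<forall>c<n. c \<notin> snd ` set M \<longrightarrow> V ! c = 0"
    and b: "\<forall>r c. 0 \<le> b r c" "\<forall>r<n. \<forall>c<n. b r c \<le> B"
    and d: "\<forall>r\<in>fst ` set t. \<forall>c<n. c \<notin> set (tree_cols t) \<longrightarrow> d \<le> U ! r + V ! c - b r c"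
    and d0: "0 \<le> d"
  defines "U' \<equiv> map (\<lambda>i. U ! i - (if i \<in> fst ` set t then d else 0)) [0..<n]"
    and "V' \<equiv> map (\<lambda>i. V ! i + (if i \<in> set (tree_cols t) then d else 0)) [0..<n]"
  shows "dual_feasible n b B U' V'" and "\<forall>e\<in>set M. tight b U' V' e"
    and "\<forall>e\<in>set t. \<forall>e'\<in>set (snd e). tight b U' V' e'"
    and "\<forall>c<n. c \<notin> snd ` set M \<longrightarrow> V' ! c = 0"
    and "\<And>r c. r \<in> fst ` set t \<Longrightarrow> c < n \<Longrightarrow> c \<notin> set (tree_cols t) \<Longrightarrow>
      U ! r + V ! c - b r c = d \<Longrightarrow> tight b U' V' (r, c)"
proof -
  note cols = tree_cols_iff[OF M t]
  have rown: "r < n" if "r \<in> fst ` set t" for r using that tree_row[OF t] by auto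
  have U': "U' ! r = U ! r - (if r \<in> fst ` set t then d else 0)" if "r < n" for r
    using that by (simp add: U'_def)
  have V': "V' ! c = V ! c + (if c \<in> set (tree_cols t) then d else 0)" if "c < n" for c
    using that by (simp add: V'_def)
  have Mn: "r < n" "c < n" if "(r, c) \<in> set M" for r c using matching_bound[OF M that] by auto
  have UV: "b r c \<le> U ! r + V ! c" if "r < n" "c < n" for r c
    using dual that by (simp add: dual_feasible_def)
  have dmin: "d \<le> U ! r + V ! c - b r c"
    if "r \<in> fst ` set t" "c < n" "c \<notin> set (tree_cols t)" for r c
    using d that by blast
  have feas: "b r c \<le> U' ! r + V' ! c" if "r < n" "c < n" for r c
    using UV[OF that] dmin[of r c] d0 that
    by (cases "r \<in> fst ` set t"; cases "c \<in> set (tree_cols t)") (simp_all add: U' V')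
  have sync: "r \<in> fst ` set t \<longleftrightarrow> c \<in> set (tree_cols t)" if "(r, c) \<in> set M" for r c
    using cols[of c] that matching_col[OF M that] by blast
  have tM: "U' ! r + V' ! c = b r c" if "(r, c) \<in> set M" for r c
    using Mn[OF that] sync[OF that] tightM that by (auto simp: U' V' tight_def)
  show "\<forall>e\<in>set M. tight b U' V' e" using tM by (auto simp: tight_def)
  show V0: "\<forall>c<n. c \<notin> snd ` set M \<longrightarrow> V' ! c = 0"
    using zero cols by (force simp: V')
  \<comment> \<open>A free column is not in the tree, so its potential is still 0, and feasibility
    against it forces row potentials to be nonnegative.\<close>
  obtain c0 where c0: "c0 < n" "c0 \<notin> snd ` set M"
    using matching_free_col[OF M] tree_matching_less[OF M t] by blast
  have nn: "0 \<le> U' ! r" if "r < n" for r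
    using feas[OF that c0(1)] V0 c0 b(1) by (metis add.right_neutral order_trans)
  show "dual_feasible n b B U' V'"
    unfolding dual_feasible_def
  proof (intro conjI allI impI)
    show "length U' = n" "length V' = n" by (simp_all add: U'_def V'_def)
    fix i assume i: "i < n"
    show "0 \<le> U' ! i" by (rule nn[OF i])
    have *: "U ! i \<le> B" "0 \<le> V ! i" "V ! i \<le> B" using dual i by (auto simp: dual_feasible_def)
    show "U' ! i \<le> B" "0 \<le> V' ! i" using * d0 i by (auto simp: U' V')
    show "V' ! i \<le> B"
    proof (cases "i \<in> set (tree_cols t)")
      case True
      \<comment> \<open>A raised column is matched, so tightness gives
        \<open>V' ! i = b r i - U' ! r\<close>, which is at most \<open>B\<close>.\<close>
      then obtain r where r: "(r, i) \<in> set M" using cols by blast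
      then show ?thesis using tM[OF r] nn[of r] Mn[OF r] b(2) by (smt (verit))
    next
      case False
      then show ?thesis using * i by (simp add: V')
    qed
  qed (rule feas)
  show "\<forall>e\<in>set t. \<forall>e'\<in>set (snd e). tight b U' V' e'"
  proof (intro ballI)
    fix e e' assume e: "e \<in> set t" "e' \<in> set (snd e)"
    obtain r p where rp: "e = (r, p)" by (cases e)
    have "fst e' \<in> fst ` set t"
      using tree_path_row[OF t, of r p "fst e'"] e rp by force
    moreover have c: "snd e' \<in> set (tree_cols t)"
      using e unfolding set_tree_cols by blast
    moreover have "snd e' < n" using c cols Mn by blast
    ultimately show "tight b U' V' e'"
      using tightt e rown by (auto simp: tight_def U' V')
  qed
  show "tight b U' V' (r, c)" if "r \<in> fst ` set t" "c < n" "c \<notin> set (tree_cols t)"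
    "U ! r + V ! c - b r c = d" for r c
    using that rown[of r] by (simp add: tight_def U' V')
qed

text \<open>There are three kinds of proper steps: planting a root, adding a row, augmenting. Each
  of them raises \<open>progress\<close>.\<close>

lemma hungarian_step:
  assumes b: "\<And>r c. 0 \<le> b r c" "\<And>r c. r < n \<Longrightarrow> c < n \<Longrightarrow> b r c \<le> B"
    and inv: "hungarian_inv n b B s"
  shows "hungarian_inv n b B (hungarian_step n b s)"
    and "length (fst (snd (snd s))) < n \<Longrightarrow> progress n s < progress n (hungarian_step n b s)"
    and "length (fst (snd (snd s))) = n \<Longrightarrow> hungarian_step n b s = s"
proof -
  obtain U V M t where s: "s = (U, V, M, t)" by (cases s)
  have dual: "dual_feasible n b B U V" and M: "matching n M" and tightM: "\<forall>e\<in>set M. tight b U V e"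
    and zero: "\<forall>c<n. c \<notin> snd ` set M \<longrightarrow> V ! c = 0"
    and tr: "t \<noteq> [] \<Longrightarrow> \<exists>rt. alternating_tree n M rt t"
    and tightt: "\<forall>e\<in>set t. \<forall>e'\<in>set (snd e). tight b U V e'"
    using inv unfolding hungarian_inv_def s by simp_all
  have len: "length U = n" "length V = n" using dual by (auto simp: dual_feasible_def)
  let ?s' = "hungarian_step n b s"
  show "hungarian_inv n b B ?s'"
    and "length (fst (snd (snd s))) < n \<Longrightarrow> progress n s < progress n ?s'"
    and "length (fst (snd (snd s))) = n \<Longrightarrow> ?s' = s"
  proof -
    have "hungarian_inv n b B ?s' \<and> (length M < n \<longrightarrow> progress n s < progress n ?s') \<and>
      (length M = n \<longrightarrow> ?s' = s)"
    proof (cases "t = []")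
      case True
      let ?free = "filter (\<lambda>r. \<not> list_ex (\<lambda>e. fst e = r) M) [0..<n]"
      have free: "set ?free = {r. r < n \<and> r \<notin> fst ` set M}" by (auto simp: list_ex_iff)
      show ?thesis
      proof (cases "?free = []")
        case f: True
        then have "\<not> length M < n"
          using matching_free_row[OF M] free by (metis (mono_tags, lifting) empty_Collect_eq list.set(1))
        moreover have "?s' = s" using f True by (simp add: hungarian_step_def s)
        ultimately show ?thesis using inv by simp
      next
        case f: False
        then have hd: "hd ?free < n" "hd ?free \<notin> fst ` set M" using free hd_in_set[OF f] by blast+
        then have "length M < n" using matching_free_row[OF M] by blast
        moreover have s': "?s' = (U, V, M, [(hd ?free, [])])"
          using f True by (simp add: hungarian_step_def s)
        moreover have "alternating_tree n M (hd ?free) [(hd ?free, [])]"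
          using hd by (simp add: alternating_tree_def)
        ultimately show ?thesis using inv True
          unfolding hungarian_inv_def s progress_def by auto
      qed
    next
      case False
      then obtain rt where t: "alternating_tree n M rt t" using tr by blast
      note less = tree_matching_less[OF M t]
      obtain c0 where c0: "c0 < n" "c0 \<notin> snd ` set M" using matching_free_col[OF M less] by blast
      have cols: "c \<in> snd ` set M" if "c \<in> set (tree_cols t)" for c
        using that tree_cols_iff[OF M t] by force
      let ?sl = "slacks n b U V t"
      \<comment> \<open>The free column \<open>c0\<close> lies outside the tree, so there is a slack
        to minimise.\<close>
      obtain e0 where e0: "e0 \<in> set t" using False by (cases t) auto
      then have "(nth_default 0 U (fst e0) + nth_default 0 V c0 - b (fst e0) c0, e0, c0) \<in> set ?sl"
        unfolding slacks_iff using c0 cols by blast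
      then have sl: "?sl \<noteq> []" by force
      obtain d r p c where m: "min_by fst ?sl = (d, (r, p), c)" by (metis prod.collapse)
      have "(d, (r, p), c) \<in> set ?sl" using min_by(1)[OF sl, of fst] m by metis
      then have rp: "(r, p) \<in> set t" and c: "c < n" "c \<notin> set (tree_cols t)"
        and d: "d = nth_default 0 U r + nth_default 0 V c - b r c"
        unfolding slacks_iff by auto
      have rn: "r' < n" if "r' \<in> fst ` set t" for r' using that tree_row[OF t] by auto
      have r: "r < n" "r \<in> fst ` set t" using tree_row[OF t rp] rp by force+
      have dmin: "d \<le> U ! r' + V ! c' - b r' c'"
        if rc: "r' \<in> fst ` set t" "c' < n" "c' \<notin> set (tree_cols t)" for r' c'
      proof -
        obtain e where e: "e \<in> set t" "r' = fst e" using rc(1) by blast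
        then have "(nth_default 0 U r' + nth_default 0 V c' - b r' c', e, c') \<in> set ?sl"
          unfolding slacks_iff using rc by blast
        from min_by(2)[OF sl this, of fst] show ?thesis
          using rn[OF rc(1)] rc(2) len by (simp add: m nth_default_nth)
      qed
      have deq: "U ! r + V ! c - b r c = d" using d r c len by (simp add: nth_default_nth)
      have "b r c \<le> U ! r + V ! c" using dual r(1) c(1) by (simp add: dual_feasible_def)
      then have d0: "0 \<le> d" using deq by simp
      define U' where "U' = map (\<lambda>i. U ! i - (if i \<in> fst ` set t then d else 0)) [0..<n]"
      define V' where "V' = map (\<lambda>i. V ! i + (if i \<in> set (tree_cols t) then d else 0)) [0..<n]"
      have "\<forall>r c. 0 \<le> b r c" "\<forall>r<n. \<forall>c<n. b r c \<le> B"
        "\<forall>r\<in>fst ` set t. \<forall>c<n. c \<notin> set (tree_cols t) \<longrightarrow> d \<le> U ! r + V ! c - b r c"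
        using b dmin by blast+
      note upd = dual_update[OF M t dual tightM tightt zero this d0,
          folded U'_def V'_def]
      note upd5 = upd(5)[OF r(2) c deq]
      have lists: "map (\<lambda>i. nth_default 0 U i - (if list_ex (\<lambda>e. fst e = i) t then d else 0)) [0..<n] = U'"
        "map (\<lambda>i. nth_default 0 V i + (if list_ex (\<lambda>c. c = i) (tree_cols t) then d else 0)) [0..<n] = V'"
        unfolding U'_def V'_def using len by (auto simp: nth_default_nth list_ex_iff image_iff)
      have s': "?s' = hungarian_grow n s (d, (r, p), c)"
        using False sl by (simp add: hungarian_step_def s m)
      have tp: "tight b U' V' e" if "e \<in> set p" for e using upd(3) rp that by force
      show ?thesis
      proof (cases "c \<in> snd ` set M")
        case True
        then have ex: "list_ex (\<lambda>e. snd e = c) M" by (auto simp: list_ex_iff)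
        let ?f = "filter (\<lambda>e. snd e = c) M"
        have "?f \<noteq> []" using ex by (auto simp: list_ex_iff filter_empty_conv)
        then have "hd ?f \<in> set ?f" by (rule hd_in_set)
        then have "hd ?f \<in> set M" "snd (hd ?f) = c" by simp_all
        then obtain r' where r': "hd ?f = (r', c)" "(r', c) \<in> set M" by (metis prod.collapse)
        have s'': "?s' = (U', V', M, (r', (r, c) # p) # t)"
          unfolding s' hungarian_grow_def by (simp only: s fst_conv snd_conv lists ex r' if_True)
        have "alternating_tree n M rt ((r', (r, c) # p) # t)"
          by (rule alternating_tree_grow[OF M t rp c(2) r'(2)])
        then show ?thesis unfolding s'' hungarian_inv_def
          using upd(1-4) upd5 M tp less by (auto simp: progress_def s)
      next
        case False
        then have ex: "\<not> list_ex (\<lambda>e. snd e = c) M" by (auto simp: list_ex_iff)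
        let ?M' = "(r, c) # p @ filter (\<lambda>e. fst e \<notin> fst ` set ((r, c) # p)) M"
        have "(\<lambda>e :: nat \<times> nat. \<not> list_ex (\<lambda>e'. fst e' = fst e) ((r, c) # p)) =
          (\<lambda>e. fst e \<notin> fst ` set ((r, c) # p))"
          by (auto simp: list_ex_iff image_iff fun_eq_iff)
        then have s'': "?s' = (U', V', ?M', [])"
          unfolding s' hungarian_grow_def by (simp only: s fst_conv snd_conv lists ex if_False)
        note aug = matching_augment[OF M t rp c(1) False]
        have "length t \<le> n" by (rule alternating_tree_length[OF t])
        then have "progress n s < progress n ?s'"
          using aug(2) unfolding s'' progress_def by (simp add: s)
        moreover have "\<forall>e\<in>set ?M'. tight b U' V' e" using upd5 tp upd(2) by auto
        moreover have "\<forall>c<n. c \<notin> snd ` set ?M' \<longrightarrow> V' ! c = 0" using upd(4) aug(3) by blast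
        ultimately show ?thesis
          using upd(1) aug(1) less unfolding s'' hungarian_inv_def by simp
      qed
    qed
    then show "hungarian_inv n b B ?s'"
      "length (fst (snd (snd s))) < n \<Longrightarrow> progress n s < progress n ?s'"
      "length (fst (snd (snd s))) = n \<Longrightarrow> ?s' = s" by (simp_all add: s)
  qed
qed

lemma member_le_sum_list_int:
  assumes "x \<in> set xs" and "\<And>y. y \<in> set xs \<Longrightarrow> 0 \<le> y"
  shows "x \<le> (sum_list xs :: int)"
  using assms
proof (induction xs)
  case (Cons y ys)
  then have "0 \<le> sum_list ys" by (intro sum_list_nonneg) auto
  with Cons show ?case by (cases "x = y") fastforce+
qed simp

text \<open>The nested list only counts rounds. While the matching is incomplete
  \<open>progress\<close> stays below \<open>Suc n * Suc n\<close>, so this many rounds complete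
  it.\<close>

definition hungarian :: "nat \<Rightarrow> (nat \<Rightarrow> nat \<Rightarrow> int) \<Rightarrow> hstate" where
  "hungarian n b =
     fold (\<lambda>_. hungarian_step n b) (concat (map (\<lambda>_. [0..<Suc n]) [0..<Suc n])) (hungarian_init n b)"

text \<open>The sum of the initial row values is taken for \<open>B\<close> because it is easily
  computed from the input; all that matters is that its length is polynomial.\<close>

lemma hungarian_init_inv:
  fixes b :: "nat \<Rightarrow> nat \<Rightarrow> int" and n :: nat
  assumes b: "\<And>r c. 0 \<le> b r c"
  defines "B \<equiv> sum_list (fst (hungarian_init n b))"
  shows "hungarian_inv n b B (hungarian_init n b)" and "r < n \<Longrightarrow> c < n \<Longrightarrow> b r c \<le> B"
proof -
  let ?U = "fst (hungarian_init n b)"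
  have U: "?U ! r = sum_list (map (b r) [0..<n])" if "r < n" for r
    using that by (simp add: hungarian_init_def)
  have nn: "0 \<le> sum_list (map (b r) [0..<n])" for r by (rule sum_list_nonneg) (use b in auto)
  have row: "b r c \<le> sum_list (map (b r) [0..<n])" if "c < n" for r c
    using that b by (intro member_le_sum_list_int) auto
  have UB: "sum_list (map (b r) [0..<n]) \<le> B" if "r < n" for r
    unfolding B_def using that nn by (intro member_le_sum_list_int) (auto simp: hungarian_init_def)
  show "b r c \<le> B" if "r < n" "c < n" for r c
    using row[OF that(2)] UB[OF that(1)] by (rule order_trans)
  show "hungarian_inv n b B (hungarian_init n b)"
    unfolding hungarian_inv_def hungarian_init_def
    using row UB nn order_trans[OF nn UB] by (auto simp: dual_feasible_def matching_def)
qed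

text \<open>Either the matching is complete or every round so far has raised
  \<open>progress\<close>.\<close>

lemma hungarian_iterate:
  fixes b :: "nat \<Rightarrow> nat \<Rightarrow> int" and n :: nat
  assumes b: "\<And>r c. 0 \<le> b r c"
  defines "B \<equiv> sum_list (fst (hungarian_init n b))"
  defines "s \<equiv> \<lambda>k. (hungarian_step n b ^^ k) (hungarian_init n b)"
  shows "hungarian_inv n b B (s k)"
    and "length (fst (snd (snd (s k)))) = n \<or> k \<le> progress n (s k)"
proof -
  have "hungarian_inv n b B (s k) \<and> (length (fst (snd (snd (s k)))) = n \<or> k \<le> progress n (s k))"
  proof (induction k)
    case 0
    show ?case using hungarian_init_inv(1)[of b n] b by (simp add: s_def B_def)
  next
    case (Suc k)
    have bB: "\<And>r c. r < n \<Longrightarrow> c < n \<Longrightarrow> b r c \<le> B"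
      unfolding B_def by (rule hungarian_init_inv(2)[OF b])
    have inv: "hungarian_inv n b B (s k)" using Suc.IH by blast
    note step = hungarian_step[OF b bB inv]
    have Suc_s: "s (Suc k) = hungarian_step n b (s k)" by (simp add: s_def)
    have "length (fst (snd (snd (s k)))) \<le> n"
      using Suc.IH matching_length by (auto simp: hungarian_inv_def split: prod.splits)
    then consider "length (fst (snd (snd (s k)))) = n" | "length (fst (snd (snd (s k)))) < n"
      by linarith
    then show ?case
    proof cases
      case 1
      then show ?thesis using step(1,3) unfolding Suc_s by simp
    next
      case 2
      then have "Suc k \<le> progress n (s (Suc k))" using step(2) Suc.IH unfolding Suc_s by linarith
      then show ?thesis using step(1) unfolding Suc_s by blast
    qed
  qed
  then show "hungarian_inv n b B (s k)"
    "length (fst (snd (snd (s k)))) = n \<or> k \<le> progress n (s k)" by auto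
qed

lemma fold_const: "fold (\<lambda>_. f) xs = f ^^ length xs"
  by (induction xs) (simp_all add: funpow_Suc_right del: funpow.simps(2))

text \<open>Potentials that are feasible everywhere and tight on a perfect matching certify its
  optimality. The certificate is what the analysis consumes; maximality itself is never
  stated.\<close>

theorem hungarian:
  assumes b: "\<And>r c. 0 \<le> b r c"
  obtains U V M t where "hungarian n b = (U, V, M, t)" "matching n M" "length M = n"
    "\<And>r c. r < n \<Longrightarrow> c < n \<Longrightarrow> b r c \<le> U ! r + V ! c"
    "\<And>r c. (r, c) \<in> set M \<Longrightarrow> U ! r + V ! c = b r c"
proof -
  obtain U V M t where h: "hungarian n b = (U, V, M, t)" by (metis prod.collapse)
  let ?B = "sum_list (fst (hungarian_init n b))"
  have len: "length (concat (map (\<lambda>_. [0..<Suc n]) [0..<Suc n])) = Suc n * Suc n"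
    by (simp add: length_concat o_def sum_list_triv del: upt_Suc)
  have it: "hungarian n b = (hungarian_step n b ^^ (Suc n * Suc n)) (hungarian_init n b)"
    unfolding hungarian_def fold_const len ..
  have inv: "hungarian_inv n b ?B (U, V, M, t)"
    using hungarian_iterate(1)[where b = b and n = n and k = "Suc n * Suc n"] b unfolding it[symmetric] h by blast
  have M: "matching n M" using inv by (simp add: hungarian_inv_def)
  have "length t \<le> n"
    using inv alternating_tree_length unfolding hungarian_inv_def by (cases "t = []") auto
  have "length M = n"
  proof (rule ccontr)
    assume ne: "length M \<noteq> n"
    \<comment> \<open>After all rounds an incomplete matching would have more progress than
      \<open>n - 1\<close> edges and \<open>n\<close> tree rows can account for.\<close>
    then have "Suc n * Suc n \<le> progress n (U, V, M, t)"
      using hungarian_iterate(2)[where b = b and n = n and k = "Suc n * Suc n"] b unfolding it[symmetric] h by auto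
    moreover have "Suc (length M) \<le> n" using ne matching_length[OF M] by linarith
    then have "Suc n * Suc (length M) \<le> Suc n * n" by (rule mult_le_mono2)
    ultimately show False using \<open>length t \<le> n\<close> by (simp add: progress_def)
  qed
  with inv M show thesis
    by (intro that[OF h]) (auto simp: hungarian_inv_def dual_feasible_def tight_def)
qed

section \<open>Cycles of a perfect matching\<close>

fun path_sum :: "('a \<Rightarrow> 'a \<Rightarrow> int) \<Rightarrow> 'a list \<Rightarrow> int" where
  "path_sum f (x # y # zs) = f x y + path_sum f (y # zs)"
| "path_sum f _ = 0"

definition cycle_sum :: "('a \<Rightarrow> 'a \<Rightarrow> int) \<Rightarrow> 'a list \<Rightarrow> int" where
  "cycle_sum f xs = path_sum f xs + f (last xs) (hd xs)"

text \<open>Arcs of the permutation are inserted one at a time. The first component holds open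
  paths, the second closed cycles; an arc links two open paths or closes one. Reading ends by
  \<open>nth_default\<close> keeps the lookups total.\<close>

definition join_step :: "nat \<times> nat \<Rightarrow> nat list list \<times> nat list list \<Rightarrow> nat list list \<times> nat list list" where
  "join_step e s =
    (let p = nth_default [] (filter (\<lambda>p. nth_default 0 (rev p) 0 = fst e) (fst s)) 0;
         q = nth_default [] (filter (\<lambda>q. nth_default 0 q 0 = snd e) (fst s)) 0;
         rest = filter (\<lambda>p. nth_default 0 (rev p) 0 \<noteq> fst e \<and> nth_default 0 p 0 \<noteq> snd e) (fst s)
     in if nth_default 0 p 0 = snd e then (rest, p # snd s) else ((p @ q) # rest, snd s))"

definition cycles_of :: "nat \<Rightarrow> (nat \<times> nat) list \<Rightarrow> nat list list" where
  "cycles_of n M = snd (fold join_step M (map (\<lambda>i. [i]) [0..<n], []))"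

lemma path_sum_append:
  "p \<noteq> [] \<Longrightarrow> q \<noteq> [] \<Longrightarrow> path_sum f (p @ q) = path_sum f p + f (last p) (hd q) + path_sum f q"
proof (induction f p rule: path_sum.induct)
  case ("2_2" f x)
  then show ?case by (cases q) auto
qed auto

definition disjoint_lists :: "'a list list \<Rightarrow> bool" where
  "disjoint_lists L \<longleftrightarrow> distinct L \<and> [] \<notin> set L \<and> (\<forall>p\<in>set L. distinct p) \<and>
     (\<forall>p\<in>set L. \<forall>q\<in>set L. \<forall>x. x \<in> set p \<longrightarrow> x \<in> set q \<longrightarrow> p = q)"

text \<open>Open paths end in the rows whose arc is still to come and start in the columns not yet
  reached. The weight of the inserted arcs is split between open paths and cycles.\<close>

definition join_inv ::
  "nat \<Rightarrow> (nat \<Rightarrow> nat \<Rightarrow> int) \<Rightarrow> (nat \<times> nat) list \<Rightarrow> nat list list \<times> nat list list \<Rightarrow> bool" where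
  "join_inv n b M s \<longleftrightarrow> (case s of (P, D) \<Rightarrow>
     disjoint_lists (P @ D) \<and> \<Union>(set ` set (P @ D)) = {..<n} \<and>
     last ` set P = {..<n} - fst ` set M \<and> hd ` set P = {..<n} - snd ` set M \<and>
     sum (path_sum b) (set P) + sum_list (map (cycle_sum b) D) = (\<Sum>e\<leftarrow>M. b (fst e) (snd e)))"

lemma filter_eq_singleton: "distinct xs \<Longrightarrow> x \<in> set xs \<Longrightarrow> filter (\<lambda>y. y = x) xs = [x]"
  by (induction xs) (auto simp: filter_empty_conv)

lemma disjoint_lists_join:
  assumes disj: "disjoint_lists L" and pq: "p \<in> set L" "q \<in> set L" "p \<noteq> q"
    and L': "distinct L'" "set L' = set L - {p, q}"
  shows "disjoint_lists ((p @ q) # L')"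
proof -
  have ne: "[] \<notin> set L" and dis: "\<And>t. t \<in> set L \<Longrightarrow> distinct t"
    and eq: "\<And>t u x. t \<in> set L \<Longrightarrow> u \<in> set L \<Longrightarrow> x \<in> set t \<Longrightarrow> x \<in> set u \<Longrightarrow> t = u"
    using disj unfolding disjoint_lists_def by blast+
  have new: False if "t \<in> set L'" "x \<in> set t" "x \<in> set (p @ q)" for t x
    using that L'(2) eq[of t p x] eq[of t q x] pq by auto
  have "p \<noteq> []" using ne pq(1) by blast
  then obtain x where "x \<in> set (p @ q)" by (cases p) auto
  then have "p @ q \<notin> set L'" using new by blast
  moreover have "distinct (p @ q)" using dis[OF pq(1)] dis[OF pq(2)] eq[OF pq(1,2)] pq(3) by auto
  moreover have "t = u" if "t \<in> set ((p @ q) # L')" "u \<in> set ((p @ q) # L')"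
    "x \<in> set t" "x \<in> set u" for t u x
  proof -
    consider "t = p @ q" "u = p @ q" | "t = p @ q" "u \<in> set L'" | "t \<in> set L'" "u = p @ q"
      | "t \<in> set L'" "u \<in> set L'" using \<open>t \<in> _\<close> \<open>u \<in> _\<close> by (simp only: set_simps insert_iff) blast
    then show ?thesis
    proof cases
      case 2
      then show ?thesis using new[of u x] \<open>x \<in> set t\<close> \<open>x \<in> set u\<close> by simp
    next
      case 3
      then show ?thesis using new[of t x] \<open>x \<in> set t\<close> \<open>x \<in> set u\<close> by simp
    next
      case 4
      then show ?thesis using eq[of t u x] L'(2) \<open>x \<in> set t\<close> \<open>x \<in> set u\<close> by blast
    qed simp
  qed
  moreover have "distinct t" if "t \<in> set L'" for t using dis that L'(2) by blast
  moreover have "[] \<notin> set L'" using ne L'(2) by blast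
  ultimately show ?thesis
    using L'(1) \<open>p \<noteq> []\<close> unfolding disjoint_lists_def by (intro conjI; (simp; fail)?; blast)
qed

text \<open>By disjointness exactly one open path ends in \<open>r\<close> and exactly one starts in
  \<open>c\<close>. If they coincide the new arc closes a cycle, otherwise it becomes the joint of a
  longer path; either way its weight enters the sum.\<close>

lemma join_step_inv:
  assumes inv: "join_inv n b M s" and e: "r < n" "c < n" "r \<notin> fst ` set M" "c \<notin> snd ` set M"
  shows "join_inv n b (M @ [(r, c)]) (join_step (r, c) s)"
proof -
  obtain P D where s: "s = (P, D)" by (cases s)
  have disj: "disjoint_lists (P @ D)" and set: "\<Union>(set ` set (P @ D)) = {..<n}"
    and la: "last ` set P = {..<n} - fst ` set M"
    and hd: "hd ` set P = {..<n} - snd ` set M"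
    and sum: "sum (path_sum b) (set P) + sum_list (map (cycle_sum b) D) = (\<Sum>e\<leftarrow>M. b (fst e) (snd e))"
    using inv by (simp_all add: join_inv_def s)
  have ne: "p \<noteq> []" if "p \<in> set (P @ D)" for p
    using that disj unfolding disjoint_lists_def by metis
  have eq: "p = q" if "p \<in> set (P @ D)" "q \<in> set (P @ D)" "x \<in> set p" "x \<in> set q" for p q x
    using that disj unfolding disjoint_lists_def by metis
  have distPD: "distinct (P @ D)" using disj unfolding disjoint_lists_def by metis
  have "r \<in> last ` set P" using la e by simp
  then obtain p where p: "p \<in> set P" "last p = r" by auto
  have "c \<in> hd ` set P" using hd e by simp
  then obtain q where q: "q \<in> set P" "hd q = c" by auto
  have pq: "p \<in> set (P @ D)" "q \<in> set (P @ D)" using p q by auto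
  have h: "nth_default 0 p' 0 = hd p'" "nth_default 0 (rev p') 0 = last p'" if "p' \<in> set P" for p'
    using ne[of p'] that by (simp_all add: nth_default_nth hd_conv_nth[symmetric] hd_rev)
  have p_unique: "last p' = r \<longleftrightarrow> p' = p" if "p' \<in> set P" for p'
    using eq[OF _ pq(1), of p' r] that p(2) ne[of p'] ne[OF pq(1)]
    by (metis Un_iff last_in_set set_append)
  have q_unique: "hd q' = c \<longleftrightarrow> q' = q" if "q' \<in> set P" for q'
    using eq[OF _ pq(2), of q' c] that q(2) ne[of q'] ne[OF pq(2)]
    by (metis Un_iff hd_in_set set_append)
  have distP: "distinct P" using distPD by simp
  have "filter (\<lambda>p'. nth_default 0 (rev p') 0 = r) P = filter (\<lambda>p'. p' = p) P"
    using h p_unique by (intro filter_cong) auto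
  then have fp: "filter (\<lambda>p'. nth_default 0 (rev p') 0 = r) P = [p]"
    using filter_eq_singleton[OF distP p(1)] by simp
  have "filter (\<lambda>q'. nth_default 0 q' 0 = c) P = filter (\<lambda>q'. q' = q) P"
    using h q_unique by (intro filter_cong) auto
  then have fq: "filter (\<lambda>q'. nth_default 0 q' 0 = c) P = [q]"
    using filter_eq_singleton[OF distP q(1)] by simp
  let ?R = "filter (\<lambda>p'. nth_default 0 (rev p') 0 \<noteq> r \<and> nth_default 0 p' 0 \<noteq> c) P"
  have "set ?R = {p' \<in> set P. last p' \<noteq> r \<and> hd p' \<noteq> c}" using h by auto
  then have R: "set ?R = set P - {p, q}" using p_unique q_unique by blast
  have distR: "distinct (?R @ D)" using distPD by auto
  have lastR: "last ` (set P - {p}) = {..<n} - fst ` set (M @ [(r, c)])"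
  proof -
    have "last ` (set P - {p}) = last ` set P - {r}" using p_unique p by auto
    then show ?thesis using la by auto
  qed
  have hdR: "hd ` (set P - {q}) = {..<n} - snd ` set (M @ [(r, c)])"
  proof -
    have "hd ` (set P - {q}) = hd ` set P - {c}" using q_unique q by auto
    then show ?thesis using hd by auto
  qed
  have step: "join_step (r, c) s = (if p = q then (?R, p # D) else ((p @ q) # ?R, D))"
    using h[OF p(1)] q_unique[OF p(1)] by (simp add: join_step_def s fp fq nth_default_nth Let_def)
  show ?thesis
  proof (cases "p = q")
    case True
    have R': "set ?R = set P - {p}" using R True by simp
    have all: "set (?R @ p # D) = set (P @ D)" using R' p(1) by auto
    have "p \<notin> set ?R" "p \<notin> set D" using R' p(1) distPD by auto
    then have "disjoint_lists (?R @ p # D)"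
      using disj distR unfolding disjoint_lists_def all by simp
    moreover have "sum (path_sum b) (set P) = path_sum b p + sum (path_sum b) (set ?R)"
      unfolding R' by (rule sum.remove[OF _ p(1)]) simp
    moreover have "cycle_sum b p = path_sum b p + b r c"
      using p q True by (simp add: cycle_sum_def)
    moreover have "last ` set ?R = {..<n} - fst ` set (M @ [(r, c)])"
      "hd ` set ?R = {..<n} - snd ` set (M @ [(r, c)])"
      using lastR hdR R' True by simp_all
    moreover have "\<Union>(set ` set (?R @ p # D)) = {..<n}" unfolding all by (rule set)
    ultimately show ?thesis
      using sum True unfolding step join_inv_def by (simp del: set_append set_filter set_simps Union_iff)
  next
    case False
    have R': "set ?R = set P - {p} - {q}" using R by auto
    have RD: "set (?R @ D) = set (P @ D) - {p, q}" using R p q distPD by auto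
    have "p @ q \<notin> set (?R @ D)" and "disjoint_lists ((p @ q) # ?R @ D)"
      using disjoint_lists_join[OF disj pq False distR RD] by (simp_all add: disjoint_lists_def)
    moreover have "set (P @ D) = insert p (insert q (set (?R @ D)))" using R p q by auto
    then have "\<Union>(set ` set ((p @ q) # ?R @ D)) = {..<n}" using set by auto
    moreover have "last ` set ((p @ q) # ?R) = last ` (set P - {p})"
      unfolding list.set(2) R' using q(1) False ne[OF pq(2)]
      by (subst insert_Diff[of q "set P - {p}", symmetric]) auto
    moreover have "hd ` set ((p @ q) # ?R) = hd ` (set P - {q})"
      unfolding list.set(2) R using p(1) False ne[OF pq(1)]
      by (subst insert_Diff[of p "set P - {q}", symmetric]) auto
    moreover have "sum (path_sum b) (set ((p @ q) # ?R)) = sum (path_sum b) (set P) + b r c"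
    proof -
      have "sum (path_sum b) (set P) = path_sum b p + (path_sum b q + sum (path_sum b) (set ?R))"
        unfolding R' using sum.remove[of "set P" p "path_sum b"] sum.remove[of "set P - {p}" q "path_sum b"]
          p(1) q(1) False by simp
      moreover have "p @ q \<notin> set ?R" using \<open>p @ q \<notin> set (?R @ D)\<close> by simp
      then have "sum (path_sum b) (set ((p @ q) # ?R)) = path_sum b (p @ q) + sum (path_sum b) (set ?R)"
        unfolding list.set(2) by (rule sum.insert[OF finite_set])
      ultimately show ?thesis using path_sum_append[OF ne[OF pq(1)] ne[OF pq(2)]] p(2) q(2) by simp
    qed
    moreover note lastR hdR
    ultimately show ?thesis
      using sum False unfolding step join_inv_def by (simp del: set_append set_filter set_simps Union_iff)
  qed
qed

text \<open>Stated for every prefix of a matching, since the size bound of the loop also refers to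
  the states on the way.\<close>

lemma join_fold_inv:
  assumes "matching n (M @ N)"
  shows "join_inv n b M (fold join_step M (map (\<lambda>i. [i]) [0..<n], []))"
  using assms
proof (induction M arbitrary: N rule: rev_induct)
  case Nil
  have "inj (\<lambda>i :: nat. [i])" by (simp add: inj_def)
  then show ?case
    by (auto simp: join_inv_def disjoint_lists_def distinct_map image_image inj_on_def sum.reindex)
next
  case (snoc e M)
  obtain r c where e: "e = (r, c)" by (cases e)
  have "matching n (M @ e # N)" using snoc.prems by simp
  then have "r < n" "c < n" "r \<notin> fst ` set M" "c \<notin> snd ` set M"
    by (auto simp: matching_def e)
  from join_step_inv[OF snoc.IH[of "e # N"] this] snoc.prems show ?case by (simp add: e)
qed

text \<open>In a perfect matching every row has its arc, so no end is left for an open path and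
  everything has been closed into cycles.\<close>

lemma cycles_of:
  assumes M: "matching n M" "length M = n"
  shows "disjoint_lists (cycles_of n M)" and "\<Union>(set ` set (cycles_of n M)) = {..<n}"
    and "sum_list (map (cycle_sum b) (cycles_of n M)) = (\<Sum>e\<leftarrow>M. b (fst e) (snd e))"
proof -
  obtain P D where PD: "fold join_step M (map (\<lambda>i. [i]) [0..<n], []) = (P, D)" by (metis prod.collapse)
  then have D: "cycles_of n M = D" by (simp add: cycles_of_def)
  have inv: "join_inv n b M (P, D)" for b using join_fold_inv[of n M "[]"] M(1) PD by simp
  have "fst ` set M = {..<n}"
  proof (rule card_subset_eq)
    show "fst ` set M \<subseteq> {..<n}" using matching_bound[OF M(1)] by auto
    show "card (fst ` set M) = card {..<n}"
      using M unfolding matching_def by (metis card_lessThan distinct_card length_map list.set_map)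
  qed simp
  then have "P = []" using inv by (simp add: join_inv_def)
  with inv show "disjoint_lists (cycles_of n M)" "\<Union>(set ` set (cycles_of n M)) = {..<n}"
    "sum_list (map (cycle_sum b) (cycles_of n M)) = (\<Sum>e\<leftarrow>M. b (fst e) (snd e))"
    by (simp_all add: join_inv_def D)
qed

section \<open>From cycles to tours\<close>

text \<open>
  From here on customers are numbered from \<open>0\<close>, so that customer \<open>i\<close> is vertex \<open>Suc i\<close>.
\<close>

primrec route :: "(nat \<Rightarrow> nat \<Rightarrow> int) \<Rightarrow> nat \<Rightarrow> nat list \<Rightarrow> int" where
  "route w u [] = w u 0"
| "route w u (i # is) = w u (Suc i) + route w (Suc i) is"

definition groups_cost :: "(nat \<Rightarrow> nat \<Rightarrow> int) \<Rightarrow> nat list list \<Rightarrow> int" where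
  "groups_cost w gs = sum_list (map (route w 0) gs)"

fun pair_up :: "'a list \<Rightarrow> 'a list list" where
  "pair_up (a # b # xs) = [a, b] # pair_up xs"
| "pair_up [a] = [[a]]"
| "pair_up [] = []"

text \<open>For odd length at least 3 the tail falls into full pairs, so the group at the head is
  the only triple and nobody is left alone.\<close>

definition triple_up :: "'a list \<Rightarrow> 'a list list" where
  "triple_up xs = (if pair_up (tl xs) = [] then [xs]
     else (hd xs # hd (pair_up (tl xs))) # tl (pair_up (tl xs)))"

text \<open>A group above the capacity is dissolved. This saves nothing, in accordance with
  \<open>pair_gain\<close> being 0 there.\<close>

definition split_group :: "(nat \<Rightarrow> nat) \<Rightarrow> nat list \<Rightarrow> nat list list" where
  "split_group d g = (if sum_list (map d g) \<le> 3 then [g] else map (\<lambda>i. [i]) g)"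

text \<open>The head of the accumulator is the latest rotation; after a full turn the original list
  occurs twice, which is harmless.\<close>

definition rotations :: "'a list \<Rightarrow> 'a list list" where
  "rotations xs = fold (\<lambda>_ acc. rotate1 (hd acc) # acc) xs [xs]"

text \<open>The case distinction on cycles belongs to the analysis alone: the algorithm tries both
  ways of cutting on every rotation.\<close>

definition candidates :: "(nat \<Rightarrow> nat) \<Rightarrow> nat list \<Rightarrow> nat list list list" where
  "candidates d xs = map (\<lambda>gs. concat (map (split_group d) gs))
     (map pair_up (rotations xs) @ map triple_up (rotations xs))"

definition best_groups :: "(nat \<Rightarrow> nat) \<Rightarrow> (nat \<Rightarrow> nat \<Rightarrow> int) \<Rightarrow> nat list \<Rightarrow> nat list list" where
  "best_groups d w xs = min_by (groups_cost w) (candidates d xs)"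

definition saving :: "(nat \<Rightarrow> nat \<Rightarrow> int) \<Rightarrow> nat \<Rightarrow> nat \<Rightarrow> int" where
  "saving w i j = w 0 (Suc i) + w 0 (Suc j) - w (Suc i) (Suc j)"

text \<open>
  Pairs that contain a customer of demand 2 count only half: an odd cycle through such a customer
  cannot be cut into pairs and one triple.
\<close>

definition benefit :: "(nat \<Rightarrow> nat) \<Rightarrow> (nat \<Rightarrow> nat \<Rightarrow> int) \<Rightarrow> nat \<Rightarrow> nat \<Rightarrow> int" where
  "benefit d w i j =
     (if i = j \<or> saving w i j < 0 then 0
      else if d i + d j = 2 then 2 * saving w i j
      else if d i + d j = 3 then saving w i j else 0)"

definition solve_groups :: "nat \<Rightarrow> (nat \<Rightarrow> nat) \<Rightarrow> (nat \<Rightarrow> nat \<Rightarrow> int) \<Rightarrow> nat list list" where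
  "solve_groups n d w =
     concat (map (best_groups d w) (cycles_of n (fst (snd (snd (hungarian n (benefit d w)))))))"

lemma benefit_nonneg: "0 \<le> benefit d w i j"
  by (simp add: benefit_def)

section \<open>Groups: no customer is lost, and the capacity is respected\<close>

lemma concat_pair_up [simp]: "concat (pair_up xs) = xs"
  by (induction xs rule: pair_up.induct) auto

lemma concat_triple_up [simp]: "concat (triple_up xs) = xs"
proof (cases "pair_up (tl xs) = []")
  case False
  then have "xs \<noteq> []" by auto
  moreover have "hd (pair_up (tl xs)) @ concat (tl (pair_up (tl xs))) = tl xs"
    using False concat_pair_up[of "tl xs"] by (cases "pair_up (tl xs)") (simp_all del: concat_pair_up)
  ultimately show ?thesis using False by (simp add: triple_up_def)
qed (simp add: triple_up_def)

lemma concat_split_groups [simp]: "concat (concat (map (split_group d) gs)) = concat gs"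
proof (induction gs)
  case (Cons g gs)
  have "concat (map (\<lambda>i. [i]) g) = g" by (induction g) auto
  with Cons show ?case by (simp add: split_group_def)
qed simp

lemma split_group_demand:
  assumes "g' \<in> set (split_group d g)" and "\<And>i. i \<in> set g \<Longrightarrow> d i \<le> 3"
  shows "sum_list (map d g') \<le> 3"
  using assms by (auto simp: split_group_def split: if_splits)

lemma set_rotations: "set (rotations xs) = (\<lambda>k. rotate k xs) ` {..length xs}"
proof -
  have "set (fold (\<lambda>_ acc. rotate1 (hd acc) # acc) ys [xs]) = (\<lambda>k. rotate k xs) ` {..length ys} \<and>
    hd (fold (\<lambda>_ acc. rotate1 (hd acc) # acc) ys [xs]) = rotate (length ys) xs" for ys :: "'a list"
    by (induction ys rule: rev_induct) (auto simp: atMost_Suc)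
  then show ?thesis by (simp add: rotations_def)
qed

lemma rotate_in_rotations: "rotate k xs \<in> set (rotations xs)"
proof (cases "xs = []")
  case False
  then have "k mod length xs \<le> length xs" by (simp add: order_less_imp_le)
  then show ?thesis unfolding set_rotations by (subst rotate_conv_mod) blast
qed (simp add: set_rotations)

lemma candidates_pair: "concat (map (split_group d) (pair_up (rotate k xs))) \<in> set (candidates d xs)"
  and candidates_triple: "concat (map (split_group d) (triple_up (rotate k xs))) \<in> set (candidates d xs)"
  using rotate_in_rotations[of k xs] by (auto simp: candidates_def)

lemma candidates_concat:
  assumes "gs \<in> set (candidates d xs)"
  shows "\<exists>k. concat gs = rotate k xs"
  using assms by (auto simp: candidates_def set_rotations)

lemma candidates_demand:
  assumes "gs \<in> set (candidates d xs)" and "\<And>i. i \<in> set xs \<Longrightarrow> d i \<le> 3" and "g \<in> set gs"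
  shows "sum_list (map d g) \<le> 3"
proof -
  obtain k hs where hs: "gs = concat (map (split_group d) hs)" "concat hs = rotate k xs"
    using assms(1) by (auto simp: candidates_def set_rotations)
  then obtain h where h: "h \<in> set hs" "g \<in> set (split_group d h)" using assms(3) by auto
  have "set h \<subseteq> set (concat hs)" using h(1) by auto
  then have "set h \<subseteq> set xs" using hs(2) by simp
  then show ?thesis using split_group_demand[OF h(2)] assms(2) by blast
qed

lemma best_groups:
  shows "best_groups d w xs \<in> set (candidates d xs)"
    and "gs \<in> set (candidates d xs) \<Longrightarrow> groups_cost w (best_groups d w xs) \<le> groups_cost w gs"
proof -
  have "candidates d xs \<noteq> []" using candidates_pair[of d 0 xs] by force
  from min_by[OF this, where f = "groups_cost w"] show "best_groups d w xs \<in> set (candidates d xs)"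
    and "gs \<in> set (candidates d xs) \<Longrightarrow> groups_cost w (best_groups d w xs) \<le> groups_cost w gs"
    by (auto simp: best_groups_def)
qed

section \<open>Arc sums and the gain of alternate arcs\<close>

lemma path_sum_mono:
  "(\<And>x y. x \<in> set xs \<Longrightarrow> y \<in> set xs \<Longrightarrow> f x y \<le> g x y) \<Longrightarrow> path_sum f xs \<le> path_sum g xs"
proof (induction f xs rule: path_sum.induct)
  case (1 f x y zs)
  then have "f x y \<le> g x y" "path_sum f (y # zs) \<le> path_sum g (y # zs)" by auto
  then show ?case by simp
qed auto

lemma path_sum_scale: "path_sum (\<lambda>x y. c * f x y) xs = c * path_sum f xs"
  by (induction f xs rule: path_sum.induct) (auto simp: algebra_simps)

lemma cycle_sum_rotate: "cycle_sum f (rotate k xs) = cycle_sum f xs"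
proof (induction k)
  case (Suc k)
  have "cycle_sum f (rotate1 ys) = cycle_sum f ys" for ys
  proof (cases ys)
    case (Cons a zs)
    then show ?thesis
      using path_sum_append[of zs "[a]" f] by (cases zs) (auto simp: cycle_sum_def)
  qed simp
  with Suc show ?case by simp
qed simp

fun gain :: "('a \<Rightarrow> 'a \<Rightarrow> int) \<Rightarrow> 'a list \<Rightarrow> int" where
  "gain f (a # b # xs) = f a b + gain f xs"
| "gain f _ = 0"

text \<open>Pairing from the first and pairing from the second element use complementary sets of
  arcs.\<close>

lemma gain_Cons: "gain f (a # xs) + gain f xs = path_sum f (a # xs)"
proof (induction xs arbitrary: a)
  case (Cons b xs)
  from Cons.IH[of b] show ?case by simp
qed simp

lemma gain_snoc_even: "even (length xs) \<Longrightarrow> gain f (xs @ [a]) = gain f xs"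
  by (induction f xs rule: gain.induct) auto

lemma gain_snoc_odd: "odd (length xs) \<Longrightarrow> gain f (xs @ [a]) = gain f xs + f (last xs) a"
proof (induction f xs rule: gain.induct)
  case (1 f b c xs)
  then show ?case by (cases xs) auto
qed auto

text \<open>One rotation passes to the other alternate arcs; for even length the closing arc is
  among them.\<close>

lemma gain_rotate_even:
  assumes "even (length xs)" and "xs \<noteq> []"
  shows "gain f xs + gain f (rotate1 xs) = cycle_sum f xs"
proof -
  obtain a ys where xs: "xs = a # ys" using assms(2) by (cases xs) auto
  then have "odd (length ys)" using assms(1) by simp
  then have "ys \<noteq> []" "gain f (ys @ [a]) = gain f ys + f (last ys) a" by (auto simp: gain_snoc_odd)
  then show ?thesis using gain_Cons[of f a ys] by (simp add: xs cycle_sum_def)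
qed

section \<open>Upper and lower bounds for integer weights\<close>

locale routing =
  fixes n :: nat and d :: "nat \<Rightarrow> nat" and w :: "nat \<Rightarrow> nat \<Rightarrow> int"
  assumes demand: "i < n \<Longrightarrow> 1 \<le> d i" "i < n \<Longrightarrow> d i \<le> 3"
    and nonneg: "u \<le> n \<Longrightarrow> v \<le> n \<Longrightarrow> 0 \<le> w u v"
    and sym: "u \<le> n \<Longrightarrow> v \<le> n \<Longrightarrow> w u v = w v u"
    and triangle: "u \<le> n \<Longrightarrow> v \<le> n \<Longrightarrow> x \<le> n \<Longrightarrow> w u x \<le> w u v + w v x"
    and refl: "u \<le> n \<Longrightarrow> w u u = 0"
begin

abbreviation radius :: "nat \<Rightarrow> int" where
  "radius i \<equiv> w 0 (Suc i)"

text \<open>What a pair really saves as a group, as opposed to the weight \<open>benefit\<close>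
  used in the optimisation.\<close>

definition pair_gain :: "nat \<Rightarrow> nat \<Rightarrow> int" where
  "pair_gain i j = (if d i + d j \<le> 3 then saving w i j else 0)"

lemma saving_nonneg: "i < n \<Longrightarrow> j < n \<Longrightarrow> 0 \<le> saving w i j"
  using triangle[of "Suc i" 0 "Suc j"] sym[of 0 "Suc i"] by (simp add: saving_def)

lemma benefit_le_2_gain: "i < n \<Longrightarrow> j < n \<Longrightarrow> benefit d w i j \<le> 2 * pair_gain i j"
  using saving_nonneg[of i j] by (auto simp: benefit_def pair_gain_def)

text \<open>Pairs of unit demands enter \<open>benefit\<close> with twice their saving, pairs with a
  larger demand at most once. This difference pays for odd cycles.\<close>

lemma benefit_le_gain:
  "i < n \<Longrightarrow> j < n \<Longrightarrow> 2 \<le> d i \<or> 2 \<le> d j \<Longrightarrow> benefit d w i j \<le> pair_gain i j"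
  using saving_nonneg[of i j] demand[of i] demand[of j] by (auto simp: benefit_def pair_gain_def)

lemma radius_sym: "i < n \<Longrightarrow> w (Suc i) 0 = radius i"
  by (simp add: sym)

lemma groups_cost_append: "groups_cost w (gs @ hs) = groups_cost w gs + groups_cost w hs"
  by (simp add: groups_cost_def)

lemma groups_cost_concat: "groups_cost w (concat gss) = (\<Sum>gs\<leftarrow>gss. groups_cost w gs)"
  by (induction gss) (simp_all add: groups_cost_append, simp add: groups_cost_def)

lemma cost_pair_up:
  assumes "set xs \<subseteq> {..<n}"
  shows "groups_cost w (concat (map (split_group d) (pair_up xs))) =
    (\<Sum>i\<leftarrow>xs. 2 * radius i) - gain pair_gain xs"
  using assms
proof (induction xs rule: pair_up.induct)
  case (1 a b xs)
  then have "groups_cost w (split_group d [a, b]) = 2 * radius a + 2 * radius b - pair_gain a b"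
    by (auto simp: groups_cost_def split_group_def pair_gain_def saving_def radius_sym)
  with 1 show ?case by (simp add: groups_cost_append)
next
  case (2 a)
  then show ?case by (simp add: groups_cost_def split_group_def radius_sym)
qed (simp add: groups_cost_def)

text \<open>A triple served in order saves its two consecutive arcs; unit demands make it fit the
  capacity.\<close>

lemma cost_triple_up:
  assumes "set (a # b # c # xs) \<subseteq> {..<n}" and "d a = 1" "d b = 1" "d c = 1"
  shows "groups_cost w (concat (map (split_group d) (triple_up (a # b # c # xs)))) =
    (\<Sum>i\<leftarrow>a # b # c # xs. 2 * radius i) - (pair_gain a b + pair_gain b c + gain pair_gain xs)"
proof -
  have "groups_cost w (split_group d [a, b, c]) =
    2 * radius a + 2 * radius b + 2 * radius c - (pair_gain a b + pair_gain b c)"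
    using assms by (simp add: groups_cost_def split_group_def pair_gain_def saving_def radius_sym)
  then show ?thesis using cost_pair_up[of xs] assms(1) by (simp add: triple_up_def groups_cost_append)
qed

text \<open>
  Two or three rotations of the cycle, averaged with suitable weights, gain enough; hence so does the
  best of them.
\<close>

lemma best_groups_cost:
  assumes xs: "xs \<noteq> []" "set xs \<subseteq> {..<n}"
  shows "4 * groups_cost w (best_groups d w xs) \<le> (\<Sum>i\<leftarrow>xs. 8 * radius i) - cycle_sum (benefit d w) xs"
proof -
  let ?C = "groups_cost w (best_groups d w xs)"
  let ?R = "\<Sum>i\<leftarrow>xs. 2 * radius i" and ?b = "benefit d w"
  have sub: "set (rotate k xs) \<subseteq> {..<n}" for k using xs(2) by simp
  have radii: "(\<Sum>i\<leftarrow>rotate k xs. 2 * radius i) = ?R" for k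
  proof (induction k)
    case (Suc k)
    have "(\<Sum>i\<leftarrow>rotate1 ys. 2 * radius i) = (\<Sum>i\<leftarrow>ys. 2 * radius i)" for ys by (cases ys) auto
    with Suc show ?case by simp
  qed simp
  have pairs: "?C \<le> ?R - gain pair_gain (rotate k xs)" for k
    using best_groups(2)[OF candidates_pair, of w d xs k] cost_pair_up[OF sub, of k] radii[of k] by simp
  have triple: "?C \<le> ?R - (pair_gain a b + pair_gain b c + gain pair_gain ys)"
    if "rotate k xs = a # b # c # ys" "d a = 1" "d b = 1" "d c = 1" for k a b c ys
    using best_groups(2)[OF candidates_triple, of w d xs k] cost_triple_up[of a b c ys] sub[of k] radii[of k] that
    by simp
  have b2: "path_sum ?b ys \<le> 2 * path_sum pair_gain ys" if "set ys \<subseteq> {..<n}" for ys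
    using path_sum_mono[of ys ?b "\<lambda>x y. 2 * pair_gain x y"] benefit_le_2_gain that
    by (auto simp: path_sum_scale subset_iff)
  have c2: "cycle_sum ?b ys \<le> 2 * cycle_sum pair_gain ys" if "set ys \<subseteq> {..<n}" "ys \<noteq> []" for ys
  proof -
    have "last ys < n" "hd ys < n" using that last_in_set hd_in_set by blast+
    then show ?thesis using b2[OF that(1)] benefit_le_2_gain[of "last ys" "hd ys"]
      by (simp add: cycle_sum_def)
  qed
  have "4 * ?C \<le> 4 * ?R - cycle_sum ?b xs"
  proof (cases "even (length xs)")
    case True
    then show ?thesis
      using gain_rotate_even[OF True xs(1), of pair_gain] pairs[of 0] pairs[of 1] c2[OF xs(2,1)] by simp
  next
    case odd: False
    show ?thesis
    proof (cases "length xs = 1")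
      case True
      \<comment> \<open>A fixed point of the permutation is a customer served alone; the diagonal of
        \<open>benefit\<close> is 0.\<close>
      then obtain a where "xs = [a]" by (metis One_nat_def Suc_length_conv length_0_conv)
      then show ?thesis using pairs[of 0] by (simp add: cycle_sum_def benefit_def)
    next
      case False
      have three: "\<exists>a b r. rotate k xs = a # b # r \<and> odd (length r)" for k
      proof -
        have "length (rotate k xs) \<ge> 2" using odd False xs(1) by (cases xs) (auto simp: Suc_le_eq)
        then obtain a b r where "rotate k xs = a # b # r"
          by (metis Suc_le_length_iff numeral_2_eq_2)
        moreover from this have "length xs = Suc (Suc (length r))" by (metis length_rotate length_Cons)
        ultimately show ?thesis using odd by auto
      qed
      show ?thesis
      proof (cases "\<exists>a\<in>set xs. 2 \<le> d a")
        case True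
        then obtain k where k: "k < length xs" "2 \<le> d (xs ! k)" by (auto simp: in_set_conv_nth)
        obtain a b r where z: "rotate k xs = a # b # r" "odd (length r)" using three by blast
        have "hd (rotate k xs) = xs ! k" using k(1) xs(1) by (simp add: hd_rotate_conv_nth)
        then have a: "2 \<le> d a" using k(2) z(1) by simp
        have r: "r \<noteq> []" using z(2) by auto
        have n: "a < n" "b < n" "last r < n" "set (b # r) \<subseteq> {..<n}"
          using sub[of k] r last_in_set[OF r] unfolding z by (auto simp: subset_iff)
        \<comment> \<open>Three rotations are compared. The one starting at \<open>a\<close> leaves
          \<open>last r\<close> single, the next leaves \<open>a\<close> single, and the third
          leaves \<open>b\<close> single.\<close>
        have r1: "rotate (Suc k) xs = (b # r) @ [a]" and r2: "rotate (Suc (Suc k)) xs = (r @ [a]) @ [b]"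
          using z(1) by simp_all
        have g1: "gain pair_gain (rotate (Suc k) xs) = gain pair_gain (b # r)"
          unfolding r1 by (rule gain_snoc_even) (use z(2) in simp)
        have g2: "gain pair_gain (rotate (Suc (Suc k)) xs) = gain pair_gain r + pair_gain (last r) a"
          unfolding r2 by (subst gain_snoc_even) (use z(2) in \<open>simp_all add: gain_snoc_odd\<close>)
        have "cycle_sum ?b xs = cycle_sum ?b (a # b # r)"
          using cycle_sum_rotate[of ?b k xs] z(1) by simp
        also have "\<dots> = ?b a b + path_sum ?b (b # r) + ?b (last r) a"
          using r by (simp add: cycle_sum_def)
        \<comment> \<open>The right side is the gain of the first rotation, twice that of the
          second, and that of the third; the weights 1, 2, 1 make up the factor 4. The two arcs at
          \<open>a\<close> occur only once, which is where their reduced \<open>benefit\<close>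
          enters.\<close>
        also have "\<dots> \<le> pair_gain a b + 2 * (gain pair_gain (b # r) + gain pair_gain r) + pair_gain (last r) a"
          unfolding gain_Cons using benefit_le_gain[OF n(1,2) disjI1[OF a]]
            benefit_le_gain[OF n(3,1) disjI2[OF a]] b2[OF n(4)] by (intro add_mono)
        finally show ?thesis
          using pairs[of k] pairs[of "Suc k"] pairs[of "Suc (Suc k)"] unfolding g1 g2 unfolding z
          by simp
      next
        case all: False
        have one: "d i = 1" if "i \<in> set xs" for i
          using all that demand(1)[of i] xs(2) by (force simp: not_le)
        obtain a b r' where z: "xs = a # b # r'" "odd (length r')" using three[of 0] by auto
        obtain c r where r': "r' = c # r" using z(2) by (cases r') auto
        have xs': "xs = a # b # c # r" and ev: "even (length r)" using z r' by auto
        have g0: "?C \<le> ?R - (pair_gain a b + pair_gain b c + gain pair_gain r)"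
          by (rule triple[of 0]) (use one xs' in auto)
        have nn: "0 \<le> pair_gain i j" if "i \<in> set xs" "j \<in> set xs" for i j
          using saving_nonneg[of i j] that xs(2) by (auto simp: pair_gain_def)
        \<comment> \<open>Cutting with a triple at two successive rotations uses every arc of the
          cycle, and the arc from \<open>b\<close> to \<open>c\<close> twice; its nonnegative saving
          is the surplus.\<close>
        have "cycle_sum pair_gain xs \<le> 2 * (?R - ?C)"
        proof (cases r)
          case Nil
          have "?C \<le> ?R - (pair_gain b c + pair_gain c a + gain pair_gain [])"
            by (rule triple[of 1]) (use one xs' Nil in auto)
          with g0 nn[of b c] show ?thesis by (simp add: xs' Nil cycle_sum_def)
        next
          case (Cons e s)
          have "?C \<le> ?R - (pair_gain b c + pair_gain c e + gain pair_gain (s @ [a]))"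
            by (rule triple[of 1]) (use one xs' Cons in auto)
          moreover have "odd (length s)" "s \<noteq> []" using ev Cons by auto
          ultimately show ?thesis
            using g0 nn[of b c] gain_Cons[of pair_gain e s]
            by (simp add: xs' Cons cycle_sum_def gain_snoc_odd)
        qed
        then show ?thesis using c2[OF xs(2,1)] by simp
      qed
    qed
  qed
  moreover have "(\<Sum>i\<leftarrow>xs. 8 * radius i) = 4 * ?R"
    by (simp add: sum_list_const_mult[symmetric] mult.assoc[symmetric])
  ultimately show ?thesis by simp
qed

text \<open>Each customer takes at least one unit, so there are at most three of them. Adding the
  dual inequalities along the arcs of a cycle through the customers, a loop if there is only one,
  meets every \<open>U\<close> and every \<open>V\<close> exactly once.\<close>

lemma tour_bound:
  assumes dual: "\<And>i j. i < n \<Longrightarrow> j < n \<Longrightarrow> benefit d w i j \<le> U i + V j"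
    and xs: "distinct xs" "set xs \<subseteq> {..<n}" "sum_list (map d xs) \<le> 3"
  shows "(\<Sum>i\<leftarrow>xs. 8 * radius i - (U i + V i)) \<le> 6 * route w 0 xs"
proof -
  have "length xs \<le> sum_list (map d xs)"
    using xs(2) demand(1) by (induction xs) force+
  then have "length xs \<le> 3" using xs(3) by linarith
  then consider "xs = []" | a where "xs = [a]" | a b where "xs = [a, b]" | a b c where "xs = [a, b, c]"
    by (auto simp: le_Suc_eq length_Suc_conv numeral_3_eq_3)
  then show ?thesis
  proof cases
    case 1
    then show ?thesis by (simp add: refl)
  next
    case (2 a)
    then show ?thesis using xs(2) dual[of a a] nonneg[of 0 "Suc a"] by (simp add: benefit_def radius_sym)
  next
    case (3 a b)
    then have n: "a < n" "b < n" "a \<noteq> b" "d a + d b \<le> 3" using xs by auto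
    then consider "d a + d b = 2" | "d a + d b = 3" using demand(1)[of a] demand(1)[of b] by linarith
    then show ?thesis
      using dual[of a b] dual[of b a] saving_nonneg[of a b] saving_nonneg[of b a] n
        nonneg[of 0 "Suc a"] nonneg[of 0 "Suc b"] nonneg[of "Suc a" "Suc b"] sym[of "Suc a" "Suc b"]
      by cases (simp_all add: 3 benefit_def radius_sym saving_def)
  next
    case (4 a b c)
    then have n: "a < n" "b < n" "c < n" "a \<noteq> b" "b \<noteq> c" "a \<noteq> c" "d a + d b + d c \<le> 3" using xs by auto
    then have one: "d a = 1" "d b = 1" "d c = 1"
      using demand(1)[of a] demand(1)[of b] demand(1)[of c] by linarith+
    have "2 * saving w a b + 2 * saving w b c + 2 * saving w c a \<le> U a + V b + (U b + V c) + (U c + V a)"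
      using dual[of a b] dual[of b c] dual[of c a] saving_nonneg[of a b] saving_nonneg[of b c]
        saving_nonneg[of c a] n by (simp add: benefit_def one)
    \<comment> \<open>The first two inequalities bound the radius of the middle customer
      \<open>b\<close> from both ends of the route, the third bounds the side between
      \<open>c\<close> and \<open>a\<close> that the route does not use. Each is used twice.\<close>
    then show ?thesis
      using triangle[of 0 "Suc a" "Suc b"] triangle[of 0 "Suc c" "Suc b"]
        triangle[of "Suc c" "Suc b" "Suc a"] sym[of "Suc b" "Suc c"] sym[of "Suc b" "Suc a"] n
      by (simp add: 4 radius_sym saving_def)
  qed
qed

text \<open>The potentials are passed on as a certificate: tightness on the matching bounds the cost
  of the groups, and feasibility on all pairs will bound every tour of any other solution.\<close>

lemma solve_groups:
  shows "\<exists>U V. (\<forall>i<n. \<forall>j<n. benefit d w i j \<le> U i + V j) \<and>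
      4 * groups_cost w (solve_groups n d w) \<le> (\<Sum>i<n. 8 * radius i - (U i + V i))"
    and "distinct (concat (solve_groups n d w))"
    and "set (concat (solve_groups n d w)) = {..<n}"
    and "g \<in> set (solve_groups n d w) \<Longrightarrow> sum_list (map d g) \<le> 3"
proof -
  let ?b = "benefit d w"
  obtain U V M t where h: "hungarian n ?b = (U, V, M, t)" and M: "matching n M" "length M = n"
    and dual: "\<And>r c. r < n \<Longrightarrow> c < n \<Longrightarrow> ?b r c \<le> U ! r + V ! c"
    and tight: "\<And>r c. (r, c) \<in> set M \<Longrightarrow> U ! r + V ! c = ?b r c"
    using hungarian[of ?b n] benefit_nonneg by blast
  let ?D = "cycles_of n M"
  note D = cycles_of[OF M]
  have sol: "solve_groups n d w = concat (map (best_groups d w) ?D)"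
    by (simp add: solve_groups_def h)
  have Dne: "xs \<noteq> []" "set xs \<subseteq> {..<n}" "distinct xs" if "xs \<in> set ?D" for xs
    using that D(1,2) by (auto simp: disjoint_lists_def)
  have setb: "\<exists>k. concat (best_groups d w xs) = rotate k xs" for xs
    by (rule candidates_concat[OF best_groups(1)])
  have setb': "set (concat (best_groups d w xs)) = set xs" "distinct (concat (best_groups d w xs)) = distinct xs" for xs
    using setb[of xs] by (metis set_rotate, metis distinct_rotate)
  have cc: "concat (solve_groups n d w) = concat (map (\<lambda>xs. concat (best_groups d w xs)) ?D)"
  proof -
    have "concat (concat (map f L)) = concat (map (\<lambda>xs. concat (f xs)) L)" for f :: "nat list \<Rightarrow> nat list list" and L
      by (induction L) auto
    then show ?thesis unfolding sol .
  qed
  show "set (concat (solve_groups n d w)) = {..<n}"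
  proof -
    have "set (concat (solve_groups n d w)) = (\<Union>xs\<in>set ?D. set (concat (best_groups d w xs)))"
      unfolding cc by simp
    then show ?thesis unfolding setb'(1) D(2) .
  qed
  have dD: "distinct (concat (map f ?D))" if "\<And>xs. set (f xs) = set xs" "\<And>xs. distinct (f xs) = distinct xs"
    for f :: "nat list \<Rightarrow> nat list"
  proof -
    have "distinct (concat (map f L))" if "disjoint_lists L" for L
      using that
    proof (induction L)
      case (Cons p L)
      have "set p \<inter> set q = {}" if "q \<in> set L" for q
        using Cons.prems that unfolding disjoint_lists_def by auto
      moreover have "disjoint_lists L" "distinct p" using Cons.prems unfolding disjoint_lists_def by auto
      ultimately show ?case using Cons.IH \<open>\<And>xs. set (f xs) = set xs\<close> \<open>\<And>xs. distinct (f xs) = distinct xs\<close>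
        by auto
    qed simp
    then show ?thesis using D(1) by blast
  qed
  show "distinct (concat (solve_groups n d w))"
    unfolding cc by (rule dD) (rule setb')+
  show "sum_list (map d g) \<le> 3" if "g \<in> set (solve_groups n d w)"
  proof -
    obtain xs where "xs \<in> set ?D" "g \<in> set (best_groups d w xs)" using \<open>g \<in> _\<close> by (auto simp: sol)
    then show ?thesis
      using candidates_demand[OF best_groups(1)] Dne(2) demand(2) by blast
  qed
  have sumD: "(\<Sum>xs\<leftarrow>?D. \<Sum>i\<leftarrow>xs. f i) = (\<Sum>i<n. f i)" for f :: "nat \<Rightarrow> int"
  proof -
    have "distinct (concat ?D)" using dD[of "\<lambda>xs. xs"] by simp
    moreover have "set (concat ?D) = {..<n}" using D(2) by simp
    ultimately have "(\<Sum>i<n. f i) = (\<Sum>i\<leftarrow>concat ?D. f i)" by (metis sum_list_distinct_conv_sum_set)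
    also have "(\<Sum>i\<leftarrow>concat L. f i) = (\<Sum>xs\<leftarrow>L. \<Sum>i\<leftarrow>xs. f i)" for L by (induction L) auto
    finally show ?thesis by simp
  qed
  have "4 * groups_cost w (solve_groups n d w) = (\<Sum>xs\<leftarrow>?D. 4 * groups_cost w (best_groups d w xs))"
    unfolding sol groups_cost_concat by (simp add: sum_list_const_mult[symmetric] o_def)
  also have "\<dots> \<le> (\<Sum>xs\<leftarrow>?D. (\<Sum>i\<leftarrow>xs. 8 * radius i) - cycle_sum ?b xs)"
    by (rule sum_list_mono) (rule best_groups_cost[OF Dne(1,2)])
  also have "\<dots> = (\<Sum>i<n. 8 * radius i) - (\<Sum>e\<leftarrow>M. ?b (fst e) (snd e))"
    unfolding sum_list_subtractf sumD D(3) ..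
  also have "(\<Sum>e\<leftarrow>M. ?b (fst e) (snd e)) = (\<Sum>e\<leftarrow>M. U ! fst e + V ! snd e)"
    using tight by (intro arg_cong[of _ _ sum_list] map_cong) auto
  also have "\<dots> = (\<Sum>r\<leftarrow>map fst M. U ! r) + (\<Sum>c\<leftarrow>map snd M. V ! c)"
    by (simp add: sum_list_addf o_def)
  \<comment> \<open>A perfect matching meets every row and every column once, so the sum no longer
    depends on the matching.\<close>
  also have "\<dots> = (\<Sum>i<n. U ! i) + (\<Sum>i<n. V ! i)"
  proof -
    have key: "(\<Sum>i\<leftarrow>xs. f i) = (\<Sum>i<n. f i)" if "distinct xs" "set xs \<subseteq> {..<n}" "length xs = n"
      for xs and f :: "nat \<Rightarrow> int"
    proof -
      have "set xs = {..<n}" using that by (intro card_subset_eq) (auto simp: distinct_card)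
      then show ?thesis using sum_list_distinct_conv_sum_set[OF that(1)] by simp
    qed
    moreover have "set (map fst M) \<subseteq> {..<n}" "set (map snd M) \<subseteq> {..<n}"
      using matching_bound[OF M(1)] by auto
    ultimately show ?thesis
      using M key[of "map fst M" "(!) U"] key[of "map snd M" "(!) V"] by (simp add: matching_def)
  qed
  finally have "4 * groups_cost w (solve_groups n d w) \<le> (\<Sum>i<n. 8 * radius i - (U ! i + V ! i))"
    by (simp add: sum_subtractf sum.distrib)
  then show "\<exists>U V. (\<forall>i<n. \<forall>j<n. ?b i j \<le> U i + V j) \<and>
      4 * groups_cost w (solve_groups n d w) \<le> (\<Sum>i<n. 8 * radius i - (U i + V i))"
    using dual by (intro exI[of _ "\<lambda>i. U ! i"] exI[of _ "\<lambda>i. V ! i"]) auto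
qed

end

section \<open>The algorithm on vehicle routing instances\<close>

text \<open>Any common multiple will do, and the length of the product is controlled by the lengths
  of the factors.\<close>

definition common_denominator :: "rat list list \<Rightarrow> int" where
  "common_denominator wm = prod_list (map (\<lambda>r. snd (quotient_of r)) (concat wm))"

definition scaled :: "rat list list \<Rightarrow> int list list" where
  "scaled wm = map (map (\<lambda>r. fst (quotient_of r) * (common_denominator wm div snd (quotient_of r)))) wm"

definition entry :: "int list list \<Rightarrow> nat \<Rightarrow> nat \<Rightarrow> int" where
  "entry W u v = nth_default 0 (nth_default [] W u) v"

definition vrp_groups :: "nat list \<times> int list list \<Rightarrow> nat list list" where
  "vrp_groups x = solve_groups (length (fst x)) (nth_default 0 (fst x)) (entry (snd x))"

definition vrp_solve :: "nat \<times> nat list \<times> rat list list \<Rightarrow> itinerary" where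
  "vrp_solve x = map (map (\<lambda>i. (Suc i, nth_default 0 (fst (snd x)) i)))
     (vrp_groups (fst (snd x), scaled (snd (snd x))))"

text \<open>The finite part of an instance that its encoding shows; the algorithm is a function of
  this part alone.\<close>

definition cvrp_data :: "cvrp \<Rightarrow> nat \<times> nat list \<times> rat list list" where
  "cvrp_data I = (customers I, map (demand I) [1..<customers I + 1],
     map (\<lambda>u. map (weight I u) [0..<customers I + 1]) [0..<customers I + 1])"

section \<open>Shortcuts in walks, and deliveries\<close>

lemma walk_weight_Cons: "walk_weight I (u # v # p) = weight I u v + walk_weight I (v # p)"
  by (simp add: walk_weight_def)

text \<open>The final depot gives the dropped vertex a successor even if \<open>p\<close> is empty,
  so the triangle inequality always applies.\<close>

lemma walk_weight_skip:
  assumes I: "cvrp_instance k I" and "u \<le> customers I" "x \<le> customers I" "set p \<subseteq> {..customers I}"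
  shows "walk_weight I (u # p @ [0]) \<le> walk_weight I (u # x # p @ [0])"
proof -
  obtain v q where "p @ [0] = v # q" "v \<le> customers I" using assms(4) by (cases p) auto
  moreover from this have "weight I u v \<le> weight I u x + weight I x v"
    using I assms(2,3) by (auto simp: cvrp_instance_def)
  ultimately show ?thesis by (simp add: walk_weight_Cons)
qed

text \<open>Serves to drop stops at which nothing is delivered, among them passages through the
  depot.\<close>

lemma walk_weight_filter:
  assumes I: "cvrp_instance k I" and "u \<le> customers I" "set p \<subseteq> {..customers I}"
  shows "walk_weight I (u # filter P p @ [0]) \<le> walk_weight I (u # p @ [0])"
  using assms(2,3)
proof (induction p arbitrary: u)
  case (Cons x p)
  then show ?case
  proof (cases "P x")
    case True
    then show ?thesis using Cons by (simp add: walk_weight_Cons)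
  next
    case False
    have "walk_weight I (u # filter P p @ [0]) \<le> walk_weight I (u # p @ [0])"
      using Cons by simp
    also have "\<dots> \<le> walk_weight I (u # x # p @ [0])"
      using Cons.prems by (intro walk_weight_skip[OF I]) auto
    finally show ?thesis using False by simp
  qed
qed simp

lemma walk_weight_remdups:
  assumes I: "cvrp_instance k I" and "u \<le> customers I" "set p \<subseteq> {..customers I}"
  shows "walk_weight I (u # remdups p @ [0]) \<le> walk_weight I (u # p @ [0])"
  using assms(2,3)
proof (induction p arbitrary: u)
  case (Cons x p)
  then show ?case
  proof (cases "x \<in> set p")
    case False
    then show ?thesis using Cons by (simp add: walk_weight_Cons)
  next
    case True
    have "walk_weight I (u # remdups p @ [0]) \<le> walk_weight I (u # p @ [0])"
      using Cons by simp
    also have "\<dots> \<le> walk_weight I (u # x # p @ [0])"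
      using Cons.prems by (intro walk_weight_skip[OF I]) auto
    finally show ?thesis using True by simp
  qed
qed simp

lemma delivered_visited: "0 < delivered T i \<Longrightarrow> i \<in> fst ` set T"
  by (induction T) (auto simp: delivered_def split: if_splits)

lemma delivered_concat: "(\<Sum>T\<leftarrow>S. delivered T i) = delivered (concat S) i"
  by (induction S) (auto simp: delivered_def)

lemma delivered_all:
  assumes "distinct g"
  shows "delivered (map (\<lambda>i. (Suc i, d i)) g) (Suc i) = (if i \<in> set g then d i else 0)"
  using assms by (induction g) (auto simp: delivered_def)

text \<open>One tour delivers the whole sum, and amounts are natural numbers, so nothing remains for
  the others. As \<open>m\<close> is positive, charging \<open>z\<close> to the tours that deliver
  something charges it exactly once.\<close>

lemma single_supplier:
  fixes g :: "'a \<Rightarrow> nat" and z :: int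
  assumes sum: "(\<Sum>T\<leftarrow>S. g T) = m" and ex: "\<exists>T\<in>set S. g T = m" and m: "0 < m"
  shows "\<And>T. T \<in> set S \<Longrightarrow> g T = 0 \<or> g T = m" and "(\<Sum>T\<leftarrow>S. if 0 < g T then z else 0) = z"
proof -
  obtain T0 A B where S: "S = A @ T0 # B" "g T0 = m" using ex by (metis split_list)
  then have "(\<Sum>T\<leftarrow>A @ B. g T) = 0" using sum by simp
  then have zero: "\<forall>T\<in>set A \<union> set B. g T = 0" by auto
  then show "\<And>T. T \<in> set S \<Longrightarrow> g T = 0 \<or> g T = m" using S by auto
  have "(\<Sum>T\<leftarrow>L. if 0 < g T then z else 0) = 0" if "\<forall>T\<in>set L. g T = 0" for L
    using that by (induction L) auto
  then show "(\<Sum>T\<leftarrow>S. if 0 < g T then z else 0) = z" using zero m S by simp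
qed

lemma sum_list_sum_swap:
  "(\<Sum>T\<leftarrow>S. \<Sum>i<n. h T i) = (\<Sum>i<n. \<Sum>T\<leftarrow>S. (h T i :: int))" for n :: nat
  by (induction S) (auto simp: sum.distrib)

lemma of_int_sum_list: "of_int (\<Sum>T\<leftarrow>S. h T) = (\<Sum>T\<leftarrow>S. of_int (h T))"
  by (induction S) auto

lemma dvd_prod_list_member: "x \<in> set xs \<Longrightarrow> x dvd (prod_list xs :: int)"
  by (induction xs) auto

section \<open>Scaling to integer weights, feasibility and the ratio\<close>

context
  fixes I :: cvrp
  assumes I: "cvrp_instance 3 I"
begin

definition num_customers :: nat where "num_customers = customers I"
definition denominator :: int where "denominator = common_denominator (snd (snd (cvrp_data I)))"
definition demand_of :: "nat \<Rightarrow> nat" where "demand_of = nth_default 0 (fst (snd (cvrp_data I)))"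
definition weight_of :: "nat \<Rightarrow> nat \<Rightarrow> int" where "weight_of = entry (scaled (snd (snd (cvrp_data I))))"

lemma demand_of: "i < num_customers \<Longrightarrow> demand_of i = demand I (Suc i)"
  by (simp add: demand_of_def num_customers_def cvrp_data_def nth_default_nth del: upt_Suc)

lemma denominator_pos: "0 < denominator"
proof -
  have "0 < prod_list xs" if "\<forall>x\<in>set xs. (0 :: int) < x" for xs
    using that by (induction xs) auto
  then show ?thesis
    unfolding denominator_def common_denominator_def by (auto simp: quotient_of_denom_pos')
qed

text \<open>Scaling is exact: every single denominator divides the product, so the integer division
  leaves no remainder.\<close>

lemma weight_of: "u \<le> num_customers \<Longrightarrow> v \<le> num_customers \<Longrightarrow> of_int (weight_of u v) = of_int denominator * weight I u v"
proof -
  assume uv: "u \<le> num_customers" "v \<le> num_customers"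
  let ?q = "quotient_of (weight I u v)" and ?wm = "snd (snd (cvrp_data I))"
  have e: "weight_of u v = fst ?q * (denominator div snd ?q)"
    using uv by (simp add: weight_of_def entry_def scaled_def cvrp_data_def num_customers_def nth_default_nth denominator_def
        del: upt_Suc)
  have "weight I u v \<in> set (concat ?wm)"
  proof -
    have "weight I u v \<in> set (map (weight I u) [0..<customers I + 1])"
      using uv by (auto simp: num_customers_def simp del: upt_Suc)
    moreover have "map (weight I u) [0..<customers I + 1] \<in> set ?wm"
      using uv by (auto simp: num_customers_def cvrp_data_def simp del: upt_Suc)
    ultimately show ?thesis unfolding set_concat by blast
  qed
  then have "snd ?q \<in> set (map (\<lambda>r. snd (quotient_of r)) (concat ?wm))" by (simp only: set_map) blast
  then have "snd ?q dvd denominator"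
    unfolding denominator_def common_denominator_def by (rule dvd_prod_list_member)
  then obtain c where c: "denominator = snd ?q * c" by (elim dvdE)
  have pos: "0 < snd ?q" by (rule quotient_of_denom_pos')
  have "weight I u v = of_int (fst ?q) / of_int (snd ?q)" by (rule quotient_of_div) simp
  then have "of_int denominator * weight I u v = of_int (snd ?q * c) * (of_int (fst ?q) / of_int (snd ?q))"
    by (simp add: c)
  also have "\<dots> = of_int (fst ?q * c)" using pos by simp
  also have "fst ?q * c = weight_of u v" using pos by (simp add: e c)
  finally show ?thesis by simp
qed

lemma weight_of_le_iff:
  assumes "of_int a = of_int denominator * (x :: rat)" and "of_int b = of_int denominator * y"
  shows "a \<le> b \<longleftrightarrow> x \<le> y"
  using denominator_pos assms by (metis mult_le_cancel_left_pos of_int_0_less_iff of_int_le_iff)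

interpretation routing num_customers demand_of weight_of
proof
  show "1 \<le> demand_of i" "demand_of i \<le> 3" if "i < num_customers" for i
    using I that by (auto simp: demand_of cvrp_instance_def num_customers_def)
  fix u v assume uv: "u \<le> num_customers" "v \<le> num_customers"
  have "0 \<le> weight I u v" "weight I u v = weight I v u" using I uv by (auto simp: cvrp_instance_def num_customers_def)
  then show "0 \<le> weight_of u v" "weight_of u v = weight_of v u"
    using weight_of[OF uv] weight_of[OF uv(2,1)] denominator_pos
    by (metis mult_nonneg_nonneg of_int_0_le_iff order_less_imp_le, metis of_int_eq_iff)
  fix x assume x: "x \<le> num_customers"
  have "weight I u x \<le> weight I u v + weight I v x" using I uv x by (auto simp: cvrp_instance_def num_customers_def)
  then show "weight_of u x \<le> weight_of u v + weight_of v x"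
    by (subst weight_of_le_iff[of _ "weight I u x" _ "weight I u v + weight I v x"])
      (simp_all add: weight_of uv x algebra_simps)
next
  fix u assume u: "u \<le> num_customers"
  then have "weight I u u = 0" using I by (auto simp: cvrp_instance_def num_customers_def)
  then show "weight_of u u = 0" using weight_of[OF u u] by simp
qed

lemma route_walk:
  "u \<le> num_customers \<Longrightarrow> set g \<subseteq> {..<num_customers} \<Longrightarrow> of_int (route weight_of u g) = of_int denominator * walk_weight I (u # map Suc g @ [0])"
proof (induction g arbitrary: u)
  case Nil
  then show ?case by (simp add: weight_of walk_weight_def)
next
  case (Cons i g)
  then show ?case by (simp add: weight_of walk_weight_Cons algebra_simps)
qed

lemma vrp_solve_eq: "vrp_solve (cvrp_data I) = map (map (\<lambda>i. (Suc i, demand_of i))) (solve_groups num_customers demand_of weight_of)"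
  by (simp add: vrp_solve_def vrp_groups_def demand_of_def weight_of_def num_customers_def cvrp_data_def del: upt_Suc)

lemma vrp_solve_feasible:
  "feasible 3 I (vrp_solve (cvrp_data I))" "unsplittable I (vrp_solve (cvrp_data I))"
proof -
  let ?gs = "solve_groups num_customers demand_of weight_of" and ?T = "map (\<lambda>i. (Suc i, demand_of i))"
  note gs = solve_groups(2-4)
  have g: "distinct g" "set g \<subseteq> {..<num_customers}" if "g \<in> set ?gs" for g
    using that gs(1,2) by (auto simp: distinct_concat_iff)
  have tour: "is_tour 3 I (?T g)" if "g \<in> set ?gs" for g
    unfolding is_tour_def
  proof (intro conjI ballI)
    show "v \<le> customers I" if "v \<in> set (tour_walk (?T g))" for v
      using that g(2)[OF \<open>g \<in> _\<close>] by (auto simp: tour_walk_def num_customers_def)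
    show "delivered (?T g) 0 = 0" by (induction g) (auto simp: delivered_def)
    have "(\<Sum>i=1..customers I. delivered (?T g) i) = (\<Sum>i<num_customers. delivered (?T g) (Suc i))"
      by (simp add: num_customers_def sum.atLeast1_atMost_eq)
    also have "\<dots> = (\<Sum>i<num_customers. if i \<in> set g then demand_of i else 0)"
      by (simp add: delivered_all[OF g(1)[OF that]])
    also have "\<dots> = sum demand_of (set g)"
      using g(2)[OF that] by (simp add: sum.If_cases Int_absorb1)
    also have "\<dots> = sum_list (map demand_of g)"
      using g(1)[OF that] by (simp add: sum_list_distinct_conv_sum_set)
    also have "\<dots> \<le> 3" by (rule gs(3)[OF that])
    finally show "(\<Sum>i=1..customers I. delivered (?T g) i) \<le> 3" .
  qed
  have cust: "\<exists>i<num_customers. v = Suc i" if "v \<in> {1..customers I}" for v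
    using that by (cases v) (auto simp: num_customers_def)
  have "(\<Sum>T\<leftarrow>map ?T ?gs. delivered T (Suc i)) = demand I (Suc i)" if "i < num_customers" for i
  proof -
    \<comment> \<open>The groups concatenate to one list without repetition, so the deliveries of
      all tours are those of a single long one.\<close>
    have "(\<Sum>T\<leftarrow>map ?T ?gs. delivered T (Suc i)) = delivered (?T (concat ?gs)) (Suc i)"
      unfolding delivered_concat map_concat ..
    then show ?thesis using that gs(2) demand_of[OF that] by (simp only: delivered_all[OF gs(1)]) simp
  qed
  then have "(\<Sum>T\<leftarrow>map ?T ?gs. delivered T v) = demand I v" if "v \<in> {1..customers I}" for v
    using cust[OF that] by blast
  then show "feasible 3 I (vrp_solve (cvrp_data I))"
    unfolding vrp_solve_eq feasible_def using tour by (auto simp del: map_map)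
  have "\<exists>g\<in>set ?gs. delivered (?T g) (Suc i) = demand I (Suc i)" if "i < num_customers" for i
  proof -
    have "i \<in> (\<Union>g\<in>set ?gs. set g)" using gs(2) that by simp
    then obtain g where "g \<in> set ?gs" "i \<in> set g" by blast
    then show ?thesis using delivered_all[OF g(1)] demand_of[OF that] by force
  qed
  then show "unsplittable I (vrp_solve (cvrp_data I))"
    unfolding vrp_solve_eq unsplittable_def using cust by fastforce
qed

text \<open>Repeated stops and stops without delivery are cut out without raising the weight. By
  \<open>all\<close> the remaining customers receive their full demands, so these add up to at most
  3 and \<open>tour_bound\<close> applies.\<close>

lemma tour_lower_bound:
  assumes dual: "\<And>i j. i < num_customers \<Longrightarrow> j < num_customers \<Longrightarrow> benefit demand_of weight_of i j \<le> U i + V j"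
    and T: "is_tour 3 I T" and all: "\<And>i. i < num_customers \<Longrightarrow> delivered T (Suc i) = 0 \<or> delivered T (Suc i) = demand_of i"
  shows "of_int (\<Sum>i<num_customers. if 0 < delivered T (Suc i) then 8 * radius i - (U i + V i) else 0)
    \<le> 6 * of_int denominator * walk_weight I (tour_walk T)"
proof -
  define p where "p = filter (\<lambda>v. 0 < delivered T v) (remdups (map fst T))"
  define g where "g = map (\<lambda>v. v - 1) p"
  have sub: "set (map fst T) \<subseteq> {..customers I}" using T by (auto simp: is_tour_def tour_walk_def)
  have p: "distinct p" "set p = {v. 0 < delivered T v}"
    using delivered_visited[of T] by (auto simp: p_def)
  \<comment> \<open>The depot is not in \<open>p\<close>, as a tour delivers nothing there.\<close>
  have pos: "0 < v" "v \<le> num_customers" if "v \<in> set p" for v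
    using that p(2) T sub delivered_visited[of T v] by (auto simp: is_tour_def num_customers_def intro!: gr0I)
  have Sg: "map Suc g = p" unfolding g_def using pos by (auto intro!: map_idI)
  have g: "set g \<subseteq> {..<num_customers}" unfolding g_def using pos by (auto simp: less_eq_Suc_le)
  have dg: "distinct g" using p(1) Sg by (metis distinct_map)
  have ig: "i \<in> set g \<longleftrightarrow> 0 < delivered T (Suc i)" for i
  proof -
    have "i \<in> set g \<longleftrightarrow> Suc i \<in> set (map Suc g)" by auto
    then show ?thesis unfolding Sg p(2) by simp
  qed
  have "sum_list (map demand_of g) = (\<Sum>i\<in>set g. delivered T (Suc i))"
    using dg g all ig by (subst sum_list_distinct_conv_sum_set) (force intro!: sum.cong)+
  also have "\<dots> \<le> (\<Sum>i<num_customers. delivered T (Suc i))" using g by (intro sum_mono2) auto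
  also have "\<dots> = (\<Sum>i=1..customers I. delivered T i)" by (simp add: num_customers_def sum.atLeast1_atMost_eq)
  also have "\<dots> \<le> 3" using T by (simp add: is_tour_def)
  finally have "(\<Sum>i\<leftarrow>g. 8 * radius i - (U i + V i)) \<le> 6 * route weight_of 0 g"
    by (intro tour_bound[OF dual dg g])
  also have "(\<Sum>i\<leftarrow>g. 8 * radius i - (U i + V i)) =
    (\<Sum>i<num_customers. if 0 < delivered T (Suc i) then 8 * radius i - (U i + V i) else 0)"
  proof -
    have "(\<Sum>i\<leftarrow>g. f i) = (\<Sum>i<num_customers. if i \<in> set g then f i else 0)" for f :: "nat \<Rightarrow> int"
      using dg g by (simp add: sum_list_distinct_conv_sum_set sum.If_cases Int_absorb1)
    then show ?thesis unfolding ig .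
  qed
  finally have "of_int (\<Sum>i<num_customers. if 0 < delivered T (Suc i) then 8 * radius i - (U i + V i) else 0)
    \<le> (of_int (6 * route weight_of 0 g) :: rat)" by (simp only: of_int_le_iff)
  also have "\<dots> = 6 * of_int denominator * walk_weight I (0 # p @ [0])"
    using route_walk[of 0 g] g Sg by simp
  also have "walk_weight I (0 # p @ [0]) \<le> walk_weight I (tour_walk T)"
    unfolding p_def tour_walk_def
    using walk_weight_filter[OF I, of 0 "remdups (map fst T)"] walk_weight_remdups[OF I, of 0 "map fst T"] sub
    by (auto intro: order_trans)
  finally show ?thesis using denominator_pos by (simp add: mult_left_mono)
qed

lemma vrp_solve_cost:
  assumes S: "feasible 3 I S" "unsplittable I S"
  shows "itinerary_cost I (vrp_solve (cvrp_data I)) \<le> 3 / 2 * itinerary_cost I S"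
proof -
  obtain U V where dual: "\<And>i j. i < num_customers \<Longrightarrow> j < num_customers \<Longrightarrow> benefit demand_of weight_of i j \<le> U i + V j"
    and cost: "4 * groups_cost weight_of (solve_groups num_customers demand_of weight_of) \<le> (\<Sum>i<num_customers. 8 * radius i - (U i + V i))"
    using solve_groups(1) by blast
  let ?f = "\<lambda>i. 8 * radius i - (U i + V i)"
  let ?W = "\<lambda>S. \<Sum>T\<leftarrow>S. walk_weight I (tour_walk T)"
  have supplied: "(\<Sum>T\<leftarrow>S. delivered T (Suc i)) = demand_of i" "\<exists>T\<in>set S. delivered T (Suc i) = demand_of i" "0 < demand_of i"
    if "i < num_customers" for i
    using that S demand_of[OF that] demand(1)[OF that] by (auto simp: feasible_def unsplittable_def num_customers_def)
  note one = single_supplier[OF supplied]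
  \<comment> \<open>Every customer has exactly one supplier, so its share is charged to exactly one
    tour, whatever the sign of the share.\<close>
  have "(\<Sum>i<num_customers. ?f i) = (\<Sum>i<num_customers. \<Sum>T\<leftarrow>S. if 0 < delivered T (Suc i) then ?f i else 0)"
    using one(2) by (intro sum.cong) auto
  also have "\<dots> = (\<Sum>T\<leftarrow>S. \<Sum>i<num_customers. if 0 < delivered T (Suc i) then ?f i else 0)"
    by (rule sum_list_sum_swap[symmetric])
  finally have "of_int (\<Sum>i<num_customers. ?f i) =
    (\<Sum>T\<leftarrow>S. (of_int (\<Sum>i<num_customers. if 0 < delivered T (Suc i) then ?f i else 0) :: rat))"
    by (simp add: of_int_sum_list o_def)
  also have "\<dots> \<le> (\<Sum>T\<leftarrow>S. 6 * of_int denominator * walk_weight I (tour_walk T))"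
    using S(1) one(1) by (intro sum_list_mono tour_lower_bound dual) (auto simp: feasible_def)
  also have "\<dots> = 6 * of_int denominator * ?W S" by (simp add: sum_list_const_mult)
  finally have upper: "of_int (\<Sum>i<num_customers. ?f i) \<le> 6 * of_int denominator * ?W S" .
  have "of_int (groups_cost weight_of gs) = of_int denominator * ?W (map (map (\<lambda>i. (Suc i, demand_of i))) gs)"
    if "\<forall>g\<in>set gs. set g \<subseteq> {..<num_customers}" for gs
    using that
  proof (induction gs)
    case (Cons g gs)
    have "tour_walk (map (\<lambda>i. (Suc i, demand_of i)) g) = 0 # map Suc g @ [0]"
      by (simp add: tour_walk_def o_def)
    then show ?case using Cons route_walk[of 0 g] by (simp add: groups_cost_def algebra_simps)
  qed (simp add: groups_cost_def)
  moreover have "\<forall>g\<in>set (solve_groups num_customers demand_of weight_of). set g \<subseteq> {..<num_customers}"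
    using solve_groups(3) by auto
  ultimately have "of_int (groups_cost weight_of (solve_groups num_customers demand_of weight_of)) = of_int denominator * ?W (vrp_solve (cvrp_data I))"
    unfolding vrp_solve_eq by blast
  then have "4 * (of_int denominator * ?W (vrp_solve (cvrp_data I))) = of_int (4 * groups_cost weight_of (solve_groups num_customers demand_of weight_of))"
    by simp
  also have "\<dots> \<le> (of_int (\<Sum>i<num_customers. ?f i) :: rat)" using cost by (simp only: of_int_le_iff)
  also note upper
  finally have "of_int denominator * (4 * ?W (vrp_solve (cvrp_data I))) \<le> of_int denominator * (6 * ?W S)"
    by (simp add: algebra_simps)
  then have "4 * ?W (vrp_solve (cvrp_data I)) \<le> 6 * ?W S"
    using denominator_pos by (simp add: mult_le_cancel_left_pos)
  then have "?W (vrp_solve (cvrp_data I)) \<le> 3 / 2 * ?W S" by simp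
  then have "real_of_rat (?W (vrp_solve (cvrp_data I))) \<le> real_of_rat (3 / 2 * ?W S)"
    by (simp only: of_rat_less_eq)
  then show ?thesis by (simp add: itinerary_cost_def of_rat_mult of_rat_divide)
qed

end

section \<open>The algorithm runs in polynomial time\<close>

lemma ptime_comp4:
  "ptime UNIV (\<lambda>p. g (fst p) (fst (snd p)) (fst (snd (snd p))) (snd (snd (snd p)))) \<Longrightarrow>
    ptime A f \<Longrightarrow> ptime A h \<Longrightarrow> ptime A k \<Longrightarrow> ptime A l \<Longrightarrow> ptime A (\<lambda>x. g (f x) (h x) (k x) (l x))"
  using ptime_comp3[of "\<lambda>a b c. g a b (fst c) (snd c)" A f h "\<lambda>x. (k x, l x)"] ptime_pair[of A k l]
  by simp

lemma ptime_comp5: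
  "ptime UNIV (\<lambda>p. g (fst p) (fst (snd p)) (fst (snd (snd p))) (fst (snd (snd (snd p))))
      (snd (snd (snd (snd p))))) \<Longrightarrow>
    ptime A f \<Longrightarrow> ptime A h \<Longrightarrow> ptime A k \<Longrightarrow> ptime A l \<Longrightarrow> ptime A m \<Longrightarrow>
    ptime A (\<lambda>x. g (f x) (h x) (k x) (l x) (m x))"
  using ptime_comp4[of "\<lambda>a b c d. g a b c (fst d) (snd d)" A f h k "\<lambda>x. (l x, m x)"]
    ptime_pair[of A l m]
  by simp

lemma ptime_sum_list_nat:
  assumes "ptime A xs"
  shows "ptime A (\<lambda>x. sum_list (xs x) :: nat)"
proof -
  have "ptime A (\<lambda>x. sum_list (map int (xs x)))"
    by (intro ptime_base assms)
  moreover have "sum_list (map int ys) = int (sum_list ys)" for ys by (induction ys) auto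
  ultimately show ?thesis unfolding ptime_def by simp
qed

lemma ptime_upt_Suc_length: "ptime A xs \<Longrightarrow> ptime A (\<lambda>x. [0..<Suc (length (xs x))])"
  using ptime_upt_length[OF ptime_Cons[OF ptime_const[of A 0] ptime_upt_length[of A xs]]]
  by (simp del: upt_Suc)

text \<open>The running minimum is always a member of the list, hence no larger than the
  list.\<close>

lemma ptime_min_by:
  assumes f: "ptime {p. fst p \<in> A \<and> snd p \<in> set (xs (fst p))} (\<lambda>p. f (fst p) (snd p))"
    and xs: "ptime A xs" and ne: "\<And>x. x \<in> A \<Longrightarrow> xs x \<noteq> []"
  shows "ptime A (\<lambda>x. min_by (f x) (xs x))"
proof -
  let ?g = "\<lambda>x e m. if f x e < f x m then e else m"
  obtain r where r: "\<And>x. x \<in> A \<Longrightarrow> sz (xs x) \<le> poly r (sz x)"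
    using ptime_size[OF xs] by blast
  have mem: "fold (?g x) ys (hd (xs x)) \<in> set (xs x)" if "x \<in> A" "xs x = ys @ zs" for x ys zs
  proof -
    have "fold (?g x) ys m \<in> insert m (set ys)" for m by (induction ys arbitrary: m) auto
    moreover have "insert (hd (xs x)) (set ys) \<subseteq> set (xs x)"
      using hd_in_set[OF ne[OF that(1)]] that(2) by (simp del: hd_in_set)
    ultimately show ?thesis by (rule subsetD[rotated])
  qed
  have "ptime A (\<lambda>x. fold (?g x) (xs x) (hd (xs x)))"
  proof (rule ptime_fold[where q = r])
    show "ptime A (\<lambda>x. hd (xs x))" by (rule ptime_hd[OF xs ne])
    show "ptime {(x, e, acc). x \<in> A \<and> (\<exists>ys zs. xs x = ys @ e # zs \<and> acc = fold (?g x) ys (hd (xs x)))}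
      (\<lambda>p. if f (fst p) (fst (snd p)) < f (fst p) (snd (snd p)) then fst (snd p) else snd (snd p))"
      (is "ptime ?B _")
    proof (intro ptime_if ptime_less_int ptime_base)
      have "ptime ?B (\<lambda>p. (fst p, fst (snd p)))" "ptime ?B (\<lambda>p. (fst p, snd (snd p)))"
        by (intro ptime_base)+
      from ptime_comp[OF this(1) f] ptime_comp[OF this(2) f] mem
      show "ptime ?B (\<lambda>p. f (fst p) (fst (snd p)))" "ptime ?B (\<lambda>p. f (fst p) (snd (snd p)))"
        by (fastforce)+
    qed
    show "sz (fold (?g x) ys (hd (xs x))) \<le> poly r (sz x)" if "x \<in> A" "xs x = ys @ zs" for x ys zs
      using sz_le_sz_list[OF mem[OF that]] r[OF that(1)] by linarith
  qed (rule xs)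
  then show ?thesis by (simp add: min_by_def)
qed

lemma sz_nth_default: "sz (nth_default d xs i) \<le> sz d + sz xs"
  using sz_le_sz_list[of "xs ! i" xs] by (auto simp: nth_default_def)

lemma ptime_entry:
  "ptime A W \<Longrightarrow> ptime A u \<Longrightarrow> ptime A v \<Longrightarrow> ptime A (\<lambda>x. entry (W x) (u x) (v x))"
  unfolding entry_def by (intro ptime_base)

text \<open>Functions have no encoding, so demands and weights enter as the tables from which they
  are read. The same form is used for all functions below that depend on them.\<close>

lemma ptime_benefit:
  assumes "ptime A dl" "ptime A W" "ptime A i" "ptime A j"
  shows "ptime A (\<lambda>x. benefit (nth_default 0 (dl x)) (entry (W x)) (i x) (j x))"
proof (rule ptime_comp4[of "\<lambda>dl W i j. benefit (nth_default 0 dl) (entry W) i j", OF _ assms])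
  show "ptime UNIV (\<lambda>p. benefit (nth_default 0 (fst p)) (entry (fst (snd p)))
      (fst (snd (snd p))) (snd (snd (snd p))))"
    unfolding benefit_def saving_def by (intro ptime_base ptime_entry)
qed

lemma ptime_tree_cols: "ptime A t \<Longrightarrow> ptime A (\<lambda>x. tree_cols (t x))"
  by (rule ptime_comp1) (unfold tree_cols_def, intro ptime_base)

lemma ptime_slacks:
  assumes "ptime A dl" "ptime A W" "ptime A U" "ptime A V" "ptime A t"
  shows "ptime A (\<lambda>x. slacks (length (dl x)) (benefit (nth_default 0 (dl x)) (entry (W x))) (U x) (V x) (t x))"
proof (rule ptime_comp5[of "\<lambda>dl W U V t. slacks (length dl) (benefit (nth_default 0 dl) (entry W)) U V t",
      OF _ assms])
  show "ptime UNIV (\<lambda>p. slacks (length (fst p)) (benefit (nth_default 0 (fst p)) (entry (fst (snd p))))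
    (fst (snd (snd p))) (fst (snd (snd (snd p)))) (snd (snd (snd (snd p)))))"
    unfolding slacks_def by (intro ptime_base ptime_benefit ptime_tree_cols)
qed

lemma ptime_hungarian_grow:
  assumes "ptime A dl" "ptime A s" "ptime A m"
  shows "ptime A (\<lambda>x. hungarian_grow (length (dl x)) (s x) (m x))"
proof (rule ptime_comp3[of "\<lambda>dl s m. hungarian_grow (length dl) s m", OF _ assms])
  show "ptime UNIV (\<lambda>p. hungarian_grow (length (fst p :: 'b list)) (fst (snd p)) (snd (snd p)))"
    unfolding hungarian_grow_def
    by (intro ptime_base ptime_tree_cols ptime_hd) (auto simp: list_ex_iff filter_empty_conv)
qed

lemma ptime_hungarian_step:
  assumes "ptime A dl" "ptime A W" "ptime A s"
  shows "ptime A (\<lambda>x. hungarian_step (length (dl x)) (benefit (nth_default 0 (dl x)) (entry (W x))) (s x))"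
proof (rule ptime_comp3[of "\<lambda>dl W s. hungarian_step (length dl) (benefit (nth_default 0 dl) (entry W)) s",
      OF _ assms])
  show "ptime UNIV (\<lambda>p. hungarian_step (length (fst p))
    (benefit (nth_default 0 (fst p)) (entry (fst (snd p)))) (snd (snd p)))"
    unfolding hungarian_step_def
    by (intro ptime_base ptime_hungarian_grow ptime_slacks ptime_min_by ptime_hd) auto
qed

lemma ptime_hungarian_init:
  assumes "ptime A dl" "ptime A W"
  shows "ptime A (\<lambda>x. hungarian_init (length (dl x)) (benefit (nth_default 0 (dl x)) (entry (W x))))"
proof (rule ptime_comp2[of "\<lambda>dl W. hungarian_init (length dl) (benefit (nth_default 0 dl) (entry W))",
      OF _ assms])
  show "ptime UNIV (\<lambda>p. hungarian_init (length (fst p)) (benefit (nth_default 0 (fst p)) (entry (snd p))))"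
    unfolding hungarian_init_def by (intro ptime_base ptime_benefit)
qed

lemma sz_nat_less: "i < n \<Longrightarrow> sz (i :: nat) \<le> n"
  using floorlog2_le_self[of i] by simp

lemma sz_int_mono: "0 \<le> a \<Longrightarrow> a \<le> b \<Longrightarrow> sz (a :: int) \<le> sz b"
  by (simp add: floorlog_mono nat_mono)

lemma sz_list_bound:
  assumes "\<And>e. e \<in> set xs \<Longrightarrow> sz e \<le> k" and "length xs \<le> m"
  shows "sz xs \<le> 1 + m * (k + 1)"
  using sz_list_le[of xs k, OF assms(1)] mult_le_mono1[OF assms(2), of "k + 1"] by linarith

text \<open>The summands account for three pair nodes, two lists of potentials, the matching, and a
  tree of at most \<open>N\<close> rows with paths of at most \<open>N\<close> edges, where
  \<open>N\<close> bounds both \<open>n\<close> and the length of \<open>B\<close>.\<close>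

definition state_size :: "nat poly" where
  "state_size = 3 + 2 * (1 + [:0, 1:] * [:1, 1:]) + (1 + [:0, 1:] * [:2, 2:]) +
    (1 + [:0, 1:] * ([:2, 1:] + (1 + [:0, 1:] * [:2, 2:])))"

text \<open>The invariant limits every list to \<open>n\<close> entries, every index to less than
  \<open>n\<close> and every potential to the range from 0 to \<open>B\<close>.\<close>

lemma hungarian_inv_sz:
  assumes inv: "hungarian_inv n b B s" and N: "n \<le> N" "sz B \<le> N"
  shows "sz s \<le> poly state_size N"
proof -
  obtain U V M t where s: "s = (U, V, M, t)" by (cases s)
  have dual: "dual_feasible n b B U V" and M: "matching n M"
    and tr: "t \<noteq> [] \<Longrightarrow> \<exists>rt. alternating_tree n M rt t"
    using inv unfolding hungarian_inv_def s by simp_all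
  have idx: "sz i \<le> N" if "i < n" for i
    using sz_nat_less[OF that] N(1) by linarith
  have edge: "sz e \<le> 2 * N + 1" if "fst e < n" "snd e < n" for e :: "nat \<times> nat"
    using idx[OF that(1)] idx[OF that(2)] by (cases e) simp
  have pot: "sz xs \<le> 1 + N * (N + 1)"
    if "length xs = n" "\<And>i. i < n \<Longrightarrow> 0 \<le> xs ! i \<and> xs ! i \<le> B" for xs
  proof (rule sz_list_bound)
    fix a assume "a \<in> set xs"
    then have "0 \<le> a \<and> a \<le> B" using that by (auto simp: in_set_conv_nth)
    then show "sz a \<le> N" using sz_int_mono[of a B] N(2) by linarith
  qed (use that N in simp)
  have "sz U \<le> 1 + N * (N + 1)" "sz V \<le> 1 + N * (N + 1)"
    by (rule pot; use dual in \<open>simp add: dual_feasible_def\<close>)+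
  moreover have "sz M \<le> 1 + N * (2 * N + 1 + 1)"
  proof (rule sz_list_bound)
    fix e assume "e \<in> set M"
    then show "sz e \<le> 2 * N + 1" using matching_bound[OF M, of "fst e" "snd e"] by (intro edge) auto
  qed (use matching_length[OF M] N in linarith)
  moreover have "sz t \<le> 1 + N * (1 + N + (1 + N * (2 * N + 1 + 1)) + 1)"
  proof (cases "t = []")
    case True
    then show ?thesis by (simp add: floorlog_def)
  next
    case False
    then obtain rt where t: "alternating_tree n M rt t" using tr by blast
    show ?thesis
    proof (rule sz_list_bound)
      fix e assume e: "e \<in> set t"
      obtain r p where rp: "e = (r, p)" by (cases e)
      then have p: "(r, p) \<in> set t" using e by simp
      have "sz p \<le> 1 + N * (2 * N + 1 + 1)"
      proof (rule sz_list_bound)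
        fix e' assume e': "e' \<in> set p"
        have "fst e' < n" using tree_path_row[OF t p, of "fst e'"] tree_row[OF t] e' by blast
        moreover have "snd e' < n"
          using tree_path_col[OF t p, of "snd e'"] matching_bound[OF M] e' by blast
        ultimately show "sz e' \<le> 2 * N + 1" by (rule edge)
      qed (use tree_path_length[OF t p] N in linarith)
      moreover have "sz r \<le> N" by (rule idx[OF tree_row[OF t p]])
      ultimately show "sz e \<le> 1 + N + (1 + N * (2 * N + 1 + 1))" by (simp add: rp)
    qed (use alternating_tree_length[OF t] N in linarith)
  qed
  ultimately have "sz s \<le> 3 + 2 * (1 + N * (N + 1)) + (1 + N * (2 * N + 1 + 1)) +
    (1 + N * (1 + N + (1 + N * (2 * N + 1 + 1)) + 1))"
    by (simp add: s)
  also have "\<dots> = poly state_size N"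
    by (simp add: state_size_def algebra_simps)
  finally show ?thesis .
qed

lemma ptime_hungarian:
  assumes "ptime A dl" "ptime A W"
  shows "ptime A (\<lambda>x. hungarian (length (dl x)) (benefit (nth_default 0 (dl x)) (entry (W x))))"
proof (rule ptime_comp2[of "\<lambda>dl W. hungarian (length dl) (benefit (nth_default 0 dl) (entry W))",
      OF _ assms])
  let ?b = "\<lambda>p. benefit (nth_default 0 (fst p)) (entry (snd p))"
  let ?B = "\<lambda>p. sum_list (fst (hungarian_init (length (fst p)) (?b p)))"
  \<comment> \<open>The bound on all potentials is itself computable in polynomial time, so its
    length is polynomial in the input.\<close>
  have "ptime UNIV ?B" by (intro ptime_base ptime_hungarian_init)
  then obtain r where r: "\<And>p. sz (?B p) \<le> poly r (sz p)" using ptime_size by blast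
  show "ptime UNIV (\<lambda>p. hungarian (length (fst p)) (?b p))"
    unfolding hungarian_def
  proof (rule ptime_fold[where q = "pcompose state_size (r + [:0, 1:])"])
    show "ptime UNIV (\<lambda>p. hungarian_init (length (fst p)) (?b p))"
      by (intro ptime_base ptime_hungarian_init)
    show "ptime UNIV (\<lambda>p :: nat list \<times> int list list.
        concat (map (\<lambda>_. [0..<Suc (length (fst p))]) [0..<Suc (length (fst p))]))"
      by (intro ptime_base ptime_upt_Suc_length)
    fix p :: "nat list \<times> int list list" and ys zs :: "nat list"
    have "sz (fold (\<lambda>_. hungarian_step (length (fst p)) (?b p)) ys (hungarian_init (length (fst p)) (?b p)))
      \<le> poly state_size (poly r (sz p) + sz p)"
      unfolding fold_const
    proof (rule hungarian_inv_sz[OF hungarian_iterate(1)])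
      show "length (fst p) \<le> poly r (sz p) + sz p"
        using length_le_sz[of "fst p"] by (cases p) simp
      show "sz (?B p) \<le> poly r (sz p) + sz p" using r[of p] by linarith
    qed (rule benefit_nonneg)
    then show "sz (fold (\<lambda>_. hungarian_step (length (fst p)) (?b p)) ys
        (hungarian_init (length (fst p)) (?b p))) \<le> poly (pcompose state_size (r + [:0, 1:])) (sz p)"
      by (simp add: poly_pcompose)
  qed (intro ptime_base ptime_hungarian_step)
qed

section \<open>Running time of the cycle decomposition\<close>

lemma ptime_join_step:
  assumes "ptime A e" "ptime A s"
  shows "ptime A (\<lambda>x. join_step (e x) (s x))"
proof (rule ptime_comp2[of join_step, OF _ assms])
  show "ptime UNIV (\<lambda>p. join_step (fst p) (snd p))"
    unfolding join_step_def Let_def by (intro ptime_base)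
qed

text \<open>Heads of disjoint nonempty lists are distinct elements below \<open>n\<close>, so there
  are at most \<open>n\<close> lists.\<close>

lemma disjoint_lists_length:
  assumes L: "disjoint_lists L" and sub: "\<Union>(set ` set L) \<subseteq> {..<n}"
  shows "length L \<le> n" and "p \<in> set L \<Longrightarrow> length p \<le> n"
proof -
  have hd: "hd p \<in> set p" if "p \<in> set L" for p
    using that L unfolding disjoint_lists_def by (metis hd_in_set)
  have "inj_on hd (set L)"
    using L hd unfolding disjoint_lists_def inj_on_def by metis
  then have "card (hd ` set L) = length L"
    using L unfolding disjoint_lists_def by (metis card_image distinct_card)
  moreover have "hd ` set L \<subseteq> {..<n}" using hd sub by blast
  ultimately show "length L \<le> n" by (metis card_lessThan card_mono finite_lessThan)
  assume p: "p \<in> set L"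
  then have "distinct p" "set p \<subseteq> {..<n}" using L sub unfolding disjoint_lists_def by blast+
  then show "length p \<le> n" by (metis card_lessThan card_mono distinct_card finite_lessThan)
qed

text \<open>The promise of a matching makes the lists disjoint in all intermediate states, and
  disjointness bounds their size.\<close>

lemma ptime_cycles_of:
  assumes dl: "ptime A dl" and M: "ptime A M"
    and matching: "\<And>x. x \<in> A \<Longrightarrow> matching (length (dl x)) (M x)"
  shows "ptime A (\<lambda>x. cycles_of (length (dl x)) (M x))"
proof -
  obtain r where r: "\<And>x. x \<in> A \<Longrightarrow> sz (dl x) \<le> poly r (sz x)" using ptime_size[OF dl] by blast
  have "ptime A (\<lambda>x. fold join_step (M x) (map (\<lambda>i. [i]) [0..<length (dl x)], []))"
  proof (rule ptime_fold[OF _ M, where q = "1 + 2 * (1 + r * (1 + r * (r + 1) + 1))"])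
    show "ptime A (\<lambda>x. (map (\<lambda>i. [i]) [0..<length (dl x)], []))" by (intro ptime_base dl)
    fix x ys zs assume x: "x \<in> A" "M x = ys @ zs"
    let ?n = "length (dl x)" and ?N = "poly r (sz x)"
    obtain P D where PD: "fold join_step ys (map (\<lambda>i. [i]) [0..<?n], []) = (P, D)"
      by (metis prod.collapse)
    \<comment> \<open>The zero weight is a dummy: only disjointness and the range of the entries are
      read off.\<close>
    have "join_inv ?n (\<lambda>_ _. 0) ys (P, D)"
      using join_fold_inv[of ?n ys zs "\<lambda>_ _. 0"] matching[OF x(1)] x(2) PD by simp
    then have L: "disjoint_lists (P @ D)" "\<Union>(set ` set (P @ D)) \<subseteq> {..<?n}"
      by (simp_all add: join_inv_def)
    have N: "?n \<le> ?N" using length_le_sz[of "dl x"] r[OF x(1)] by linarith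
    have p: "sz p \<le> 1 + ?N * (?N + 1)" if "p \<in> set (P @ D)" for p
    proof (rule sz_list_bound)
      fix i assume "i \<in> set p"
      then have "i < ?n" using that L(2) by blast
      then show "sz i \<le> ?N" using sz_nat_less[of i ?n] N by linarith
    qed (use disjoint_lists_length(2)[OF L that] N in linarith)
    have "length P \<le> ?N" "length D \<le> ?N" using disjoint_lists_length(1)[OF L] N by simp_all
    moreover have "sz p \<le> 1 + ?N * (?N + 1)" if "p \<in> set P \<or> p \<in> set D" for p
      using p[of p] that by auto
    ultimately have "sz P \<le> 1 + ?N * (1 + ?N * (?N + 1) + 1)" "sz D \<le> 1 + ?N * (1 + ?N * (?N + 1) + 1)"
      by (meson sz_list_bound)+
    then show "sz (fold join_step ys (map (\<lambda>i. [i]) [0..<?n], []))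
      \<le> poly (1 + 2 * (1 + r * (1 + r * (r + 1) + 1))) (sz x)"
      unfolding PD by simp
  qed (intro ptime_base ptime_join_step)
  then show ?thesis unfolding cycles_of_def by (rule ptime_snd)
qed

text \<open>The recursion of \<open>route\<close> becomes a loop: the accumulator holds the current
  vertex and the weight so far, and the return to the depot is added at the end.\<close>

lemma route_fold:
  "route w u g + c = (let s = fold (\<lambda>i s. (Suc i, snd s + w (fst s) (Suc i))) g (u, c)
    in snd s + w (fst s) 0)"
proof (induction g arbitrary: u c)
  case (Cons i g)
  from Cons[of "Suc i" "c + w u (Suc i)"] show ?case by (simp add: Let_def algebra_simps)
qed simp

lemma sz_add_int: "sz (a + b :: int) \<le> sz a + sz b"
proof -
  have "floorlog 2 (nat \<bar>a + b\<bar>) \<le> floorlog 2 (nat \<bar>a\<bar> + nat \<bar>b\<bar>)"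
    by (rule floorlog_mono) linarith
  then show ?thesis using floorlog2_add[of "nat \<bar>a\<bar>" "nat \<bar>b\<bar>"] by simp
qed

lemma sz_Suc: "sz (Suc i) \<le> sz i + 2"
  using floorlog2_add[of i 1] by (simp add: floorlog_def nat_add_distrib)

lemma ptime_route:
  assumes "ptime A W" "ptime A g"
  shows "ptime A (\<lambda>x. route (entry (W x)) 0 (g x))"
proof (rule ptime_comp2[of "\<lambda>W g. route (entry W) 0 g", OF _ assms])
  let ?F = "\<lambda>p :: int list list \<times> nat list.
    fold (\<lambda>i s. (Suc i, snd s + entry (fst p) (fst s) (Suc i))) (snd p) (0, 0)"
  have "ptime UNIV ?F"
  proof (rule ptime_fold_add[where q = "[:5, 1:]"])
    fix p :: "int list list \<times> nat list" and i :: nat and s :: "nat \<times> int"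
    \<comment> \<open>An entry is no larger than the table it is read from, apart from the default,
      so each round adds a bounded amount.\<close>
    have "sz (entry (fst p) (fst s) (Suc i)) \<le> 2 + sz (fst p)"
      using sz_nth_default[of 0 "nth_default [] (fst p) (fst s)" "Suc i"]
        sz_nth_default[of "[]" "fst p" "fst s"] by (simp add: entry_def floorlog_def)
    moreover have "sz (fst p) \<le> sz p" "sz s = 1 + sz (fst s) + sz (snd s)"
      by (cases p; simp) (cases s; simp)
    ultimately show "sz (Suc i, snd s + entry (fst p) (fst s) (Suc i)) \<le> sz s + poly [:5, 1:] (sz p + sz i)"
      using sz_Suc[of i] sz_add_int[of "snd s" "entry (fst p) (fst s) (Suc i)"]
      by (simp del: enc_nat_simp enc_int_def)
  qed (intro ptime_base ptime_entry)+
  then have "ptime UNIV (\<lambda>p. snd (?F p) + entry (fst p) (fst (?F p)) 0)"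
    by (intro ptime_base ptime_entry)
  then show "ptime UNIV (\<lambda>p. route (entry (fst p)) 0 (snd p))"
    using route_fold[of "entry _" 0 _ 0] by (simp add: Let_def)
qed

section \<open>Running time of cutting cycles into groups\<close>

lemma ptime_pair_up: "ptime A f \<Longrightarrow> ptime A (\<lambda>x. pair_up (f x))"
proof (rule ptime_comp1[of pair_up])
  \<comment> \<open>The result is built in reverse; a singleton at its head is a pair still waiting
    for its second member.\<close>
  let ?g = "\<lambda>x gs. if gs \<noteq> [] \<and> tl (hd gs) = [] then (hd gs @ [x]) # tl gs else [x] # gs"
  have "fold ?g xs gs = rev (pair_up xs) @ gs" if "gs \<noteq> [] \<Longrightarrow> tl (hd gs) \<noteq> []"
    for xs :: "'b list" and gs
    using that by (induction xs arbitrary: gs rule: pair_up.induct) auto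
  from this[of "[]"] have eq: "rev (fold ?g xs []) = pair_up xs" for xs :: "'b list" by simp
  have "ptime UNIV (\<lambda>xs :: 'b list. fold ?g xs [])"
  proof (rule ptime_fold_add[where q = "[:5, 1:]"], goal_cases)
    case 3
    show ?case by (intro ptime_base ptime_hd) auto
  next
    case (4 xs x gs)
    show ?case
    proof (cases "gs \<noteq> [] \<and> tl (hd gs) = []")
      case True
      then obtain g hs where "gs = g # hs" by (cases gs) auto
      then show ?thesis using True sz_append[of g "[x]"] by (simp add: floorlog_def)
    next
      case False
      then show ?thesis by (simp only: if_False) (simp add: floorlog_def)
    qed
  qed (intro ptime_base)+
  then have "ptime UNIV (\<lambda>xs :: 'b list. rev (fold ?g xs []))" by (rule ptime_rev)
  then show "ptime UNIV (\<lambda>xs :: 'b list. pair_up xs)" unfolding eq .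
qed

lemma ptime_triple_up: "ptime A f \<Longrightarrow> ptime A (\<lambda>x. triple_up (f x))"
proof (rule ptime_comp1[of triple_up])
  show "ptime UNIV (\<lambda>xs :: 'b list. triple_up xs)"
    unfolding triple_up_def by (intro ptime_base ptime_pair_up ptime_hd) auto
qed

lemma ptime_rotate1: "ptime A f \<Longrightarrow> ptime A (\<lambda>x. rotate1 (f x))"
proof (rule ptime_comp1[of rotate1])
  have "ptime UNIV (\<lambda>xs :: 'b list. if xs = [] then [] else tl xs @ [hd xs])"
    by (intro ptime_base ptime_hd) auto
  moreover have "(if xs = [] then [] else tl xs @ [hd xs]) = rotate1 xs" for xs :: "'b list"
    by (cases xs) auto
  ultimately show "ptime UNIV (\<lambda>xs :: 'b list. rotate1 xs)" by simp
qed

lemma sz_rotate: "sz (rotate k xs) = sz xs"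
proof (induction k)
  case (Suc k)
  have "sz (ys @ [a]) = 1 + sz a + sz ys" for a :: 'a and ys
    by (induction ys) auto
  then have "sz (rotate1 ys) = sz ys" for ys :: "'a list" by (cases ys) auto
  with Suc show ?case by simp
qed simp

lemma ptime_rotations: "ptime A f \<Longrightarrow> ptime A (\<lambda>x. rotations (f x))"
proof (rule ptime_comp1[of rotations])
  let ?g = "\<lambda>_ acc. rotate1 (hd acc) # acc"
  have ne: "fold ?g ys [xs] \<noteq> []" for xs ys :: "'b list"
    by (induction ys rule: rev_induct) auto
  have len: "length (fold ?g ys [xs]) = Suc (length ys)" for xs ys :: "'b list"
    by (induction ys rule: rev_induct) auto
  have mem: "hd (fold ?g ys [xs]) = rotate (length ys) xs \<and>
    (\<forall>z\<in>set (fold ?g ys [xs]). sz z = sz xs)" for xs ys :: "'b list"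
  proof (induction ys rule: rev_induct)
    case (snoc y ys)
    then show ?case using sz_rotate[of "Suc (length ys)" xs] by simp
  qed simp
  show "ptime UNIV (\<lambda>xs :: 'b list. rotations xs)"
    unfolding rotations_def
  proof (rule ptime_fold[where q = "1 + ([:1, 1:]) * ([:0, 1:] + 1)"], goal_cases)
    case 3
    show ?case by (intro ptime_base ptime_rotate1 ptime_hd) (use ne in auto)
  next
    case (4 xs ys zs)
    have "sz (fold ?g ys [xs]) \<le> 1 + Suc (sz xs) * (sz xs + 1)"
    proof (rule sz_list_bound)
      show "sz z \<le> sz xs" if "z \<in> set (fold ?g ys [xs])" for z using mem[of ys xs] that by simp
      show "length (fold ?g ys [xs]) \<le> Suc (sz xs)"
        using length_le_sz[of xs] 4(2) unfolding len by simp
    qed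
    then show ?case by (simp add: algebra_simps)
  qed (intro ptime_base)+
qed

lemma ptime_split_group:
  assumes "ptime A dl" "ptime A g"
  shows "ptime A (\<lambda>x. split_group (nth_default 0 (dl x)) (g x))"
proof (rule ptime_comp2[of "\<lambda>dl g. split_group (nth_default 0 dl) g", OF _ assms])
  show "ptime UNIV (\<lambda>p. split_group (nth_default 0 (fst p)) (snd p))"
    unfolding split_group_def by (intro ptime_base ptime_sum_list_nat)
qed

lemma ptime_candidates:
  assumes "ptime A dl" "ptime A xs"
  shows "ptime A (\<lambda>x. candidates (nth_default 0 (dl x)) (xs x))"
proof (rule ptime_comp2[of "\<lambda>dl xs. candidates (nth_default 0 dl) xs", OF _ assms])
  show "ptime UNIV (\<lambda>p. candidates (nth_default 0 (fst p)) (snd p))"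
    unfolding candidates_def
    by (intro ptime_base ptime_split_group ptime_pair_up ptime_triple_up ptime_rotations)
qed

lemma candidates_not_Nil: "candidates d xs \<noteq> []"
  using candidates_pair[of d 0 xs] by force

lemma ptime_best_groups:
  assumes "ptime A dl" "ptime A W" "ptime A xs"
  shows "ptime A (\<lambda>x. best_groups (nth_default 0 (dl x)) (entry (W x)) (xs x))"
proof (rule ptime_comp3[of "\<lambda>dl W xs. best_groups (nth_default 0 dl) (entry W) xs", OF _ assms])
  show "ptime UNIV (\<lambda>p. best_groups (nth_default 0 (fst p)) (entry (fst (snd p))) (snd (snd p)))"
    unfolding best_groups_def groups_cost_def
    by (intro ptime_min_by ptime_base ptime_candidates ptime_route) (rule candidates_not_Nil)
qed

lemma ptime_vrp_groups: "ptime A x \<Longrightarrow> ptime A (\<lambda>y. vrp_groups (x y))"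
proof (rule ptime_comp1[of vrp_groups])
  let ?h = "\<lambda>x. hungarian (length (fst x)) (benefit (nth_default 0 (fst x)) (entry (snd x)))"
  \<comment> \<open>\<open>benefit\<close> is nonnegative for arbitrary tables, so the Hungarian
    method yields a matching on every input and keeps the promise made to
    \<open>ptime_cycles_of\<close>.\<close>
  have M: "matching (length (fst x)) (fst (snd (snd (?h x))))" for x
    using hungarian[of "benefit (nth_default 0 (fst x)) (entry (snd x))" "length (fst x)"]
      benefit_nonneg by (metis fst_conv snd_conv)
  show "ptime UNIV vrp_groups"
    unfolding vrp_groups_def solve_groups_def
    by (intro ptime_base ptime_best_groups ptime_cycles_of ptime_hungarian M)
qed

lemma ptime_common_denominator: "ptime A f \<Longrightarrow> ptime A (\<lambda>x. common_denominator (f x))"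
  by (rule ptime_comp1[of common_denominator]) (unfold common_denominator_def, intro ptime_base)

lemma ptime_scaled: "ptime A f \<Longrightarrow> ptime A (\<lambda>x. scaled (f x))"
  by (rule ptime_comp1[of scaled]) (unfold scaled_def, intro ptime_base ptime_common_denominator)

lemma ptime_vrp_solve: "ptime A vrp_solve"
proof -
  have "ptime UNIV vrp_solve"
    unfolding vrp_solve_def by (intro ptime_base ptime_vrp_groups ptime_scaled)
  then show ?thesis by (rule ptime_subset) simp
qed

lemma enc_cvrp_data: "enc_cvrp I = enc (cvrp_data I)"
  by (simp add: enc_cvrp_def cvrp_data_def enc_list_inst enc_nat_inst enc_rat_inst enc_prod_def)

lemma enc_itinerary_eq: "enc_itinerary S = enc S"
proof -
  have "(\<lambda>(v, a). Node (enc_nat v) (enc_nat a)) = (enc :: nat \<times> nat \<Rightarrow> val)"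
    by (auto simp: enc_prod_def enc_nat_inst)
  then show ?thesis by (simp add: enc_itinerary_def enc_list_inst)
qed

theorem theorem6:
  "\<exists>P. approximation_algorithm (3/2)
        {I. cvrp_instance 3 I} (\<lambda>I. {S. feasible 3 I S \<and> unsplittable I S}) itinerary_cost
        enc_cvrp enc_itinerary P"
proof -
  obtain P q where P: "\<And>x. \<exists>t. run P (enc x) t (enc (vrp_solve x)) \<and> t \<le> poly q (sz x)"
    using ptime_vrp_solve[of UNIV] unfolding ptime_def by (metis UNIV_I)
  show ?thesis
  proof (intro exI[of _ P], unfold approximation_algorithm_def, intro conjI ballI)
    show "poly_time (enc_cvrp ` {I. cvrp_instance 3 I}) P"
      unfolding poly_time_def enc_cvrp_data using P by (intro exI[of _ q]) blast
    fix I assume "I \<in> {I. cvrp_instance 3 I}"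
    then have I: "cvrp_instance 3 I" by simp
    let ?S = "vrp_solve (cvrp_data I)" and ?sol = "{S. feasible 3 I S \<and> unsplittable I S}"
    have S: "?S \<in> ?sol" using vrp_solve_feasible[OF I] by simp
    \<comment> \<open>With the ratio on the left the claim is a lower bound for each feasible cost,
      which passes to the infimum; \<open>?S\<close> itself shows that the set is nonempty.\<close>
    have "2 / 3 * itinerary_cost I ?S \<le> (INF S'\<in>?sol. itinerary_cost I S')"
      using S vrp_solve_cost[OF I] by (intro cINF_greatest) (blast, force)
    then have "itinerary_cost I ?S \<le> 3 / 2 * (INF S'\<in>?sol. itinerary_cost I S')" by simp
    then show "\<exists>t S. run P (enc_cvrp I) t (enc_itinerary S) \<and> S \<in> ?sol \<and>
        itinerary_cost I S \<le> 3 / 2 * (INF S'\<in>?sol. itinerary_cost I S')"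
      using P[of "cvrp_data I"] S unfolding enc_cvrp_data enc_itinerary_eq by blast
  qed
qed

end
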